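(* Let $K$ be a compact Hausdorff space, $X$ a complex Banach space, and $A(K,X)$ a function space over the base algebra $A$. Then $A(K,X)$ has the polynomial Daugavet property if and only if either $A$ or $X$ has the polynomial Daugavet property.
   Context: $C(K)$ and $C(K,X)$ are the spaces of continuous complex-valued, respectively $X$-valued, functions on $K$ with the supremum norm. A uniform algebra on $K$ is a closed subalgebra of $C(K)$ that separates the points of $K$ and contains the constant functions. A subspace $A(K,X)$ of $C(K,X)$ is called a function space over the base algebra $A$ if: (i) $A := \{x^*\circ f : x^* \in X^*, f \in A(K,X)\}$ is a uniform algebra on $K$; (ii) $A\otimes X := \{f\otimes x : f\in A, x\in X\} \subset A(K,X)$, where $(f\otimes x)(t)=f(t)x$; (iii) $g\cdot f \in A(K,X)$ for every $g\in A$ and $f\in A(K,X)$. For a space $Z$, a bounded $k$-homogeneous polynomial on $Z$ is a map $z\mapsto F(z,\dots,z)$ with $F: Z^k\to Z$ bounded $k$-linear; a polynomial is a finite sum of bounded homogeneous polynomials, with norm $\|P\|=\sup_{z\in B_Z}\|Pz\|$ ($B_Z$ the closed unit ball). A polynomial $P$ is weakly compact if $P(B_Z)$ is relatively weakly compact. $Z$ has the polynomial Daugavet property if $\|I+P\|=1+\|P\|$ for every weakly compact polynomial $P:Z\to Z$, where $I$ is the identity on $Z$. *)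

theory Defs
  imports "HOL-Analysis.Analysis"
begin

section \<open>Complex normed spaces\<close>

class scaleC = scaleR +
  fixes scaleC :: "complex \<Rightarrow> 'a \<Rightarrow> 'a"  (infixr \<open>*\<^sub>C\<close> 75)
  assumes scaleR_scaleC: "r *\<^sub>R x = complex_of_real r *\<^sub>C x"

class complex_vector = scaleC + real_vector +
  assumes scaleC_add_right: "a *\<^sub>C (x + y) = a *\<^sub>C x + a *\<^sub>C y"
    and scaleC_add_left: "(a + b) *\<^sub>C x = a *\<^sub>C x + b *\<^sub>C x"
    and scaleC_scaleC: "a *\<^sub>C b *\<^sub>C x = (a * b) *\<^sub>C x"
    and scaleC_one: "1 *\<^sub>C x = x"

class complex_normed_vector = complex_vector + real_normed_vector +
  assumes norm_scaleC: "norm (a *\<^sub>C x) = cmod a * norm x"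

class cbanach = complex_normed_vector + banach

global_interpretation complex_vector: vector_space "scaleC :: complex \<Rightarrow> 'a \<Rightarrow> 'a::complex_vector"
  defines csubspace = complex_vector.subspace
  by unfold_locales (simp_all add: scaleC_add_right scaleC_add_left scaleC_scaleC scaleC_one)

instantiation complex :: cbanach
begin

definition scaleC_complex :: "complex \<Rightarrow> complex \<Rightarrow> complex"
  where [simp]: "scaleC_complex a z = a * z"

instance
  by standard (simp_all add: algebra_simps norm_mult scaleR_conv_of_real)

end

section \<open>Spaces of continuous functions\<close>

text \<open>
  A compact Hausdorff space \<open>K\<close> is given by a type of class \<open>t2_space\<close> whose universe is
  compact, and \<open>C(K,X)\<close> is then the whole type of bounded continuous functions.
\<close>

lemma bcontfun_scaleC_pointwise:
  fixes f :: "'k::topological_space \<Rightarrow> 'x::complex_normed_vector"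
  assumes "g \<in> bcontfun" "f \<in> bcontfun"
  shows "(\<lambda>t. g t *\<^sub>C f t) \<in> bcontfun"
proof -
  have bb: "bounded_bilinear (scaleC :: complex \<Rightarrow> 'x \<Rightarrow> 'x)"
  proof
    show "\<exists>K. \<forall>a b. norm (a *\<^sub>C (b::'x)) \<le> norm a * norm b * K"
      by (rule exI[of _ 1]) (simp add: norm_scaleC)
  qed (simp_all add: scaleC_add_right scaleC_add_left scaleR_scaleC scaleC_scaleC mult.commute
        scaleR_conv_of_real)
  have "continuous_on UNIV (\<lambda>t. g t *\<^sub>C f t)"
    using assms by (auto simp: bcontfun_def intro: bounded_bilinear.continuous_on[OF bb])
  moreover obtain B C where "\<And>t. norm (g t) \<le> B" "\<And>t. norm (f t) \<le> C"
    using assms by (auto simp: bcontfun_def bounded_iff)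
  then have "norm (g t *\<^sub>C f t) \<le> B * C" for t
    unfolding norm_scaleC by (meson mult_mono norm_ge_zero order_trans)
  ultimately show ?thesis
    by (rule bcontfun_normI)
qed

unbundle bcontfun.lifting

instantiation bcontfun :: (topological_space, complex_normed_vector) complex_normed_vector
begin

lift_definition scaleC_bcontfun :: "complex \<Rightarrow> ('a \<Rightarrow>\<^sub>C 'b) \<Rightarrow> ('a \<Rightarrow>\<^sub>C 'b)"
  is "\<lambda>c f t. c *\<^sub>C f t"
  by (rule bcontfun_scaleC_pointwise[OF const_bcontfun])

instance
proof
  fix a b :: complex and r :: real and f g :: "'a \<Rightarrow>\<^sub>C 'b"
  show "r *\<^sub>R f = complex_of_real r *\<^sub>C f"
    by transfer (simp add: scaleR_scaleC)
  show "a *\<^sub>C (f + g) = a *\<^sub>C f + a *\<^sub>C g"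
    by transfer (simp add: scaleC_add_right)
  show "(a + b) *\<^sub>C f = a *\<^sub>C f + b *\<^sub>C f"
    by transfer (simp add: scaleC_add_left)
  show "a *\<^sub>C b *\<^sub>C f = (a * b) *\<^sub>C f"
    by transfer (simp add: scaleC_scaleC)
  show "1 *\<^sub>C f = f"
    by transfer (simp add: scaleC_one)
  have *: "norm (c *\<^sub>C h) \<le> cmod c * norm h" for c and h :: "'a \<Rightarrow>\<^sub>C 'b"
    by (rule norm_bound)
      (simp add: scaleC_bcontfun.rep_eq norm_scaleC norm_bounded mult_left_mono)
  have inv: "inverse a *\<^sub>C a *\<^sub>C f = f" if "a \<noteq> 0"
    using that by transfer (simp add: scaleC_scaleC scaleC_one)
  show "norm (a *\<^sub>C f) = cmod a * norm f"
  proof (cases "a = 0")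
    case True
    with *[of 0 f] show ?thesis by simp
  next
    case False
    have "cmod a * norm f \<le> cmod a * (cmod (inverse a) * norm (a *\<^sub>C f))"
      using *[of "inverse a" "a *\<^sub>C f"] inv[OF False] by (simp add: mult_left_mono)
    also have "\<dots> = norm (a *\<^sub>C f)"
      using False by (simp add: norm_inverse)
    finally show ?thesis
      using *[of a f] by simp
  qed
qed

end

text \<open>
  The pointwise product \<open>g \<cdot> f\<close>; since \<open>scaleC\<close> is multiplication on \<^typ>\<open>complex\<close>, for \<open>X = \<complex>\<close>
  this is the product of the algebra \<open>C(K)\<close>.
\<close>

lift_definition cmult_bcontfun ::
    "('k::topological_space \<Rightarrow>\<^sub>C complex) \<Rightarrow> ('k \<Rightarrow>\<^sub>C 'x::complex_normed_vector) \<Rightarrow> ('k \<Rightarrow>\<^sub>C 'x)"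
  is "\<lambda>g f t. g t *\<^sub>C f t"
  by (rule bcontfun_scaleC_pointwise)

lift_definition tensor_bcontfun ::
    "('k::topological_space \<Rightarrow>\<^sub>C complex) \<Rightarrow> 'x::complex_normed_vector \<Rightarrow> ('k \<Rightarrow>\<^sub>C 'x)"
  is "\<lambda>f x t. f t *\<^sub>C x"
  by (rule bcontfun_scaleC_pointwise[OF _ const_bcontfun])

section \<open>Dual space and weak topology\<close>

text \<open>
  Normed spaces are given as (not necessarily closed) complex subspaces \<open>Z\<close> of an ambient normed
  space, so that the same notions apply to \<open>X\<close> (as \<^term>\<open>UNIV\<close>), to \<open>A\<close> and to \<open>A(K,X)\<close>.
  Everything is intrinsic to \<open>Z\<close>: values of maps outside \<open>Z\<close> are irrelevant.
\<close>

definition cdual :: "'z::complex_normed_vector set \<Rightarrow> ('z \<Rightarrow> complex) set" where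
  "cdual Z = {\<phi>. (\<forall>u\<in>Z. \<forall>v\<in>Z. \<phi> (u + v) = \<phi> u + \<phi> v) \<and>
                 (\<forall>c. \<forall>u\<in>Z. \<phi> (c *\<^sub>C u) = c * \<phi> u) \<and>
                 (\<exists>M. \<forall>u\<in>Z. cmod (\<phi> u) \<le> M * norm u)}"

definition weak_topology :: "'z::complex_normed_vector set \<Rightarrow> 'z topology" where
  "weak_topology Z = topology_generated_by {{z\<in>Z. \<phi> z \<in> U} | \<phi> U. \<phi> \<in> cdual Z \<and> open U}"

definition relatively_weakly_compact :: "'z::complex_normed_vector set \<Rightarrow> 'z set \<Rightarrow> bool" where
  "relatively_weakly_compact Z S \<longleftrightarrow>
     S \<subseteq> Z \<and> compactin (weak_topology Z) (weak_topology Z closure_of S)"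

section \<open>Polynomials and the polynomial Daugavet property\<close>

text \<open>
  \<open>Z\<^sup>k\<close> is the extensional function space \<open>{..<k} \<rightarrow>\<^sub>E Z\<close>.  For \<open>k = 0\<close> it is a singleton, so that
  the \<open>0\<close>-homogeneous polynomials are the constants.
\<close>

definition bounded_multilinear_on ::
    "nat \<Rightarrow> 'z::complex_normed_vector set \<Rightarrow> ((nat \<Rightarrow> 'z) \<Rightarrow> 'z) \<Rightarrow> bool" where
  "bounded_multilinear_on k Z F \<longleftrightarrow>
     F \<in> ({..<k} \<rightarrow>\<^sub>E Z) \<rightarrow> Z \<and>
     (\<forall>z \<in> {..<k} \<rightarrow>\<^sub>E Z. \<forall>i<k. \<forall>u\<in>Z. \<forall>v\<in>Z. \<forall>a b.
        F (z(i := a *\<^sub>C u + b *\<^sub>C v)) = a *\<^sub>C F (z(i := u)) + b *\<^sub>C F (z(i := v))) \<and>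
     (\<exists>M. \<forall>z \<in> {..<k} \<rightarrow>\<^sub>E Z. norm (F z) \<le> M * (\<Prod>i<k. norm (z i)))"

definition homogeneous_polynomial_on ::
    "nat \<Rightarrow> 'z::complex_normed_vector set \<Rightarrow> ('z \<Rightarrow> 'z) \<Rightarrow> bool" where
  "homogeneous_polynomial_on k Z P \<longleftrightarrow>
     (\<exists>F. bounded_multilinear_on k Z F \<and> (\<forall>z\<in>Z. P z = F (\<lambda>i\<in>{..<k}. z)))"

definition polynomial_on :: "'z::complex_normed_vector set \<Rightarrow> ('z \<Rightarrow> 'z) \<Rightarrow> bool" where
  "polynomial_on Z P \<longleftrightarrow>
     (\<exists>(n::nat) Q. (\<forall>j<n. \<exists>k. homogeneous_polynomial_on k Z (Q j)) \<and>
                   (\<forall>z\<in>Z. P z = (\<Sum>j<n. Q j z)))"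

definition poly_norm :: "'z::complex_normed_vector set \<Rightarrow> ('z \<Rightarrow> 'z) \<Rightarrow> real" where
  "poly_norm Z P = (SUP z \<in> Z \<inter> cball 0 1. norm (P z))"

definition weakly_compact_polynomial_on ::
    "'z::complex_normed_vector set \<Rightarrow> ('z \<Rightarrow> 'z) \<Rightarrow> bool" where
  "weakly_compact_polynomial_on Z P \<longleftrightarrow>
     polynomial_on Z P \<and> relatively_weakly_compact Z (P ` (Z \<inter> cball 0 1))"

definition polynomial_Daugavet_property :: "'z::complex_normed_vector set \<Rightarrow> bool" where
  "polynomial_Daugavet_property Z \<longleftrightarrow>
     (\<forall>P. weakly_compact_polynomial_on Z P \<longrightarrow> poly_norm Z (\<lambda>z. z + P z) = 1 + poly_norm Z P)"

section \<open>Uniform algebras and function spaces\<close>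

definition uniform_algebra :: "('k::t2_space \<Rightarrow>\<^sub>C complex) set \<Rightarrow> bool" where
  "uniform_algebra A \<longleftrightarrow>
     csubspace A \<and> closed A \<and>
     (\<forall>f\<in>A. \<forall>g\<in>A. cmult_bcontfun f g \<in> A) \<and>
     (\<forall>c. const_bcontfun c \<in> A) \<and>
     (\<forall>s t. s \<noteq> t \<longrightarrow> (\<exists>f\<in>A. apply_bcontfun f s \<noteq> apply_bcontfun f t))"

definition function_space_over ::
    "('k::t2_space \<Rightarrow>\<^sub>C complex) set \<Rightarrow> ('k \<Rightarrow>\<^sub>C 'x::complex_normed_vector) set \<Rightarrow> bool" where
  "function_space_over A AKX \<longleftrightarrow>
     csubspace AKX \<and>
     A = {g. \<exists>\<phi> \<in> cdual (UNIV :: 'x set). \<exists>f\<in>AKX. apply_bcontfun g = \<phi> \<circ> apply_bcontfun f} \<and>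
     uniform_algebra A \<and>
     {tensor_bcontfun f x | f x. f \<in> A} \<subseteq> AKX \<and>
     (\<forall>g\<in>A. \<forall>f\<in>AKX. cmult_bcontfun g f \<in> AKX)"

end

theory Submission
  imports Defs
begin

text \<open>
  Call \<open>s\<close> an atom if the indicator function of \<open>{s}\<close> belongs to \<open>A\<close>.  If there is an atom \<open>s\<close>,
  the operator \<open>f \<mapsto> - f s \<cdot> 1\<^sub>s\<close> shows that \<open>A\<close> fails the Daugavet property, and composing with the
  evaluation at \<open>s\<close> turns polynomials on \<open>X\<close> into polynomials on \<open>A(K,X)\<close>.  It remains to see that
  \<open>A(K,X)\<close> has the property if \<open>X\<close> has it or there are no atoms.

  Let \<open>P\<close> almost attain its norm at \<open>f\<close>, and let \<open>\<phi>\<close> norm \<open>P f\<close> at a point of \<open>K\<close>.  There is a point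
  \<open>s\<close> of the Shilov boundary where \<open>Re \<phi>(P f)\<close> is still large.  If \<open>s\<close> is isolated in the Shilov
  boundary, then it is an atom, and only the value of \<open>f\<close> at \<open>s\<close> has to be changed, as prescribed by
  the property of \<open>X\<close>.  Otherwise there are infinitely many almost disjoint peak functions near \<open>s\<close>;
  moving \<open>f\<close> to a prescribed value on their peak sets spans a copy of \<open>c\<^sub>0\<close>, along which scalar
  polynomials converge, and weak compactness of \<open>P\<close> makes \<open>P f\<close> stay large at some new peak point.
\<close>

section \<open>Norming functionals\<close>

text \<open>The obstacle is that a weakly compact polynomial need not be weakly continuous, so a
  weakly null perturbation of \<open>f\<close> need not leave \<open>P f\<close> almost unchanged.
  Increments with uniformly bounded finite sums are better: along them scalar polynomials bounded on
  balls converge, which gives convergence of \<open>P (f + e n)\<close> at each fixed point of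
  \<open>K\<close>. This is pointwise only, whereas the peak point of the perturbation moves with
  \<open>n\<close>; weak compactness closes this gap by an interchange of limits. The Shilov
  boundary is the right place to look for isolated points because estimates for members of
  \<open>A\<close> pass from it to all of \<open>K\<close>, so that powers of a suitable function
  converge uniformly to an indicator. Norms are kept strictly below \<open>1\<close> because the
  peak functions satisfy \<open>cmod h + cmod (1 - h) \<le> 1 + \<kappa>\<close> only for some
  positive \<open>\<kappa>\<close>. Finally, \<open>A\<close> is a function space over itself, with
  the scalars as range, so that the case without atoms covers \<open>A\<close> as well.\<close>

definition sublinear :: "('a::real_vector \<Rightarrow> real) \<Rightarrow> bool" where
  "sublinear p \<longleftrightarrow> (\<forall>x y. p (x + y) \<le> p x + p y) \<and> (\<forall>c>0. \<forall>x. p (c *\<^sub>R x) \<le> c * p x)"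

lemma sublinearD:
  assumes "sublinear p"
  shows sublinear_add: "p (x + y) \<le> p x + p y"
    and sublinear_scaleR: "c \<ge> 0 \<Longrightarrow> p (c *\<^sub>R x) = c * p x"
    and sublinear_minus: "- p (- x) \<le> p x"
proof -
  have hom: "p (c *\<^sub>R x) = c * p x" if "c > 0" for c x
  proof (rule antisym)
    show "p (c *\<^sub>R x) \<le> c * p x" using assms that by (auto simp: sublinear_def)
    have "p (inverse c *\<^sub>R (c *\<^sub>R x)) \<le> inverse c * p (c *\<^sub>R x)"
      using assms that unfolding sublinear_def by (meson positive_imp_inverse_positive)
    then show "c * p x \<le> p (c *\<^sub>R x)" using that by (simp add: field_simps)
  qed
  have p0: "p 0 = 0" using hom[of 2 0] by simp
  show add: "p (x + y) \<le> p x + p y" for x y using assms by (auto simp: sublinear_def)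
  show "c \<ge> 0 \<Longrightarrow> p (c *\<^sub>R x) = c * p x" using hom[of c x] p0 by (cases "c = 0") auto
  show "- p (- x) \<le> p x" using add[of x "- x"] p0 by simp
qed

text \<open>
  The Hahn--Banach theorem for the norm: since \<open>descent p x\<close> is a sublinear functional below \<open>p\<close>, a
  minimal sublinear functional is linear.
\<close>

definition descent :: "('a::real_vector \<Rightarrow> real) \<Rightarrow> 'a \<Rightarrow> 'a \<Rightarrow> real" where
  "descent p x y = (INF t\<in>{0..}. p (y + t *\<^sub>R x) - t * p x)"

lemma descent_le:
  assumes "sublinear p" "t \<ge> 0"
  shows "descent p x y \<le> p (y + t *\<^sub>R x) - t * p x"
  unfolding descent_def
proof (rule cINF_lower)
  show "bdd_below ((\<lambda>t. p (y + t *\<^sub>R x) - t * p x) ` {0..})"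
  proof (rule bdd_belowI2)
    fix t :: real assume "t \<in> {0..}"
    then have "t * p x = p ((y + t *\<^sub>R x) + - y)"
      using sublinear_scaleR[OF assms(1)] by simp
    also have "\<dots> \<le> p (y + t *\<^sub>R x) + p (- y)" by (rule sublinear_add[OF assms(1)])
    finally show "- p (- y) \<le> p (y + t *\<^sub>R x) - t * p x" by simp
  qed
qed (use assms in auto)

lemma descent_greatest:
  assumes "\<And>t. t \<ge> 0 \<Longrightarrow> m \<le> p (y + t *\<^sub>R x) - t * p x"
  shows "m \<le> descent p x y"
  unfolding descent_def by (rule cINF_greatest) (use assms in auto)

text \<open>The parameters \<open>t\<close> for \<open>y\<close> and \<open>u\<close> for
  \<open>z\<close> combine to the parameter \<open>t + u\<close> for \<open>y + z\<close>, and
  scaling by \<open>c\<close> sends \<open>t\<close> to \<open>c * t\<close>.\<close>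

lemma sublinear_descent:
  assumes "sublinear p"
  shows "sublinear (descent p x)"
  unfolding sublinear_def
proof (intro conjI allI impI)
  fix y z
  have "descent p x (y + z) - descent p x z \<le> descent p x y"
  proof (rule descent_greatest)
    fix t :: real assume t: "t \<ge> 0"
    have "descent p x (y + z) - (p (y + t *\<^sub>R x) - t * p x) \<le> descent p x z"
    proof (rule descent_greatest)
      fix u :: real assume u: "u \<ge> 0"
      have "descent p x (y + z) \<le> p ((y + z) + (t + u) *\<^sub>R x) - (t + u) * p x"
        using t u by (intro descent_le assms) auto
      also have "(y + z) + (t + u) *\<^sub>R x = (y + t *\<^sub>R x) + (z + u *\<^sub>R x)"
        by (simp add: algebra_simps)
      also have "p \<dots> \<le> p (y + t *\<^sub>R x) + p (z + u *\<^sub>R x)" by (rule sublinear_add[OF assms])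
      finally show "descent p x (y + z) - (p (y + t *\<^sub>R x) - t * p x) \<le> p (z + u *\<^sub>R x) - u * p x"
        by (simp add: algebra_simps)
    qed
    then show "descent p x (y + z) - descent p x z \<le> p (y + t *\<^sub>R x) - t * p x" by simp
  qed
  then show "descent p x (y + z) \<le> descent p x y + descent p x z" by simp
next
  fix c :: real and y assume c: "c > 0"
  have "descent p x (c *\<^sub>R y) / c \<le> descent p x y"
  proof (rule descent_greatest)
    fix t :: real assume t: "t \<ge> 0"
    have "descent p x (c *\<^sub>R y) \<le> p (c *\<^sub>R y + (c * t) *\<^sub>R x) - (c * t) * p x"
      using c t by (intro descent_le assms) auto
    also have "c *\<^sub>R y + (c * t) *\<^sub>R x = c *\<^sub>R (y + t *\<^sub>R x)" by (simp add: algebra_simps)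
    also have "p \<dots> = c * p (y + t *\<^sub>R x)" using c by (intro sublinear_scaleR assms) auto
    finally show "descent p x (c *\<^sub>R y) / c \<le> p (y + t *\<^sub>R x) - t * p x"
      using c by (simp add: field_simps)
  qed
  then show "descent p x (c *\<^sub>R y) \<le> c * descent p x y" using c by (simp add: field_simps)
qed

lemma minimal_sublinear_exists:
  fixes q :: "'a::real_vector \<Rightarrow> real"
  assumes q: "sublinear q"
  obtains p where "sublinear p" "p \<le> q" "\<And>r. sublinear r \<Longrightarrow> r \<le> p \<Longrightarrow> r = p"
proof -
  define S where "S = {p. sublinear p \<and> p \<le> q}"
  \<comment> \<open>These bounds keep the pointwise infima over chains finite.\<close>
  have lb: "- q (- x) \<le> p x" if "p \<in> S" for p x
  proof -
    have "p (- x) \<le> q (- x)" using that by (auto simp: S_def le_fun_def)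
    with sublinear_minus[of p x] that show ?thesis by (auto simp: S_def)
  qed
  have "\<exists>m\<in>S. \<forall>a\<in>S. a \<le> m \<longrightarrow> a = m"
  proof (rule predicate_Zorn[where P = "\<lambda>a b. b \<le> a"])
    show "partial_order_on S (relation_of (\<lambda>a b. b \<le> a) S)"
      by (rule partial_order_on_relation_ofI) auto
    fix C assume C: "C \<in> Chains (relation_of (\<lambda>a b. b \<le> a) S)"
    have CS: "C \<subseteq> S" using C by (auto simp: Chains_def relation_of_def)
    have tot: "p \<le> p' \<or> p' \<le> p" if "p \<in> C" "p' \<in> C" for p p'
      using C that by (auto simp: Chains_def relation_of_def)
    show "\<exists>u\<in>S. \<forall>a\<in>C. u \<le> a"
    proof (cases "C = {}")
      case True
      then show ?thesis using q by (auto simp: S_def)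
    next
      case False
      define u where "u x = (INF p\<in>C. p x)" for x
      have le: "u x \<le> p x" if "p \<in> C" for p x
        unfolding u_def using that CS lb by (intro cINF_lower bdd_belowI2[of _ "- q (- x)"]) auto
      have gr: "m \<le> u x" if "\<And>p. p \<in> C \<Longrightarrow> m \<le> p x" for m x
        unfolding u_def using that False by (intro cINF_greatest) auto
      have "sublinear u"
        unfolding sublinear_def
      proof (intro conjI allI impI)
        fix x y
        have "u (x + y) - u y \<le> u x"
        proof (rule gr)
          fix p assume p: "p \<in> C"
          have "u (x + y) - p x \<le> u y"
          proof (rule gr)
            fix p' assume p': "p' \<in> C"
            \<comment> \<open>In a chain the smaller of \<open>p\<close> and \<open>p'\<close> lies
              below both, so its subadditivity bounds the mixed sum.\<close>
            obtain r where r: "r \<in> C" "r \<le> p" "r \<le> p'" using tot[OF p p'] p p' by blast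
            have "u (x + y) \<le> r (x + y)" by (rule le[OF r(1)])
            also have "\<dots> \<le> r x + r y" using r CS by (intro sublinear_add) (auto simp: S_def)
            also have "\<dots> \<le> p x + p' y" using r by (intro add_mono) (auto simp: le_fun_def)
            finally show "u (x + y) - p x \<le> p' y" by simp
          qed
          then show "u (x + y) - u y \<le> p x" by simp
        qed
        then show "u (x + y) \<le> u x + u y" by simp
      next
        fix c :: real and x assume c: "c > 0"
        have "u (c *\<^sub>R x) / c \<le> u x"
        proof (rule gr)
          fix p assume p: "p \<in> C"
          then have "p (c *\<^sub>R x) = c * p x" using CS c by (intro sublinear_scaleR) (auto simp: S_def)
          with le[OF p, of "c *\<^sub>R x"] c show "u (c *\<^sub>R x) / c \<le> p x" by (simp add: field_simps)
        qed
        then show "u (c *\<^sub>R x) \<le> c * u x" using c by (simp add: field_simps)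
      qed
      moreover have "u \<le> q"
      proof -
        obtain p where "p \<in> C" using False by blast
        then show ?thesis using CS le[of p] by (auto simp: S_def le_fun_def intro: order_trans)
      qed
      ultimately show ?thesis using le by (auto simp: S_def le_fun_def)
    qed
  qed
  then obtain m where m: "m \<in> S" "\<And>a. a \<in> S \<Longrightarrow> a \<le> m \<Longrightarrow> a = m" by blast
  show ?thesis
  proof (rule that)
    show "sublinear m" "m \<le> q" using m(1) by (auto simp: S_def)
    show "r = m" if "sublinear r" "r \<le> m" for r
      using m(1) that by (intro m(2)) (auto simp: S_def intro: order_trans)
  qed
qed

text \<open>Minimality gives \<open>descent p x = p\<close>. The parameter \<open>t = 1\<close> at
  the point \<open>- x\<close> then yields \<open>p (- x) \<le> - p x\<close>, and a sublinear odd
  functional is linear.\<close>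

lemma minimal_sublinear_linear:
  assumes p: "sublinear p" and min: "\<And>r. sublinear r \<Longrightarrow> r \<le> p \<Longrightarrow> r = p"
  shows "linear p"
proof -
  have neg: "p (- x) = - p x" for x
  proof -
    have "descent p x \<le> p" using descent_le[OF p, of 0] by (auto simp: le_fun_def)
    then have "descent p x = p" by (intro min sublinear_descent p)
    then have "p (- x) \<le> p (- x + 1 *\<^sub>R x) - 1 * p x" using descent_le[OF p, of 1 x "- x"] by simp
    moreover have "p 0 = 0" using sublinear_scaleR[OF p, of 0 0] by simp
    ultimately show ?thesis using sublinear_minus[OF p, of x] by simp
  qed
  show ?thesis
  proof (rule linearI)
    fix x y
    have "p x \<le> p (x + y) + p (- y)" using sublinear_add[OF p, of "x + y" "- y"] by simp
    then show "p (x + y) = p x + p y" using neg[of y] sublinear_add[OF p, of x y] by simp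
  next
    fix c x
    show "p (c *\<^sub>R x) = c *\<^sub>R p x"
      using sublinear_scaleR[OF p, of c x] sublinear_scaleR[OF p, of "- c" x] neg[of "c *\<^sub>R x"]
      by (cases "c \<ge> 0") auto
  qed
qed

lemma norming_functional_exists:
  fixes x0 :: "'x::complex_normed_vector"
  obtains \<phi> where "\<phi> \<in> cdual UNIV" "\<phi> x0 = of_real (norm x0)" "\<And>x. cmod (\<phi> x) \<le> norm x"
proof -
  have norm: "sublinear (norm :: 'x \<Rightarrow> real)"
    by (simp add: sublinear_def norm_triangle_ineq)
  \<comment> \<open>The minimal functional is sought below \<open>descent norm x0\<close> rather
    than \<open>norm\<close>: the former is at most \<open>- norm x0\<close> at \<open>- x0\<close>,
    which forces \<open>L x0\<close> up to \<open>norm x0\<close>.\<close>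
  obtain L where L: "sublinear L" "L \<le> descent norm x0"
    and min: "\<And>r. sublinear r \<Longrightarrow> r \<le> L \<Longrightarrow> r = L"
    using minimal_sublinear_exists[OF sublinear_descent[OF norm, of x0]] by metis
  have lin: "linear L" by (rule minimal_sublinear_linear[OF L(1) min])
  note add = linear_add[OF lin] and scale = linear_scale[OF lin] and neg = linear_neg[OF lin]
  have le: "L x \<le> norm x" for x
    using le_funD[OF L(2), of x] descent_le[OF norm, of 0 x0 x] by simp
  have x0: "norm x0 \<le> L x0"
    using le_funD[OF L(2), of "- x0"] descent_le[OF norm, of 1 x0 "- x0"] neg[of x0] by simp
  \<comment> \<open>The imaginary part is dictated by compatibility with multiplication by
    \<open>\<i>\<close>.\<close>
  define \<phi> where "\<phi> x = Complex (L x) (- L (\<i> *\<^sub>C x))" for x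
  have scaleC: "c *\<^sub>C x = Re c *\<^sub>R x + Im c *\<^sub>R (\<i> *\<^sub>C x)" for c and x :: 'x
    by (simp add: scaleR_scaleC scaleC_scaleC mult.commute flip: scaleC_add_left complex_eq)
  have cadd: "\<phi> (u + v) = \<phi> u + \<phi> v" for u v
    by (simp add: \<phi>_def complex_eq_iff scaleC_add_right add)
  have cscale: "\<phi> (c *\<^sub>C u) = c * \<phi> u" for c u
  proof -
    have 1: "L (c *\<^sub>C u) = Re c * L u + Im c * L (\<i> *\<^sub>C u)" for c u
      by (subst scaleC) (simp add: add scale)
    have "\<i> *\<^sub>C c *\<^sub>C u = (\<i> * c) *\<^sub>C u" by (rule scaleC_scaleC)
    then show ?thesis using 1[of c u] 1[of "\<i> * c" u]
      by (simp add: \<phi>_def complex_eq_iff algebra_simps)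
  qed
  have bound: "cmod (\<phi> x) \<le> norm x" for x
  proof -
    \<comment> \<open>Rotating \<open>\<phi> x\<close> onto the positive axis reduces its modulus to
      a real part, where \<open>L \<le> norm\<close> applies.\<close>
    define c where "c = cnj (sgn (\<phi> x))"
    have "c * \<phi> x = of_real (cmod (\<phi> x))"
      by (simp add: c_def sgn_eq complex_norm_square[symmetric] mult.commute power2_eq_square)
    then have "cmod (\<phi> x) = Re (\<phi> (c *\<^sub>C x))" by (simp add: cscale)
    also have "\<dots> \<le> norm (c *\<^sub>C x)" using le by (simp add: \<phi>_def)
    also have "\<dots> \<le> 1 * norm x"
      unfolding norm_scaleC by (intro mult_right_mono) (auto simp: c_def norm_sgn)
    finally show ?thesis by simp
  qed
  have "\<phi> x0 = of_real (norm x0)"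
  proof -
    have Re: "Re (\<phi> x0) = norm x0" using x0 le[of x0] by (simp add: \<phi>_def)
    have "(cmod (\<phi> x0))\<^sup>2 \<le> (norm x0)\<^sup>2" using bound by (intro power_mono) auto
    then have "Im (\<phi> x0) = 0" by (simp add: cmod_power2 Re)
    with Re show ?thesis by (simp add: complex_eq_iff)
  qed
  moreover have "\<phi> \<in> cdual UNIV"
    unfolding cdual_def using cadd cscale bound by (auto intro!: exI[of _ 1])
  ultimately show ?thesis using that bound by blast
qed

section \<open>Complex subspaces and bounded linear maps between them\<close>

lemmas csubspace_0 = complex_vector.subspace_0
  and csubspace_add = complex_vector.subspace_add
  and csubspace_scale = complex_vector.subspace_scale
  and csubspace_diff = complex_vector.subspace_diff
  and csubspace_sum = complex_vector.subspace_sum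

lemma csubspace_UNIV [simp]: "csubspace UNIV"
  by (simp add: complex_vector.subspace_UNIV)

text \<open>Domain and target are sets so that evaluations, tensor embeddings and functionals on
  subspaces share one notion; for scalar maps into \<open>UNIV\<close> it is membership in
  \<open>cdual\<close>.\<close>

definition bounded_clinear_on ::
    "'a::complex_normed_vector set \<Rightarrow> 'b::complex_normed_vector set \<Rightarrow> ('a \<Rightarrow> 'b) \<Rightarrow> bool" where
  "bounded_clinear_on V W L \<longleftrightarrow>
     L ` V \<subseteq> W \<and> (\<forall>u\<in>V. \<forall>v\<in>V. L (u + v) = L u + L v) \<and>
     (\<forall>c. \<forall>u\<in>V. L (c *\<^sub>C u) = c *\<^sub>C L u) \<and> (\<exists>M. \<forall>u\<in>V. norm (L u) \<le> M * norm u)"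

lemma bounded_clinear_onI:
  assumes "\<And>u. u \<in> V \<Longrightarrow> L u \<in> W"
    and "\<And>u v. u \<in> V \<Longrightarrow> v \<in> V \<Longrightarrow> L (u + v) = L u + L v"
    and "\<And>c u. u \<in> V \<Longrightarrow> L (c *\<^sub>C u) = c *\<^sub>C L u"
    and "\<And>u. u \<in> V \<Longrightarrow> norm (L u) \<le> M * norm u"
  shows "bounded_clinear_on V W L"
  unfolding bounded_clinear_on_def using assms by blast

lemma bounded_clinear_onD:
  assumes "bounded_clinear_on V W L"
  shows "u \<in> V \<Longrightarrow> L u \<in> W" "u \<in> V \<Longrightarrow> v \<in> V \<Longrightarrow> L (u + v) = L u + L v"
    "u \<in> V \<Longrightarrow> L (c *\<^sub>C u) = c *\<^sub>C L u"
  using assms by (auto simp: bounded_clinear_on_def)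

lemma bounded_clinear_on_bound:
  assumes "bounded_clinear_on V W L"
  obtains M where "M \<ge> 0" "\<And>u. u \<in> V \<Longrightarrow> norm (L u) \<le> M * norm u"
proof -
  obtain M where "\<forall>u\<in>V. norm (L u) \<le> M * norm u" using assms by (auto simp: bounded_clinear_on_def)
  then have "norm (L u) \<le> \<bar>M\<bar> * norm u" if "u \<in> V" for u
    using that by (meson abs_ge_self mult_right_mono norm_ge_zero order_trans)
  then show ?thesis using that[of "\<bar>M\<bar>"] by simp
qed

section \<open>Calculus of polynomials\<close>

text \<open>One device for two purposes: a constant base \<open>w\<close> with all slots moving is
  the substitution of \<open>c + u\<close>, and varying the base produces the finite differences of
  a polynomial.\<close>

definition shifted_slots :: "nat \<Rightarrow> nat set \<Rightarrow> (nat \<Rightarrow> 'z) \<Rightarrow> 'z::plus \<Rightarrow> nat \<Rightarrow> 'z" where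
  "shifted_slots k T w u = (\<lambda>i\<in>{..<k}. if i \<in> T then w i + u else w i)"

lemma shifted_slots_in:
  assumes "csubspace Z" "\<And>i. w i \<in> Z" "u \<in> Z"
  shows "shifted_slots k T w u \<in> {..<k} \<rightarrow>\<^sub>E Z"
  using assms by (auto simp: shifted_slots_def csubspace_add)

lemma multilinear_slot:
  assumes F: "bounded_multilinear_on k Z F" and z: "z \<in> {..<k} \<rightarrow>\<^sub>E Z" and j: "j < k"
    and uv: "u \<in> Z" "v \<in> Z"
  shows "F (z(j := u + v)) = F (z(j := u)) + F (z(j := v))"
proof -
  have "F (z(j := 1 *\<^sub>C u + 1 *\<^sub>C v)) = 1 *\<^sub>C F (z(j := u)) + 1 *\<^sub>C F (z(j := v))"
    using assms unfolding bounded_multilinear_on_def by blast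
  then show ?thesis by (simp add: scaleC_one)
qed

lemma multilinear_slot_scale:
  assumes F: "bounded_multilinear_on k Z F" and z: "z \<in> {..<k} \<rightarrow>\<^sub>E Z" and j: "j < k" and u: "u \<in> Z"
  shows "F (z(j := c *\<^sub>C u)) = c *\<^sub>C F (z(j := u))"
proof -
  have "F (z(j := c *\<^sub>C u + 0 *\<^sub>C u)) = c *\<^sub>C F (z(j := u)) + 0 *\<^sub>C F (z(j := u))"
    using assms unfolding bounded_multilinear_on_def by blast
  then show ?thesis by simp
qed

lemma multilinear_split:
  assumes Z: "csubspace Z" and F: "bounded_multilinear_on k Z F"
    and T: "T \<subseteq> {..<k}" and j: "j \<in> T" and w: "\<And>i. w i \<in> Z" and u: "u \<in> Z" and ab: "a \<in> Z" "b \<in> Z"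
    and sum: "w j + u = a + b"
  shows "F (shifted_slots k T w u) =
    F (shifted_slots k (T - {j}) (w(j := a)) u) + F (shifted_slots k (T - {j}) (w(j := b)) u)"
proof -
  let ?z = "shifted_slots k T w u"
  have "F (?z(j := a + b)) = F (?z(j := a)) + F (?z(j := b))"
    using T j by (intro multilinear_slot[OF F shifted_slots_in[OF Z w u] _ ab]) auto
  moreover have "?z(j := a + b) = ?z" using T j sum by (auto simp: shifted_slots_def fun_eq_iff)
  moreover have "?z(j := c) = shifted_slots k (T - {j}) (w(j := c)) u" for c
    using T j by (auto simp: shifted_slots_def fun_eq_iff)
  ultimately show ?thesis by simp
qed

text \<open>Slot \<open>j\<close> on the left holds \<open>w j + u + v\<close>. Splitting off
  \<open>v\<close> leaves a term in which one slot fewer depends on \<open>u\<close>, which drives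
  the inductions below.\<close>

lemma multilinear_shifted_slots_add:
  assumes "csubspace Z" "bounded_multilinear_on k Z F" "T \<subseteq> {..<k}" "j \<in> T" "\<And>i. w i \<in> Z" "u \<in> Z" "v \<in> Z"
  shows "F (shifted_slots k T (w(j := w j + v)) u) =
    F (shifted_slots k T w u) + F (shifted_slots k (T - {j}) (w(j := v)) u)"
proof -
  have *: "shifted_slots k T w u = shifted_slots k (T - {j}) (w(j := w j + u)) u"
    using assms by (auto simp: shifted_slots_def fun_eq_iff)
  show ?thesis
    unfolding *
    using multilinear_split[of Z k F T j "w(j := w j + v)" u "w j + u" v] assms
    by (auto simp: csubspace_add algebra_simps)
qed

lemma multilinear_bound:
  assumes "bounded_multilinear_on k Z F"
  obtains M where "M \<ge> 0" "\<And>z. z \<in> {..<k} \<rightarrow>\<^sub>E Z \<Longrightarrow> norm (F z) \<le> M * (\<Prod>i<k. norm (z i))"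
proof -
  obtain M where M: "\<forall>z \<in> {..<k} \<rightarrow>\<^sub>E Z. norm (F z) \<le> M * (\<Prod>i<k. norm (z i))"
    using assms unfolding bounded_multilinear_on_def by blast
  have "norm (F z) \<le> \<bar>M\<bar> * (\<Prod>i<k. norm (z i))" if "z \<in> {..<k} \<rightarrow>\<^sub>E Z" for z
  proof -
    have "M * (\<Prod>i<k. norm (z i)) \<le> \<bar>M\<bar> * (\<Prod>i<k. norm (z i))"
      by (intro mult_right_mono prod_nonneg) auto
    then show ?thesis using M that by fastforce
  qed
  then show ?thesis using that[of "\<bar>M\<bar>"] by simp
qed

lemma homogeneous_polynomial_scale:
  assumes Z: "csubspace Z" and Q: "homogeneous_polynomial_on k Z Q" and z: "z \<in> Z"
  shows "Q (c *\<^sub>C z) = c ^ k *\<^sub>C Q z"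
proof -
  obtain F where F: "bounded_multilinear_on k Z F" and QF: "\<And>z. z \<in> Z \<Longrightarrow> Q z = F (\<lambda>i\<in>{..<k}. z)"
    using Q unfolding homogeneous_polynomial_on_def by blast
  have cz: "c *\<^sub>C z \<in> Z" using Z z by (rule csubspace_scale)
  have *: "F (\<lambda>i\<in>{..<k}. if i < m then c *\<^sub>C z else z) = c ^ m *\<^sub>C F (\<lambda>i\<in>{..<k}. z)"
    if "m \<le> k" for m
    using that
  proof (induction m)
    case 0
    then show ?case by (simp add: scaleC_one)
  next
    case (Suc m)
    let ?y = "\<lambda>i\<in>{..<k}. if i < m then c *\<^sub>C z else z"
    have "(\<lambda>i\<in>{..<k}. if i < Suc m then c *\<^sub>C z else z) = ?y(m := c *\<^sub>C z)"
      using Suc.prems by (auto simp: fun_eq_iff)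
    then have "F (\<lambda>i\<in>{..<k}. if i < Suc m then c *\<^sub>C z else z) = F (?y(m := c *\<^sub>C z))" by simp
    also have "\<dots> = c *\<^sub>C F (?y(m := z))"
      using Suc.prems cz z by (intro multilinear_slot_scale[OF F]) auto
    also have "?y(m := z) = ?y" using Suc.prems by (auto simp: fun_eq_iff)
    finally show ?case using Suc by (simp add: scaleC_scaleC)
  qed
  have "(\<lambda>i\<in>{..<k}. if i < k then c *\<^sub>C z else z) = (\<lambda>i\<in>{..<k}. c *\<^sub>C z)" by (auto simp: fun_eq_iff)
  with *[of k] show ?thesis using QF[OF z] QF[OF cz] by simp
qed

lemma polynomial_on_maps_to:
  assumes "csubspace Z" "polynomial_on Z P" "z \<in> Z"
  shows "P z \<in> Z"
proof -
  obtain n Q where Q: "\<And>j. j < (n::nat) \<Longrightarrow> \<exists>k. homogeneous_polynomial_on k Z (Q j)"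
    and P: "\<And>z. z \<in> Z \<Longrightarrow> P z = (\<Sum>j<n. Q j z)"
    using assms(2) unfolding polynomial_on_def by blast
  have "Q j z \<in> Z" if "j < n" for j
    using Q[OF that] assms(3)
    unfolding homogeneous_polynomial_on_def bounded_multilinear_on_def by (auto simp: Pi_iff)
  then show ?thesis using P[OF assms(3)] by (auto intro!: csubspace_sum[OF assms(1)])
qed

text \<open>This serves to replace a point of the closed ball by one of norm below \<open>1\<close>
  at which \<open>P\<close> is almost as large. Along a ray each homogeneous part is just a power of
  \<open>r\<close>.\<close>

lemma polynomial_on_radial_limit:
  assumes Z: "csubspace Z" and P: "polynomial_on Z P" and z: "z \<in> Z"
  shows "((\<lambda>r. P (r *\<^sub>R z)) \<longlongrightarrow> P z) (at_left 1)"
proof -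
  obtain n Q where Q: "\<And>j. j < (n::nat) \<Longrightarrow> \<exists>k. homogeneous_polynomial_on k Z (Q j)"
    and PQ: "\<And>z. z \<in> Z \<Longrightarrow> P z = (\<Sum>j<n. Q j z)"
    using P unfolding polynomial_on_def by blast
  obtain k where k: "\<And>j. j < n \<Longrightarrow> homogeneous_polynomial_on (k j) Z (Q j)" using Q by metis
  have "P (r *\<^sub>R z) = (\<Sum>j<n. r ^ k j *\<^sub>R Q j z)" for r
    using z by (auto simp: PQ scaleR_scaleC csubspace_scale[OF Z] homogeneous_polynomial_scale[OF Z k]
        intro!: sum.cong)
  moreover have "((\<lambda>r::real. \<Sum>j<n. r ^ k j *\<^sub>R Q j z) \<longlongrightarrow> (\<Sum>j<n. 1 ^ k j *\<^sub>R Q j z)) (at_left 1)"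
    by (intro tendsto_intros)
  ultimately show ?thesis by (simp add: PQ[OF z])
qed

lemma polynomial_on_bounded:
  assumes Z: "csubspace Z" and P: "polynomial_on Z P"
  obtains C where "\<And>z. z \<in> Z \<Longrightarrow> norm z \<le> r \<Longrightarrow> norm (P z) \<le> C"
proof -
  obtain n Q where Q: "\<And>j. j < (n::nat) \<Longrightarrow> \<exists>k. homogeneous_polynomial_on k Z (Q j)"
    and PQ: "\<And>z. z \<in> Z \<Longrightarrow> P z = (\<Sum>j<n. Q j z)"
    using P unfolding polynomial_on_def by blast
  have "\<exists>C. \<forall>z\<in>Z. norm z \<le> r \<longrightarrow> norm (Q j z) \<le> C" if "j < n" for j
  proof -
    obtain k F where F: "bounded_multilinear_on k Z F" "\<And>z. z \<in> Z \<Longrightarrow> Q j z = F (\<lambda>i\<in>{..<k}. z)"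
      using Q[OF \<open>j < n\<close>] unfolding homogeneous_polynomial_on_def by blast
    obtain M where M: "M \<ge> 0" "\<And>z. z \<in> {..<k} \<rightarrow>\<^sub>E Z \<Longrightarrow> norm (F z) \<le> M * (\<Prod>i<k. norm (z i))"
      using multilinear_bound[OF F(1)] by blast
    have "norm (Q j z) \<le> M * r ^ k" if "z \<in> Z" "norm z \<le> r" for z
    proof -
      have "norm (Q j z) \<le> M * norm z ^ k" using M(2)[of "\<lambda>i\<in>{..<k}. z"] that F(2) by auto
      also have "\<dots> \<le> M * r ^ k" using that M(1) by (intro mult_left_mono power_mono) auto
      finally show ?thesis .
    qed
    then show ?thesis by blast
  qed
  then obtain C where C: "\<And>j z. j < n \<Longrightarrow> z \<in> Z \<Longrightarrow> norm z \<le> r \<Longrightarrow> norm (Q j z) \<le> C j" by metis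
  show ?thesis
  proof (rule that[of "\<Sum>j<n. C j"])
    fix z assume "z \<in> Z" "norm z \<le> r"
    then show "norm (P z) \<le> (\<Sum>j<n. C j)" using C PQ by (auto intro!: sum_norm_le)
  qed
qed

lemma polynomial_on_add:
  assumes "polynomial_on Z P" "polynomial_on Z P'"
  shows "polynomial_on Z (\<lambda>z. P z + P' z)"
proof -
  obtain n Q where Q: "\<And>j. j < (n::nat) \<Longrightarrow> \<exists>k. homogeneous_polynomial_on k Z (Q j)"
    and P: "\<And>z. z \<in> Z \<Longrightarrow> P z = (\<Sum>j<n. Q j z)"
    using assms(1) unfolding polynomial_on_def by blast
  obtain m R where R: "\<And>j. j < (m::nat) \<Longrightarrow> \<exists>k. homogeneous_polynomial_on k Z (R j)"
    and P': "\<And>z. z \<in> Z \<Longrightarrow> P' z = (\<Sum>j<m. R j z)"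
    using assms(2) unfolding polynomial_on_def by blast
  define S where "S j = (if j < n then Q j else R (j - n))" for j
  have "\<exists>k. homogeneous_polynomial_on k Z (S j)" if "j < n + m" for j
    using that Q[of j] R[of "j - n"] by (auto simp: S_def)
  moreover have "P z + P' z = (\<Sum>j<n + m. S j z)" if "z \<in> Z" for z
  proof -
    have "(\<Sum>j<n + m. S j z) = (\<Sum>j<n. S j z) + (\<Sum>j<m. S (n + j) z)"
      by (induction m) (auto simp: add.assoc)
    then show ?thesis using P P' that by (simp add: S_def)
  qed
  ultimately show ?thesis unfolding polynomial_on_def by blast
qed

lemma polynomial_on_homogeneous:
  assumes "homogeneous_polynomial_on k Z P"
  shows "polynomial_on Z P"
  unfolding polynomial_on_def using assms by (intro exI[of _ 1] exI[of _ "\<lambda>_. P"]) auto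

lemma polynomial_on_sum:
  assumes "finite J" "\<And>j. j \<in> J \<Longrightarrow> polynomial_on Z (P j)"
  shows "polynomial_on Z (\<lambda>z. \<Sum>j\<in>J. P j z)"
  using assms
proof (induction J rule: finite_induct)
  case empty
  show ?case unfolding polynomial_on_def by (intro exI[of _ 0]) auto
qed (auto intro!: polynomial_on_add)

section \<open>Composition of polynomials with affine maps\<close>

text \<open>Slots outside \<open>T\<close> are frozen and those in \<open>T\<close> carry exactly
  \<open>L x\<close>, so the degree is \<open>card T\<close>. The bijection \<open>b\<close>
  renumbers \<open>T\<close>, since multilinear maps take arguments indexed by an initial
  segment.\<close>

lemma homogeneous_polynomial_on_transport:
  assumes V: "csubspace V" and Z: "csubspace Z" and F: "bounded_multilinear_on k Z F"
    and L: "bounded_clinear_on V Z L" and G: "bounded_clinear_on Z V G"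
    and T: "T \<subseteq> {..<k}" and w: "\<And>i. w i \<in> Z" and w0: "\<And>i. i \<in> T \<Longrightarrow> w i = 0"
  shows "homogeneous_polynomial_on (card T) V (\<lambda>x. G (F (shifted_slots k T w (L x))))"
proof -
  have fin: "finite T" using T finite_subset by blast
  then obtain b where b: "bij_betw b {..<card T} T"
    using ex_bij_betw_nat_finite[of T] by (auto simp: atLeast0LessThan)
  define c where "c = inv_into {..<card T} b"
  have c: "bij_betw c T {..<card T}" unfolding c_def by (rule bij_betw_inv_into[OF b])
  have cb: "c (b i) = i" if "i < card T" for i
    unfolding c_def using b that by (intro inv_into_f_f) (auto simp: bij_betw_def)
  have bc: "b (c i) = i" if "i \<in> T" for i
    unfolding c_def using b that by (intro f_inv_into_f) (auto simp: bij_betw_def)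
  have cT: "c i < card T" if "i \<in> T" for i using c that by (auto simp: bij_betw_def)
  \<comment> \<open>\<open>e z\<close> places the images of the renumbered arguments into the slots
    of \<open>T\<close> and the base values elsewhere.\<close>
  define e where "e z = (\<lambda>i\<in>{..<k}. if i \<in> T then L (z (c i)) else w i)" for z
  have e_in: "e z \<in> {..<k} \<rightarrow>\<^sub>E Z" if "z \<in> {..<card T} \<rightarrow>\<^sub>E V" for z
    using that w cT PiE_mem[OF that] by (auto simp: e_def intro!: bounded_clinear_onD(1)[OF L])
  have Fin: "F y \<in> Z" if "y \<in> {..<k} \<rightarrow>\<^sub>E Z" for y
    using F that unfolding bounded_multilinear_on_def by blast
  have upd: "e (z(i := u)) = (e z)(b i := L u)" if "i < card T" for z i u
  proof -
    have "b i \<in> T" using b that by (auto simp: bij_betw_def)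
    then show ?thesis using T that bc cb by (auto simp: e_def fun_eq_iff)
  qed
  obtain M where M: "M \<ge> 0" "\<And>z. z \<in> {..<k} \<rightarrow>\<^sub>E Z \<Longrightarrow> norm (F z) \<le> M * (\<Prod>i<k. norm (z i))"
    using multilinear_bound[OF F] by blast
  obtain KL where KL: "KL \<ge> 0" "\<And>u. u \<in> V \<Longrightarrow> norm (L u) \<le> KL * norm u"
    using bounded_clinear_on_bound[OF L] by blast
  obtain KG where KG: "KG \<ge> 0" "\<And>u. u \<in> Z \<Longrightarrow> norm (G u) \<le> KG * norm u"
    using bounded_clinear_on_bound[OF G] by blast
  have "bounded_multilinear_on (card T) V (\<lambda>z. G (F (e z)))"
    unfolding bounded_multilinear_on_def
  proof (intro conjI ballI allI impI exI)
    show "(\<lambda>z. G (F (e z))) \<in> ({..<card T} \<rightarrow>\<^sub>E V) \<rightarrow> V"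
      using bounded_clinear_onD(1)[OF G] Fin e_in by auto
  next
    fix z i u v a d
    assume z: "z \<in> {..<card T} \<rightarrow>\<^sub>E V" and i: "i < card T" and uv: "u \<in> V" "v \<in> V"
    have bi: "b i < k" using b i T by (auto simp: bij_betw_def)
    have Lu: "L u \<in> Z" "L v \<in> Z" using uv bounded_clinear_onD(1)[OF L] by auto
    have ez: "(e z)(b i := y) \<in> {..<k} \<rightarrow>\<^sub>E Z" if "y \<in> Z" for y
      using e_in[OF z] bi that by (auto simp: PiE_iff extensional_def)
    have "L (a *\<^sub>C u + d *\<^sub>C v) = a *\<^sub>C L u + d *\<^sub>C L v"
      using uv bounded_clinear_onD[OF L] by (simp add: csubspace_scale[OF V])
    then have "F (e (z(i := a *\<^sub>C u + d *\<^sub>C v))) = a *\<^sub>C F (e (z(i := u))) + d *\<^sub>C F (e (z(i := v)))"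
      using F e_in[OF z] bi Lu unfolding bounded_multilinear_on_def upd[OF i] by simp
    then show "G (F (e (z(i := a *\<^sub>C u + d *\<^sub>C v)))) = a *\<^sub>C G (F (e (z(i := u)))) + d *\<^sub>C G (F (e (z(i := v))))"
      using bounded_clinear_onD[OF G] Fin[OF ez] Lu by (simp add: upd[OF i] csubspace_scale[OF Z])
  next
    fix z assume z: "z \<in> {..<card T} \<rightarrow>\<^sub>E V"
    have zV: "z (c i) \<in> V" if "i \<in> T" for i using z cT[OF that] by auto
    have "norm (G (F (e z))) \<le> KG * norm (F (e z))" by (intro KG Fin e_in z)
    also have "\<dots> \<le> KG * (M * (\<Prod>i<k. norm (e z i)))" by (intro mult_left_mono M KG e_in z)
    also have "(\<Prod>i<k. norm (e z i)) = (\<Prod>i\<in>T. norm (e z i)) * (\<Prod>i\<in>{..<k} - T. norm (e z i))"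
      using T by (simp add: prod.subset_diff mult.commute)
    also have "(\<Prod>i\<in>{..<k} - T. norm (e z i)) = (\<Prod>i\<in>{..<k} - T. norm (w i))"
      by (intro prod.cong) (auto simp: e_def)
    also have "(\<Prod>i\<in>T. norm (e z i)) = (\<Prod>i\<in>T. norm (L (z (c i))))"
      using T by (intro prod.cong) (auto simp: e_def)
    also have "KG * (M * ((\<Prod>i\<in>T. norm (L (z (c i)))) * (\<Prod>i\<in>{..<k} - T. norm (w i)))) \<le>
       KG * (M * ((\<Prod>i\<in>T. KL * norm (z (c i))) * (\<Prod>i\<in>{..<k} - T. norm (w i))))"
      using zV by (intro mult_left_mono mult_right_mono prod_mono KG M prod_nonneg) (auto simp: KL)
    also have "(\<Prod>i\<in>T. KL * norm (z (c i))) = KL ^ card T * (\<Prod>i\<in>T. norm (z (c i)))"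
      by (simp add: prod.distrib)
    also have "(\<Prod>i\<in>T. norm (z (c i))) = (\<Prod>i<card T. norm (z i))"
      by (rule prod.reindex_bij_betw[OF c])
    finally show "norm (G (F (e z))) \<le>
        (KG * M * KL ^ card T * (\<Prod>i\<in>{..<k} - T. norm (w i))) * (\<Prod>i<card T. norm (z i))"
      by (simp add: mult_ac)
  qed
  moreover have "shifted_slots k T w (L x) = e (\<lambda>i\<in>{..<card T}. x)" for x
    using w0 cT by (auto simp: e_def shifted_slots_def fun_eq_iff)
  ultimately show ?thesis unfolding homogeneous_polynomial_on_def by metis
qed

text \<open>The induction counts moving slots with nonzero base. Splitting \<open>w j + L x\<close>
  gives one term with base \<open>0\<close> at \<open>j\<close> and one with slot \<open>j\<close>
  frozen, and the count drops in both; at count \<open>0\<close> the expression is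
  homogeneous.\<close>

lemma polynomial_on_shifted_slots:
  assumes V: "csubspace V" and Z: "csubspace Z" and F: "bounded_multilinear_on k Z F"
    and L: "bounded_clinear_on V Z L" and G: "bounded_clinear_on Z V G"
    and T: "T \<subseteq> {..<k}" and w: "\<And>i. w i \<in> Z"
  shows "polynomial_on V (\<lambda>x. G (F (shifted_slots k T w (L x))))"
  using T w
proof (induction "card {i \<in> T. w i \<noteq> 0}" arbitrary: T w rule: less_induct)
  case less
  have fin: "finite T" using less.prems finite_subset by blast
  show ?case
  proof (cases "{i \<in> T. w i \<noteq> 0} = {}")
    case True
    then show ?thesis
      by (intro polynomial_on_homogeneous[OF homogeneous_polynomial_on_transport[OF V Z F L G]] less.prems) auto
  next
    case False
    then obtain j where j: "j \<in> T" "w j \<noteq> 0" by blast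
    have lt: "card {i \<in> T - {j}. w i \<noteq> 0} < card {i \<in> T. w i \<noteq> 0}"
      using j fin by (intro psubset_card_mono) auto
    have eq: "{i \<in> T. (w(j := 0)) i \<noteq> 0} = {i \<in> T - {j}. w i \<noteq> 0}" by auto
    have 1: "polynomial_on V (\<lambda>x. G (F (shifted_slots k (T - {j}) w (L x))))"
      using less.prems by (intro less.hyps lt) auto
    have 2: "polynomial_on V (\<lambda>x. G (F (shifted_slots k T (w(j := 0)) (L x))))"
    proof (rule less.hyps)
      show "card {i \<in> T. (w(j := 0)) i \<noteq> 0} < card {i \<in> T. w i \<noteq> 0}" unfolding eq by (rule lt)
    qed (use less.prems csubspace_0[OF Z] in auto)
    have split: "G (F (shifted_slots k T w (L x))) =
        G (F (shifted_slots k T (w(j := 0)) (L x))) + G (F (shifted_slots k (T - {j}) w (L x)))"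
      if "x \<in> V" for x
    proof -
      have Lx: "L x \<in> Z" using that bounded_clinear_onD(1)[OF L] by auto
      have w0: "(w(j := 0)) i \<in> Z" for i using less.prems(2) csubspace_0[OF Z] by simp
      have Fin: "F y \<in> Z" if "y \<in> {..<k} \<rightarrow>\<^sub>E Z" for y
        using F that unfolding bounded_multilinear_on_def by blast
      have "F (shifted_slots k T w (L x)) =
          F (shifted_slots k T (w(j := 0)) (L x)) + F (shifted_slots k (T - {j}) w (L x))"
        using multilinear_shifted_slots_add[where w = "w(j := 0)", OF Z F less.prems(1) j(1) w0 Lx less.prems(2)[of j]] by simp
      moreover have "F (shifted_slots k T (w(j := 0)) (L x)) \<in> Z"
        by (intro Fin shifted_slots_in[OF Z] w0 Lx)
      moreover have "F (shifted_slots k (T - {j}) w (L x)) \<in> Z"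
        by (intro Fin shifted_slots_in[OF Z] less.prems Lx)
      ultimately show ?thesis by (simp add: bounded_clinear_onD(2)[OF G])
    qed
    show ?thesis
      using polynomial_on_add[OF 2 1] split by (simp add: polynomial_on_def)
  qed
qed

text \<open>It carries polynomials in both directions between \<open>X\<close> and the function
  space, with a tensor embedding and an evaluation in the roles of \<open>L\<close> and
  \<open>G\<close>.\<close>

lemma polynomial_on_transport:
  assumes V: "csubspace V" and Z: "csubspace Z" and P: "polynomial_on Z P" and c: "c \<in> Z"
    and L: "bounded_clinear_on V Z L" and G: "bounded_clinear_on Z V G"
  shows "polynomial_on V (\<lambda>x. G (P (c + L x)))"
proof -
  obtain n Q where Q: "\<And>j. j < (n::nat) \<Longrightarrow> \<exists>k. homogeneous_polynomial_on k Z (Q j)"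
    and PQ: "\<And>z. z \<in> Z \<Longrightarrow> P z = (\<Sum>j<n. Q j z)"
    using P unfolding polynomial_on_def by blast
  have Qpoly: "polynomial_on Z (Q j)" if "j < n" for j using Q[OF that] polynomial_on_homogeneous by blast
  have cL: "c + L x \<in> Z" if "x \<in> V" for x
    using that c bounded_clinear_onD(1)[OF L] by (simp add: csubspace_add[OF Z])
  have hom: "polynomial_on V (\<lambda>x. G (Q j (c + L x)))" if "j < n" for j
  proof -
    obtain k F where F: "bounded_multilinear_on k Z F" "\<And>z. z \<in> Z \<Longrightarrow> Q j z = F (\<lambda>i\<in>{..<k}. z)"
      using Q[OF \<open>j < n\<close>] unfolding homogeneous_polynomial_on_def by blast
    have "shifted_slots k {..<k} (\<lambda>_. c) (L x) = (\<lambda>i\<in>{..<k}. c + L x)" for x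
      by (auto simp: shifted_slots_def fun_eq_iff)
    then have "polynomial_on V (\<lambda>x. G (F (\<lambda>i\<in>{..<k}. c + L x)))"
      using polynomial_on_shifted_slots[OF V Z F(1) L G order_refl, of "\<lambda>_. c"] c by simp
    then show ?thesis using F(2) cL by (simp add: polynomial_on_def)
  qed
  \<comment> \<open>\<open>G\<close> is linear only on \<open>Z\<close>, so it is pulled through
    partial sums that are known to stay in \<open>Z\<close>.\<close>
  have "G (\<Sum>j<m. Q j (c + L x)) = (\<Sum>j<m. G (Q j (c + L x)))" if "m \<le> n" "x \<in> V" for m x
    using that(1)
  proof (induction m)
    case 0
    have "G (0 *\<^sub>C 0) = 0 *\<^sub>C G 0" by (rule bounded_clinear_onD(3)[OF G csubspace_0[OF Z]])
    then show ?case by simp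
  next
    case (Suc m)
    have "(\<Sum>j<m. Q j (c + L x)) \<in> Z"
      using Suc.prems by (intro csubspace_sum[OF Z] polynomial_on_maps_to[OF Z Qpoly] cL that) auto
    moreover have "Q m (c + L x) \<in> Z"
      using Suc.prems by (intro polynomial_on_maps_to[OF Z Qpoly] cL that) auto
    ultimately show ?case using Suc by (simp add: bounded_clinear_onD[OF G])
  qed
  then show ?thesis
    using polynomial_on_sum[of "{..<n}" V "\<lambda>j x. G (Q j (c + L x))"] hom PQ cL
    by (simp add: polynomial_on_def)
qed

section \<open>Scalar polynomials in terms of finite differences\<close>

text \<open>Degree at most \<open>d\<close> in the sense of Frechet: all differences of order
  \<open>d + 1\<close> vanish. This form passes to the difference \<open>g (f + u) - g f\<close>
  with a smaller degree, which is what the limit argument inducts on.\<close>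

primrec frechet_polynomial_on :: "'z::complex_normed_vector set \<Rightarrow> nat \<Rightarrow> ('z \<Rightarrow> real) \<Rightarrow> bool" where
  "frechet_polynomial_on Z 0 g \<longleftrightarrow> (\<forall>u\<in>Z. \<forall>v\<in>Z. g u = g v)"
| "frechet_polynomial_on Z (Suc d) g \<longleftrightarrow> (\<forall>u\<in>Z. frechet_polynomial_on Z d (\<lambda>f. g (f + u) - g f))"

lemma frechet_polynomial_on_cong:
  assumes "csubspace Z" "\<And>f. f \<in> Z \<Longrightarrow> g f = h f"
  shows "frechet_polynomial_on Z d g \<longleftrightarrow> frechet_polynomial_on Z d h"
  using assms(2)
proof (induction d arbitrary: g h)
  case 0
  then show ?case by simp
next
  case (Suc d)
  have "frechet_polynomial_on Z d (\<lambda>f. g (f + u) - g f) \<longleftrightarrow>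
        frechet_polynomial_on Z d (\<lambda>f. h (f + u) - h f)" if "u \<in> Z" for u
    using that by (intro Suc.IH) (simp add: Suc.prems csubspace_add[OF assms(1)])
  then show ?case by simp
qed

lemma frechet_polynomial_on_eqI:
  assumes "csubspace Z" "frechet_polynomial_on Z d g" "\<And>f. f \<in> Z \<Longrightarrow> g f = h f"
  shows "frechet_polynomial_on Z d h"
  using frechet_polynomial_on_cong[of Z g h d, OF assms(1,3)] assms(2) by simp

lemma frechet_polynomial_on_add:
  "frechet_polynomial_on Z d g \<Longrightarrow> frechet_polynomial_on Z d h \<Longrightarrow>
   frechet_polynomial_on Z d (\<lambda>f. g f + h f)"
proof (induction d arbitrary: g h)
  case 0
  then show ?case unfolding frechet_polynomial_on.simps by metis
next
  case (Suc d)
  have "frechet_polynomial_on Z d (\<lambda>f. (g (f + u) - g f) + (h (f + u) - h f))" if "u \<in> Z" for u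
    using Suc.prems that by (intro Suc.IH) auto
  then show ?case by (simp add: algebra_simps)
qed

lemma frechet_polynomial_on_minus:
  "frechet_polynomial_on Z d g \<Longrightarrow> frechet_polynomial_on Z d (\<lambda>f. - g f)"
proof (induction d arbitrary: g)
  case 0
  then show ?case unfolding frechet_polynomial_on.simps by metis
next
  case (Suc d)
  have "frechet_polynomial_on Z d (\<lambda>f. - (g (f + u) - g f))" if "u \<in> Z" for u
    using Suc.prems that by (intro Suc.IH) auto
  then show ?case by simp
qed

lemma frechet_polynomial_on_zero: "frechet_polynomial_on Z d (\<lambda>_. 0)"
  by (induction d) auto

lemma frechet_polynomial_on_Suc:
  assumes "csubspace Z"
  shows "frechet_polynomial_on Z d g \<Longrightarrow> frechet_polynomial_on Z (Suc d) g"
proof (induction d arbitrary: g)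
  case 0
  have "g (f + u) = g f" if "u \<in> Z" "f \<in> Z" for u f
    using 0 csubspace_add[OF assms] that unfolding frechet_polynomial_on.simps(1) by blast
  then show ?case by simp
next
  case (Suc d)
  show ?case
    unfolding frechet_polynomial_on.simps(2)[of Z "Suc d"]
    using Suc.prems by (intro ballI Suc.IH) (simp only: frechet_polynomial_on.simps(2))
qed

lemma frechet_polynomial_on_mono:
  assumes "csubspace Z" "frechet_polynomial_on Z d g" "d \<le> d'"
  shows "frechet_polynomial_on Z d' g"
  using assms(3)
proof (induction rule: dec_induct)
  case base
  show ?case by (rule assms(2))
next
  case (step n)
  then show ?case by (intro frechet_polynomial_on_Suc[OF assms(1)])
qed

text \<open>Translating \<open>f\<close> by \<open>u\<close> adds \<open>u\<close> to the base in
  all slots of \<open>T\<close>. When this is done slot by slot, along the growing set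
  \<open>D\<close>, each change is a multilinear term with one moving slot fewer.\<close>

lemma frechet_polynomial_on_multilinear:
  assumes Z: "csubspace Z" and F: "bounded_multilinear_on k Z F"
    and add: "\<And>u v. u \<in> Z \<Longrightarrow> v \<in> Z \<Longrightarrow> \<psi> (u + v) = \<psi> u + \<psi> v"
    and T: "T \<subseteq> {..<k}" and w: "\<And>i. w i \<in> Z"
  shows "frechet_polynomial_on Z (card T) (\<lambda>f. \<psi> (F (shifted_slots k T w f)))"
  using T w
proof (induction "card T" arbitrary: T w)
  case 0
  then have "T = {}" using finite_subset by fastforce
  then show ?case by (simp add: shifted_slots_def)
next
  case (Suc n)
  have fin: "finite T" using Suc.prems finite_subset by blast
  have Fin: "F y \<in> Z" if "y \<in> {..<k} \<rightarrow>\<^sub>E Z" for y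
    using F that unfolding bounded_multilinear_on_def by blast
  have *: "frechet_polynomial_on Z n
      (\<lambda>f. \<psi> (F (shifted_slots k T (\<lambda>i. if i \<in> D then w i + u else w i) f)) - \<psi> (F (shifted_slots k T w f)))"
    if u: "u \<in> Z" and "D \<subseteq> T" for u D
    using finite_subset[OF that(2) fin] that(2)
  proof (induction D rule: finite_induct)
    case empty
    then show ?case by (simp add: frechet_polynomial_on_zero)
  next
    case (insert j D)
    define w' where "w' = (\<lambda>i. if i \<in> D then w i + u else w i)"
    have w': "w' i \<in> Z" "(w'(j := u)) i \<in> Z" for i
      using Suc.prems(2) u by (auto simp: w'_def csubspace_add[OF Z])
    have j: "j \<in> T" using insert.prems by simp
    have upd: "(\<lambda>i. if i \<in> insert j D then w i + u else w i) = w'(j := w' j + u)"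
      using insert.hyps by (auto simp: w'_def fun_eq_iff)
    have card: "n = card (T - {j})" using Suc.hyps(2) j by simp
    have "frechet_polynomial_on Z n (\<lambda>f. \<psi> (F (shifted_slots k (T - {j}) (w'(j := u)) f)))"
      unfolding card using Suc.prems(1) w'(2) by (intro Suc.hyps(1)[OF card]) auto
    moreover have "frechet_polynomial_on Z n
        (\<lambda>f. \<psi> (F (shifted_slots k T w' f)) - \<psi> (F (shifted_slots k T w f)))"
      unfolding w'_def using insert by simp
    ultimately have "frechet_polynomial_on Z n
        (\<lambda>f. \<psi> (F (shifted_slots k (T - {j}) (w'(j := u)) f)) +
             (\<psi> (F (shifted_slots k T w' f)) - \<psi> (F (shifted_slots k T w f))))"
      by (rule frechet_polynomial_on_add)
    moreover have "\<psi> (F (shifted_slots k (T - {j}) (w'(j := u)) f)) +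
             (\<psi> (F (shifted_slots k T w' f)) - \<psi> (F (shifted_slots k T w f))) =
        \<psi> (F (shifted_slots k T (w'(j := w' j + u)) f)) - \<psi> (F (shifted_slots k T w f))"
      if f: "f \<in> Z" for f
      unfolding multilinear_shifted_slots_add[where w = w', OF Z F Suc.prems(1) j w'(1) f u]
        add[OF Fin[OF shifted_slots_in[where w = w', OF Z w'(1) f]]
          Fin[OF shifted_slots_in[where w = "w'(j := u)", OF Z w'(2) f]]] by simp
    ultimately show ?case unfolding upd by (rule frechet_polynomial_on_eqI[OF Z])
  qed
  have shift: "shifted_slots k T (\<lambda>i. if i \<in> T then w i + u else w i) f = shifted_slots k T w (f + u)" for f u
    by (auto simp: shifted_slots_def fun_eq_iff algebra_simps)
  show ?case
    unfolding Suc.hyps(2)[symmetric] frechet_polynomial_on.simps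
    using *[OF _ order_refl] by (simp add: shift)
qed

text \<open>\<open>\<psi>\<close> will be the real part of a functional at a point of
  \<open>K\<close>, which is additive but not complex linear.\<close>

lemma frechet_polynomial_on_polynomial:
  assumes Z: "csubspace Z" and P: "polynomial_on Z P"
    and add: "\<And>u v. u \<in> Z \<Longrightarrow> v \<in> Z \<Longrightarrow> \<psi> (u + v) = \<psi> u + \<psi> v"
  shows "\<exists>d. frechet_polynomial_on Z d (\<lambda>f. \<psi> (P f))"
proof -
  obtain n Q where Q: "\<And>j. j < (n::nat) \<Longrightarrow> \<exists>k. homogeneous_polynomial_on k Z (Q j)"
    and PQ: "\<And>z. z \<in> Z \<Longrightarrow> P z = (\<Sum>j<n. Q j z)"
    using P unfolding polynomial_on_def by blast
  have Qin: "Q j z \<in> Z" if "j < n" "z \<in> Z" for j z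
    using Q[OF that(1)] that(2) polynomial_on_maps_to[OF Z polynomial_on_homogeneous] by blast
  have hom: "\<exists>d. frechet_polynomial_on Z d (\<lambda>f. \<psi> (Q j f))" if "j < n" for j
  proof -
    obtain k F where F: "bounded_multilinear_on k Z F" "\<And>z. z \<in> Z \<Longrightarrow> Q j z = F (\<lambda>i\<in>{..<k}. z)"
      using Q[OF \<open>j < n\<close>] unfolding homogeneous_polynomial_on_def by blast
    have "shifted_slots k {..<k} (\<lambda>_. 0) z = (\<lambda>i\<in>{..<k}. z)" for z :: 'a
      by (auto simp: shifted_slots_def fun_eq_iff)
    then have "frechet_polynomial_on Z (card {..<k}) (\<lambda>f. \<psi> (F (\<lambda>i\<in>{..<k}. f)))"
      using frechet_polynomial_on_multilinear[OF Z F(1) add order_refl, of "\<lambda>_. 0"] csubspace_0[OF Z]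
      by simp
    then have "frechet_polynomial_on Z (card {..<k}) (\<lambda>f. \<psi> (Q j f))"
      by (rule frechet_polynomial_on_eqI[OF Z]) (simp add: F(2))
    then show ?thesis by blast
  qed
  have zero: "\<psi> 0 = 0" using add[of 0 0] csubspace_0[OF Z] by simp
  have "\<exists>d. frechet_polynomial_on Z d (\<lambda>f. \<psi> (\<Sum>j<m. Q j f))" if "m \<le> n" for m
    using that
  proof (induction m)
    case 0
    then show ?case by (simp add: zero frechet_polynomial_on_zero)
  next
    case (Suc m)
    then obtain d where d: "frechet_polynomial_on Z d (\<lambda>f. \<psi> (\<Sum>j<m. Q j f))" by auto
    obtain d' where d': "frechet_polynomial_on Z d' (\<lambda>f. \<psi> (Q m f))" using hom[of m] Suc.prems by auto
    have "frechet_polynomial_on Z (max d d') (\<lambda>f. \<psi> (\<Sum>j<m. Q j f) + \<psi> (Q m f))"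
      by (intro frechet_polynomial_on_add frechet_polynomial_on_mono[OF Z d] frechet_polynomial_on_mono[OF Z d']) auto
    moreover have "\<psi> (\<Sum>j<m. Q j f) + \<psi> (Q m f) = \<psi> (\<Sum>j<Suc m. Q j f)" if "f \<in> Z" for f
    proof -
      have "(\<Sum>j<m. Q j f) \<in> Z" using Suc.prems that by (intro csubspace_sum[OF Z] Qin) auto
      then show ?thesis using Suc.prems that Qin[of m f] by (simp add: add)
    qed
    ultimately have "frechet_polynomial_on Z (max d d') (\<lambda>f. \<psi> (\<Sum>j<Suc m. Q j f))"
      by (rule frechet_polynomial_on_eqI[OF Z])
    then show ?case by blast
  qed
  from this[of n] obtain d where "frechet_polynomial_on Z d (\<lambda>f. \<psi> (\<Sum>j<n. Q j f))" by auto
  then have "frechet_polynomial_on Z d (\<lambda>f. \<psi> (P f))"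
    by (rule frechet_polynomial_on_eqI[OF Z]) (simp add: PQ)
  then show ?thesis by blast
qed

text \<open>
  If infinitely many increments \<open>g (f + e n) - g f\<close> exceeded \<open>\<epsilon>\<close>, the induction hypothesis for the
  differences of \<open>g\<close> would allow to add them up along finite sets of indices, and \<open>g\<close> would be
  unbounded on a ball.
\<close>

lemma frechet_polynomial_on_increment_limit:
  assumes Z: "csubspace Z" and f: "f \<in> Z" and e: "\<And>n. e n \<in> Z"
    and R: "\<And>S. finite S \<Longrightarrow> norm (\<Sum>n\<in>S. e n) \<le> R"
    and g: "frechet_polynomial_on Z d g"
    and bdd: "\<And>r. \<exists>C. \<forall>z\<in>Z. norm z \<le> r \<longrightarrow> \<bar>g z\<bar> \<le> C"
  shows "(\<lambda>n. g (f + e n)) \<longlonglongrightarrow> g f"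
  using g bdd
proof (induction d arbitrary: g)
  case 0
  have "g (f + e n) = g f" for n
    using 0(1) f csubspace_add[OF Z f e] unfolding frechet_polynomial_on.simps(1) by blast
  then show ?case by simp
next
  case (Suc d)
  note IH = Suc.IH
  have sumZ: "(\<Sum>n\<in>S. e n) \<in> Z" for S by (intro csubspace_sum[OF Z] e)
  \<comment> \<open>Stated for arbitrary \<open>g\<close>, so that the instance \<open>- g\<close>
    provides the lower estimate.\<close>
  have upper: "eventually (\<lambda>n. g (f + e n) < g f + \<epsilon>) sequentially"
    if g: "frechet_polynomial_on Z (Suc d) g" and bdd: "\<And>r. \<exists>C. \<forall>z\<in>Z. norm z \<le> r \<longrightarrow> \<bar>g z\<bar> \<le> C"
      and \<epsilon>: "\<epsilon> > 0" for g \<epsilon>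
  proof (rule ccontr)
    assume "\<not> ?thesis"
    then have freq: "\<exists>\<^sub>F n in sequentially. g f + \<epsilon> \<le> g (f + e n)"
      by (simp add: not_eventually not_less)
    have "\<exists>S. finite S \<and> g (f + (\<Sum>n\<in>S. e n)) \<ge> g f + real l * (\<epsilon> / 2)" for l
    proof (induction l)
      case 0
      then show ?case by (intro exI[of _ "{}"]) auto
    next
      case (Suc l)
      then obtain S where S: "finite S" "g (f + (\<Sum>n\<in>S. e n)) \<ge> g f + real l * (\<epsilon> / 2)" by blast
      define u where "u = (\<Sum>n\<in>S. e n)"
      have u: "u \<in> Z" unfolding u_def by (rule sumZ)
      have "\<exists>C. \<forall>z\<in>Z. norm z \<le> r \<longrightarrow> \<bar>g (z + u) - g z\<bar> \<le> C" for r
      proof -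
        obtain C where C: "\<And>z. z \<in> Z \<Longrightarrow> norm z \<le> r + norm u \<Longrightarrow> \<bar>g z\<bar> \<le> C" using bdd by metis
        have "\<bar>g (z + u) - g z\<bar> \<le> C + C" if "z \<in> Z" "norm z \<le> r" for z
        proof -
          have "norm (z + u) \<le> r + norm u" using norm_triangle_ineq[of z u] that by simp
          moreover have "norm z \<le> r + norm u" using that by (simp add: add_increasing2)
          ultimately show ?thesis
            using C[of z] C[of "z + u"] that u csubspace_add[OF Z] by fastforce
        qed
        then show ?thesis by blast
      qed
      then have "(\<lambda>n. g ((f + e n) + u) - g (f + e n)) \<longlonglongrightarrow> g (f + u) - g f"
          using g u by (intro IH) auto
      \<comment> \<open>Adding \<open>e n\<close> to \<open>f + u\<close> gains nearly what adding
        it to \<open>f\<close> gains: of the increment \<open>\<epsilon>\<close> at most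
        \<open>\<epsilon> / 2\<close> is lost, so every new index contributes at least
        \<open>\<epsilon> / 2\<close>.\<close>
      then have "eventually (\<lambda>n. g (f + u) - g f - \<epsilon> / 2 < g ((f + e n) + u) - g (f + e n)) sequentially"
        by (rule order_tendstoD) (use \<epsilon> in simp)
      moreover have "eventually (\<lambda>n. n \<notin> S) sequentially"
        using S(1) by (simp add: cofinite_eq_sequentially[symmetric] eventually_cofinite)
      ultimately have "eventually (\<lambda>n. n \<notin> S \<and>
          g (f + u) - g f - \<epsilon> / 2 < g ((f + e n) + u) - g (f + e n)) sequentially"
        by eventually_elim simp
      then have "\<exists>\<^sub>F n in sequentially. g f + \<epsilon> \<le> g (f + e n) \<and> n \<notin> S \<and>
          g (f + u) - g f - \<epsilon> / 2 < g ((f + e n) + u) - g (f + e n)"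
        by (rule frequently_eventually_frequently[OF freq])
      then obtain n where n: "g f + \<epsilon> \<le> g (f + e n)" "n \<notin> S"
          "g (f + u) - g f - \<epsilon> / 2 < g ((f + e n) + u) - g (f + e n)"
        using frequently_ex by blast
      have "(\<Sum>n\<in>insert n S. e n) = e n + u" using n(2) S(1) by (simp add: u_def)
      then show ?case
        using n S by (intro exI[of _ "insert n S"]) (auto simp: u_def algebra_simps add_divide_distrib)
    qed
    then obtain S where S: "\<And>l. finite (S l)" "\<And>l. g (f + (\<Sum>n\<in>S l. e n)) \<ge> g f + real l * (\<epsilon> / 2)" by metis
    obtain C where C: "\<And>z. z \<in> Z \<Longrightarrow> norm z \<le> norm f + R \<Longrightarrow> \<bar>g z\<bar> \<le> C" using bdd by metis
    obtain l :: nat where l: "real l > (C - g f) / (\<epsilon> / 2)" using reals_Archimedean2 by blast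
    have "norm (f + (\<Sum>n\<in>S l. e n)) \<le> norm f + R"
      using norm_triangle_ineq[of f "\<Sum>n\<in>S l. e n"] R[OF S(1)[of l]] by simp
    then have "g (f + (\<Sum>n\<in>S l. e n)) \<le> C" using C[of "f + (\<Sum>n\<in>S l. e n)"] csubspace_add[OF Z f sumZ] by fastforce
    moreover have "real l * (\<epsilon> / 2) > C - g f" using l \<epsilon> by (simp add: field_simps)
    ultimately show False using S(2)[of l] by simp
  qed
  have lower: "eventually (\<lambda>n. - g (f + e n) < - g f + \<epsilon>) sequentially" if "\<epsilon> > 0" for \<epsilon>
    using Suc.prems that by (intro upper[of "\<lambda>z. - g z"] frechet_polynomial_on_minus) auto
  show ?case
    unfolding tendsto_iff dist_real_def
  proof (intro allI impI)
    fix \<epsilon> :: real assume "\<epsilon> > 0"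
    from lower[OF this] upper[OF Suc.prems this]
    show "eventually (\<lambda>n. \<bar>g (f + e n) - g f\<bar> < \<epsilon>) sequentially"
      by eventually_elim (simp add: abs_less_iff)
  qed
qed

section \<open>The Shilov boundary of a uniform algebra\<close>

text \<open>A uniform algebra as a set of plain functions, which keeps the pointwise constructions
  readable; closedness in norm appears as closure under uniform limits.\<close>

locale function_algebra =
  fixes B :: "('k::t2_space \<Rightarrow> complex) set"
  assumes compact_space: "compact (UNIV :: 'k set)"
    and continuous: "\<And>f. f \<in> B \<Longrightarrow> continuous_on UNIV f"
    and const: "\<And>c. (\<lambda>_. c) \<in> B"
    and add: "\<And>f g. f \<in> B \<Longrightarrow> g \<in> B \<Longrightarrow> (\<lambda>t. f t + g t) \<in> B"
    and mult: "\<And>f g. f \<in> B \<Longrightarrow> g \<in> B \<Longrightarrow> (\<lambda>t. f t * g t) \<in> B"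
    and separating: "\<And>s t. s \<noteq> t \<Longrightarrow> \<exists>f\<in>B. f s \<noteq> f t"
    and uniformly_closed: "\<And>f l. (\<And>n. f n \<in> B) \<Longrightarrow> uniform_limit UNIV f l sequentially \<Longrightarrow> l \<in> B"
begin

lemma cmult: "f \<in> B \<Longrightarrow> (\<lambda>t. c * f t) \<in> B"
  using mult[OF const] by simp

lemma diff: "f \<in> B \<Longrightarrow> g \<in> B \<Longrightarrow> (\<lambda>t. f t - g t) \<in> B"
  using add[of f "\<lambda>t. (-1) * g t"] cmult[of g "-1"] by simp

lemma power: "f \<in> B \<Longrightarrow> (\<lambda>t. f t ^ n) \<in> B"
  by (induction n) (auto intro: const mult)

lemma sum: "(\<And>j. j \<in> J \<Longrightarrow> f j \<in> B) \<Longrightarrow> (\<lambda>t. \<Sum>j\<in>J. f j t) \<in> B"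
  by (induction J rule: infinite_finite_induct) (auto intro: const add)

lemma open_less: "f \<in> B \<Longrightarrow> open {t. cmod (f t) < r}"
  and open_greater: "f \<in> B \<Longrightarrow> open {t. r < cmod (f t)}"
  by (intro open_Collect_less continuous_intros continuous; assumption)+

lemma attains_sup:
  assumes "f \<in> B" "closed S" "S \<noteq> {}"
  obtains t where "t \<in> S" "\<And>u. u \<in> S \<Longrightarrow> cmod (f u) \<le> cmod (f t)"
proof -
  have "compact S" using compact_Int_closed[OF compact_space assms(2)] by simp
  moreover have "continuous_on S (\<lambda>t. cmod (f t))"
    using continuous[OF assms(1)] by (intro continuous_intros) (rule continuous_on_subset, auto)
  ultimately show ?thesis using continuous_attains_sup[of S "\<lambda>t. cmod (f t)"] assms(3) that by blast
qed

lemma strict_bound: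
  assumes "f \<in> B" "closed S" "\<And>u. u \<in> S \<Longrightarrow> cmod (f u) < 1"
  obtains \<rho> where "0 \<le> \<rho>" "\<rho> < 1" "\<And>u. u \<in> S \<Longrightarrow> cmod (f u) \<le> \<rho>"
proof (cases "S = {}")
  case True
  then show ?thesis using that[of 0] by simp
next
  case False
  then obtain t where t: "t \<in> S" "\<And>u. u \<in> S \<Longrightarrow> cmod (f u) \<le> cmod (f t)"
    using attains_sup[OF assms(1,2)] by blast
  then show ?thesis using that[of "cmod (f t)"] assms(3)[of t] by simp
qed

lemma bounded:
  assumes "f \<in> B"
  obtains C where "C > 0" "\<And>u. cmod (f u) \<le> C"
proof -
  obtain t where t: "\<And>u. cmod (f u) \<le> cmod (f t)" using attains_sup[OF assms, of UNIV] by auto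
  have "cmod (f u) \<le> cmod (f t) + 1" for u using t[of u] by simp
  then show ?thesis using that[of "cmod (f t) + 1"] by (simp add: add_nonneg_pos)
qed

section \<open>Boundaries and peak functions\<close>

definition boundary :: "'k set \<Rightarrow> bool" where
  "boundary S \<longleftrightarrow> (\<forall>f\<in>B. \<forall>s. \<exists>t\<in>S. cmod (f s) \<le> cmod (f t))"

text \<open>This is the normalized witness that \<open>S\<close> is not a boundary. It is not
  peaking at a single point: off \<open>S\<close> the modulus \<open>1\<close> may be attained
  elsewhere too.\<close>

definition peaking :: "'k set \<Rightarrow> ('k \<Rightarrow> complex) \<Rightarrow> 'k \<Rightarrow> bool" where
  "peaking S f s \<longleftrightarrow> f \<in> B \<and> f s = 1 \<and> (\<forall>t. cmod (f t) \<le> 1) \<and> (\<forall>t\<in>S. cmod (f t) < 1)"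

lemma peakingI_not_boundary:
  assumes "\<not> boundary S"
  obtains f s where "peaking S f s"
proof -
  obtain b s0 where b: "b \<in> B" and s0: "\<And>t. t \<in> S \<Longrightarrow> cmod (b t) < cmod (b s0)"
    using assms unfolding boundary_def by (meson not_le)
  show ?thesis
  proof (cases "b s0 = 0")
    case True
    then have "S = {}" using s0 by fastforce
    then show ?thesis using that[of "\<lambda>_. 1"] const by (auto simp: peaking_def)
  next
    case False
    obtain s where s: "\<And>u. cmod (b u) \<le> cmod (b s)" using attains_sup[OF b, of UNIV] by auto
    have nz: "b s \<noteq> 0" using s[of s0] False by auto
    have "cmod (b t) < cmod (b s)" if "t \<in> S" for t using s0[OF that] s[of s0] by simp
    moreover have "cmod (inverse (b s) * b t) = cmod (b t) / cmod (b s)" for t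
      by (simp add: norm_mult norm_inverse divide_inverse mult.commute)
    ultimately have "peaking S (\<lambda>t. inverse (b s) * b t) s"
      unfolding peaking_def using s nz cmult[OF b] by (simp add: divide_le_eq_1 divide_less_eq_1)
    then show ?thesis by (rule that)
  qed
qed

lemma boundary_mono: "boundary S \<Longrightarrow> S \<subseteq> S' \<Longrightarrow> boundary S'"
  unfolding boundary_def by blast

lemma peaking_small_power:
  assumes f: "f \<in> B" "closed S" "\<And>u. u \<in> S \<Longrightarrow> cmod (f u) < 1" and e: "e > 0"
  obtains n :: nat where "\<And>u. u \<in> S \<Longrightarrow> cmod (f u ^ n) < e"
proof -
  obtain \<rho> where \<rho>: "0 \<le> \<rho>" "\<rho> < 1" "\<And>u. u \<in> S \<Longrightarrow> cmod (f u) \<le> \<rho>"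
    using strict_bound[OF f] by blast
  obtain n where n: "\<rho> ^ n < e" using real_arch_pow_inv[OF e \<rho>(2)] by blast
  have "cmod (f u ^ n) < e" if "u \<in> S" for u
    using power_mono[OF \<rho>(3)[OF that] norm_ge_zero, of n] n by (simp add: norm_power)
  then show ?thesis by (rule that)
qed

text \<open>
  A function with values in a thin neighbourhood of \<open>[0,1]\<close> that peaks in \<open>U\<close>: the average of powers
  of one peak function, whose transition regions from \<open>1\<close> to \<open>0\<close> are pairwise disjoint.
\<close>

lemma peak_function_exists:
  assumes U: "open U" "\<not> boundary (- U)" and \<kappa>: "\<kappa> > 0"
  obtains h t where "h \<in> B" "t \<in> U" "h t = 1" "\<And>u. u \<notin> U \<Longrightarrow> cmod (h u) \<le> \<kappa>"
    "\<And>u. cmod (h u) + cmod (1 - h u) \<le> 1 + \<kappa>"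
proof -
  obtain a s where a: "peaking (- U) a s" using peakingI_not_boundary[OF U(2)] by blast
  have aB: "a \<in> B" and as: "a s = 1" and a1: "\<And>t. cmod (a t) \<le> 1"
    and aU: "\<And>t. t \<notin> U \<Longrightarrow> cmod (a t) < 1"
    using a by (auto simp: peaking_def)
  \<comment> \<open>Averaging with \<open>1\<close> leaves modulus \<open>1\<close> only where
    \<open>a t = 1\<close>. There all powers of \<open>g\<close> equal \<open>1\<close>, and off any
    neighbourhood of that set they decay uniformly.\<close>
  define g where "g t = (1/2) * (1 + a t)" for t
  have gB: "g \<in> B" unfolding g_def by (intro cmult add const aB)
  have g1: "cmod (g t) \<le> 1" for t
    using norm_triangle_ineq[of 1 "a t"] a1[of t] by (simp add: g_def norm_mult)
  have gs: "g s = 1" by (simp add: g_def as)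
  have glt: "cmod (g t) < 1" if "a t \<noteq> 1" for t
  proof (rule ccontr)
    assume "\<not> ?thesis"
    then have c2: "cmod (1 + a t) \<ge> 2" by (simp add: g_def norm_mult)
    have "(cmod (1 + a t))\<^sup>2 = 1 + 2 * Re (a t) + (cmod (a t))\<^sup>2"
      unfolding cmod_power2 by (simp add: power2_eq_square algebra_simps)
    moreover have "(cmod (a t))\<^sup>2 \<le> 1" using a1[of t] by (simp add: power_le_one)
    moreover have "(cmod (1 + a t))\<^sup>2 \<ge> 2\<^sup>2" using c2 by (intro power_mono) auto
    moreover have "Re (a t) \<le> cmod (a t)" by (rule complex_Re_le_cmod)
    ultimately have "Re (a t) = 1" "(cmod (a t))\<^sup>2 \<le> 1" using a1[of t] by auto
    then have "a t = 1" by (simp add: cmod_power2 complex_eq_iff)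
    with that show False by simp
  qed
  define E where "E = {t. a t = 1}"
  have EU: "E \<subseteq> U" using aU by (force simp: E_def)
  have gE: "g t = 1" if "t \<in> E" for t using that by (simp add: E_def g_def)
  \<comment> \<open>The final error is \<open>2 * \<delta> + 2 / N\<close>; the choices
    \<open>N > 4 / \<kappa>\<close> and \<open>\<delta> = \<kappa> / 4\<close> bound each summand by
    \<open>\<kappa> / 2\<close>.\<close>
  obtain N :: nat where N: "4 / \<kappa> < real N" using reals_Archimedean2 by blast
  have N0: "N > 0" using N \<kappa> by (cases N) (auto simp: field_simps)
  define \<delta> where "\<delta> = \<kappa> / 4"
  have \<delta>: "\<delta> > 0" using \<kappa> by (simp add: \<delta>_def)
  have small: "\<exists>m. \<forall>u. u \<notin> V \<longrightarrow> cmod (g u ^ m) \<le> \<delta>" if V: "open V" "E \<subseteq> V" for V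
  proof -
    obtain m where "\<And>u. u \<in> - V \<Longrightarrow> cmod (g u ^ m) < \<delta>"
    proof (rule peaking_small_power[OF gB _ _ \<delta>, of "- V"])
      show "cmod (g u) < 1" if "u \<in> - V" for u using that V(2) by (intro glt) (auto simp: E_def)
    qed (use V that in auto)
    then show ?thesis by (intro exI[of _ m]) (auto intro: less_imp_le)
  qed
  \<comment> \<open>The next set consists of the points where the current power is already close to
    \<open>1\<close>, and the next exponent makes the power small off that set. The transition
    regions \<open>V j - V (Suc j)\<close> are therefore disjoint.\<close>
  have "\<exists>Vm. \<forall>n. (open (fst (Vm n)) \<and> E \<subseteq> fst (Vm n) \<and> fst (Vm n) \<subseteq> U \<and>
        (\<forall>u. u \<notin> fst (Vm n) \<longrightarrow> cmod (g u ^ snd (Vm n)) \<le> \<delta>)) \<and>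
      fst (Vm (Suc n)) = fst (Vm n) \<inter> {u. cmod (1 - g u ^ snd (Vm n)) < \<delta>}"
  proof (rule dependent_nat_choice)
    show "\<exists>Vm. open (fst Vm) \<and> E \<subseteq> fst Vm \<and> fst Vm \<subseteq> U \<and>
        (\<forall>u. u \<notin> fst Vm \<longrightarrow> cmod (g u ^ snd Vm) \<le> \<delta>)"
      using small[OF U(1) EU] U EU by (metis fst_conv snd_conv order_refl)
  next
    fix Vm :: "'k set \<times> nat" and n :: nat
    assume *: "open (fst Vm) \<and> E \<subseteq> fst Vm \<and> fst Vm \<subseteq> U \<and>
        (\<forall>u. u \<notin> fst Vm \<longrightarrow> cmod (g u ^ snd Vm) \<le> \<delta>)"
    define V' where "V' = fst Vm \<inter> {u. cmod (1 - g u ^ snd Vm) < \<delta>}"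
    have "open V'" unfolding V'_def using * by (intro open_Int open_less diff const power gB) auto
    moreover have "E \<subseteq> V'" using * \<delta> by (auto simp: V'_def gE)
    ultimately obtain m where "\<forall>u. u \<notin> V' \<longrightarrow> cmod (g u ^ m) \<le> \<delta>" using small by blast
    then show "\<exists>Vm'. (open (fst Vm') \<and> E \<subseteq> fst Vm' \<and> fst Vm' \<subseteq> U \<and>
        (\<forall>u. u \<notin> fst Vm' \<longrightarrow> cmod (g u ^ snd Vm') \<le> \<delta>)) \<and>
        fst Vm' = fst Vm \<inter> {u. cmod (1 - g u ^ snd Vm) < \<delta>}"
      using \<open>open V'\<close> \<open>E \<subseteq> V'\<close> * by (intro exI[of _ "(V', m)"]) (auto simp: V'_def)
  qed
  then obtain Vm where "\<forall>n. (open (fst (Vm n)) \<and> E \<subseteq> fst (Vm n) \<and> fst (Vm n) \<subseteq> U \<and>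
        (\<forall>u. u \<notin> fst (Vm n) \<longrightarrow> cmod (g u ^ snd (Vm n)) \<le> \<delta>)) \<and>
      fst (Vm (Suc n)) = fst (Vm n) \<inter> {u. cmod (1 - g u ^ snd (Vm n)) < \<delta>}" by blast
  moreover define V m where "V n = fst (Vm n)" and "m n = snd (Vm n)" for n
  ultimately have VU: "\<And>n. V n \<subseteq> U" and off: "\<And>n u. u \<notin> V n \<Longrightarrow> cmod (g u ^ m n) \<le> \<delta>"
    and step: "\<And>n. V (Suc n) = V n \<inter> {u. cmod (1 - g u ^ m n) < \<delta>}" by auto
  have dec: "V j \<subseteq> V i" if "i \<le> j" for i j
    by (rule lift_Suc_antimono_le[OF _ that]) (auto simp only: step)
  define h where "h u = (1 / of_nat N) * (\<Sum>j<N. g u ^ m j)" for u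
  have hB: "h \<in> B" unfolding h_def by (intro cmult sum power gB)
  have gp1: "cmod (g u ^ i) \<le> 1" for u i using g1 by (simp add: norm_power power_le_one)
  have h_le: "cmod (h u) \<le> (\<Sum>j<N. cmod (g u ^ m j)) / N" for u
    using norm_sum[of "\<lambda>j. g u ^ m j" "{..<N}"] N0
    by (simp add: h_def norm_mult norm_divide divide_right_mono)
  have "h s = 1" using N0 by (simp add: h_def gs)
  moreover have "s \<in> U" using EU by (auto simp: E_def as)
  moreover have "cmod (h u) \<le> \<kappa>" if "u \<notin> U" for u
  proof -
    have "cmod (g u ^ m j) \<le> \<delta>" for j using that VU off by blast
    then have "(\<Sum>j<N. cmod (g u ^ m j)) \<le> (\<Sum>j<N. \<delta>)" by (intro sum_mono)
    then have "(\<Sum>j<N. cmod (g u ^ m j)) / N \<le> \<delta>" using N0 by (simp add: field_simps)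
    with h_le[of u] have "cmod (h u) \<le> \<delta>" by (rule order_trans)
    then show ?thesis using \<kappa> by (simp add: \<delta>_def)
  qed
  moreover have "cmod (h u) + cmod (1 - h u) \<le> 1 + \<kappa>" for u
  proof -
    have "1 - h u = (1 / of_nat N) * (\<Sum>j<N. 1 - g u ^ m j)"
      using N0 by (simp add: h_def sum_subtractf field_simps)
    then have "cmod (1 - h u) \<le> (\<Sum>j<N. cmod (1 - g u ^ m j)) / N"
      using norm_sum[of "\<lambda>j. 1 - g u ^ m j" "{..<N}"] N0
      by (simp add: norm_mult norm_divide divide_right_mono)
    then have "cmod (h u) + cmod (1 - h u) \<le> (\<Sum>j<N. cmod (g u ^ m j) + cmod (1 - g u ^ m j)) / N"
      using h_le[of u] by (simp add: sum.distrib add_divide_distrib)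
    also have "(\<Sum>j<N. cmod (g u ^ m j) + cmod (1 - g u ^ m j)) \<le>
        (\<Sum>j<N. (1 + 2 * \<delta>) + (if u \<in> V j - V (Suc j) then 2 else 0))"
    \<comment> \<open>Where the power is near \<open>0\<close> or near \<open>1\<close> the two
      moduli add up to about \<open>1\<close>. In a transition region the sum can reach
      \<open>3\<close>, but each \<open>u\<close> lies in at most one of them.\<close>
    proof (rule sum_mono)
      fix j
      have tri: "cmod (1 - g u ^ m j) \<le> 1 + cmod (g u ^ m j)"
        using norm_triangle_ineq4[of 1 "g u ^ m j"] by simp
      consider "u \<in> V (Suc j)" | "u \<notin> V j" | "u \<in> V j - V (Suc j)" by blast
      then show "cmod (g u ^ m j) + cmod (1 - g u ^ m j) \<le>
          (1 + 2 * \<delta>) + (if u \<in> V j - V (Suc j) then 2 else 0)"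
      proof cases
        case 1
        then have "cmod (1 - g u ^ m j) < \<delta>" by (simp add: step)
        then show ?thesis using gp1[of u "m j"] \<delta> by simp
      next
        case 2
        then show ?thesis using off[OF 2] tri \<delta> by simp
      next
        case 3
        then show ?thesis using gp1[of u "m j"] tri \<delta> by simp
      qed
    qed
    also have "\<dots> = N * (1 + 2 * \<delta>) + (\<Sum>j<N. (if u \<in> V j - V (Suc j) then 2 else 0))"
      by (simp add: sum.distrib)
    also have "(\<Sum>j<N. (if u \<in> V j - V (Suc j) then 2 else 0 :: real)) =
        2 * card {j. j < N \<and> u \<in> V j - V (Suc j)}"
      by (simp add: sum.If_cases Int_def)
    also have "card {j. j < N \<and> u \<in> V j - V (Suc j)} \<le> 1"
    proof -
      have "j = j'" if "u \<in> V j - V (Suc j)" "u \<in> V j' - V (Suc j')" for j j'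
        using that dec[of "Suc j" j'] dec[of "Suc j'" j] by (metis DiffD1 DiffD2 Suc_leI linorder_neqE_nat subsetD)
      then show ?thesis by (simp add: card_le_Suc0_iff_eq)
    qed
    finally have "cmod (h u) + cmod (1 - h u) \<le> (N * (1 + 2 * \<delta>) + 2) / N"
      using N0 by (simp add: divide_right_mono)
    also have "\<dots> = 1 + 2 * \<delta> + 2 / N" using N0 by (simp add: field_simps)
    also have "2 / N \<le> \<kappa> / 2" using N N0 \<kappa> by (simp add: field_simps)
    finally show ?thesis using \<kappa> by (simp add: \<delta>_def)
  qed
  ultimately show ?thesis using that hB by blast
qed

text \<open>A local description of the smallest closed boundary: no open neighbourhood of such a
  point can be deleted from the space without losing the maximum modulus of some function.\<close>

definition shilov :: "'k set" where
  "shilov = {s. \<forall>V. open V \<longrightarrow> s \<in> V \<longrightarrow> \<not> boundary (- V)}"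

lemma boundaryD: "boundary S \<Longrightarrow> f \<in> B \<Longrightarrow> \<exists>t\<in>S. cmod (f s) \<le> cmod (f t)"
  by (simp add: boundary_def)

text \<open>The topology of a compact space is generated by any separating algebra. For each point
  off \<open>V\<close> a function vanishing at \<open>s\<close> is scaled to the value
  \<open>2\<close> there, and compactness of \<open>- V\<close> leaves finitely many.\<close>

lemma basic_neighbourhood:
  assumes V: "open V" "s \<in> V"
  obtains G where "finite G" "G \<subseteq> B" "\<And>g. g \<in> G \<Longrightarrow> g s = 0" "{t. \<forall>g\<in>G. cmod (g t) < 1} \<subseteq> V"
proof -
  have "\<exists>g\<in>B. g s = 0 \<and> g t = 2" if t: "t \<notin> V" for t
  proof -
    have "s \<noteq> t" using V t by blast
    then obtain f where f: "f \<in> B" "f s \<noteq> f t" using separating by blast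
    define g where "g u = (2 / (f t - f s)) * (f u - f s)" for u
    have "g \<in> B" unfolding g_def by (intro cmult diff const f)
    moreover have "f t - f s \<noteq> 0" using f by simp
    then have "g s = 0 \<and> g t = 2" by (simp add: g_def divide_simps)
    ultimately show ?thesis by blast
  qed
  then obtain g where g: "\<And>t. t \<notin> V \<Longrightarrow> g t \<in> B" "\<And>t. t \<notin> V \<Longrightarrow> g t s = 0" "\<And>t. t \<notin> V \<Longrightarrow> g t t = 2"
    by metis
  have "compact (- V)" using compact_Int_closed[OF compact_space, of "- V"] V by auto
  moreover have "open {u. 1 < cmod (g t u)}" if "t \<in> - V" for t
    using that g by (intro open_greater) auto
  moreover have "- V \<subseteq> (\<Union>t\<in>- V. {u. 1 < cmod (g t u)})" using g by auto
  ultimately obtain D where D: "D \<subseteq> - V" "finite D" "- V \<subseteq> (\<Union>t\<in>D. {u. 1 < cmod (g t u)})"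
    by (rule compactE_image)
  show ?thesis
  proof (rule that[of "g ` D"])
    show "{t. \<forall>g\<in>g ` D. cmod (g t) < 1} \<subseteq> V"
    proof
      fix u assume u: "u \<in> {t. \<forall>g\<in>g ` D. cmod (g t) < 1}"
      show "u \<in> V"
      proof (rule ccontr)
        assume "u \<notin> V"
        then obtain t where "t \<in> D" "1 < cmod (g t u)" using D(3) by blast
        with u show False by force
      qed
    qed
  qed (use D g in auto)
qed

text \<open>
  Hoermander's argument: if \<open>f\<close> peaks off \<open>S - V\<close>, then the products \<open>f ^ n * g\<close> with \<open>g \<in> G\<close> are less
  than \<open>1\<close> on \<open>S\<close>, hence everywhere, so that \<open>f\<close> attains its maximum only in \<open>V\<close>.
\<close>

lemma boundary_diff:
  assumes G: "finite G" "G \<subseteq> B" and V: "V = {t. \<forall>g\<in>G. cmod (g t) < 1}" and bV: "boundary (- V)"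
    and S: "closed S" "boundary S"
  shows "boundary (S - V)"
proof (rule ccontr)
  assume "\<not> boundary (S - V)"
  then obtain f s where f: "peaking (S - V) f s" by (rule peakingI_not_boundary)
  then have fB: "f \<in> B" and fs: "f s = 1" and f1: "\<And>t. cmod (f t) \<le> 1"
    and fS: "\<And>t. t \<in> S - V \<Longrightarrow> cmod (f t) < 1" by (auto simp: peaking_def)
  have "V = (\<Inter>g\<in>G. {t. cmod (g t) < 1})" using V by auto
  then have "open V" using G by (auto intro!: open_INT open_less)
  then have cl: "closed (S - V)" using S by (intro closed_Diff)
  have "\<exists>n. \<forall>t\<in>S - V. cmod (f t ^ n * g t) < 1" if g: "g \<in> G" for g
  proof -
    obtain C where C: "C > 0" "\<And>u. cmod (g u) \<le> C" using bounded[of g] g G by blast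
    obtain n where n: "\<And>u. u \<in> S - V \<Longrightarrow> cmod (f u ^ n) < 1 / C"
      using peaking_small_power[OF fB cl fS, of "1 / C"] C by auto
    have "cmod (f t ^ n * g t) < 1" if "t \<in> S - V" for t
    proof -
      have "cmod (f t ^ n * g t) \<le> cmod (f t ^ n) * C"
        unfolding norm_mult by (intro mult_left_mono C) auto
      also have "\<dots> < (1 / C) * C" by (intro mult_strict_right_mono n that C)
      finally show ?thesis using C by simp
    qed
    then show ?thesis by blast
  qed
  then obtain n where n: "\<And>g t. g \<in> G \<Longrightarrow> t \<in> S - V \<Longrightarrow> cmod (f t ^ n g * g t) < 1" by metis
  have small: "cmod (f t ^ n g * g t) < 1" if g: "g \<in> G" for g t
  proof -
    have "(\<lambda>t. f t ^ n g * g t) \<in> B" using g G by (intro mult power fB) auto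
    then obtain u where u: "u \<in> S" "cmod (f t ^ n g * g t) \<le> cmod (f u ^ n g * g u)"
      using boundaryD[OF S(2), of "\<lambda>t. f t ^ n g * g t" t] by blast
    have "cmod (f u ^ n g * g u) < 1"
    proof (cases "u \<in> V")
      case True
      have "cmod (f u ^ n g * g u) \<le> 1 * cmod (g u)"
        unfolding norm_mult norm_power by (intro mult_right_mono power_le_one f1) auto
      also have "\<dots> < 1" using True V g by simp
      finally show ?thesis .
    qed (use n u g in auto)
    with u show ?thesis by simp
  qed
  obtain t where t: "t \<in> - V" "cmod (f s) \<le> cmod (f t)" using boundaryD[OF bV fB] by blast
  then have "cmod (f t) = 1" using f1[of t] fs by simp
  then have "cmod (g t) < 1" if "g \<in> G" for g using small[OF that, of t] by (simp add: norm_mult norm_power)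
  then show False using t V by simp
qed

text \<open>A function peaking off \<open>- U\<close> has modulus \<open>1\<close> only on a compact
  set \<open>C\<close> inside \<open>U\<close>. If \<open>U\<close> missed \<open>shilov\<close>,
  finitely many deletable neighbourhoods would cover \<open>C\<close>, and deleting them all would
  leave a boundary on which the function stays below its maximum.\<close>

lemma shilov_meets:
  assumes U: "open U" "\<not> boundary (- U)"
  shows "\<exists>s\<in>U. s \<in> shilov"
proof (rule ccontr)
  assume "\<not> ?thesis"
  then have none: "s \<notin> shilov" if "s \<in> U" for s using that by blast
  obtain f s where f: "peaking (- U) f s" using peakingI_not_boundary[OF U(2)] .
  then have fB: "f \<in> B" and fs: "f s = 1" and f1: "\<And>t. cmod (f t) \<le> 1"
    and fU: "\<And>t. t \<notin> U \<Longrightarrow> cmod (f t) < 1" by (auto simp: peaking_def)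
  define C where "C = - {t. cmod (f t) < 1}"
  have C: "compact C" using compact_Int_closed[OF compact_space, of C] open_less[OF fB] by (auto simp: C_def)
  have "\<exists>G. finite G \<and> G \<subseteq> B \<and> (\<forall>g\<in>G. g t = 0) \<and> boundary (- {u. \<forall>g\<in>G. cmod (g u) < 1})"
    if t: "t \<in> C" for t
  proof -
    have "t \<in> U" using t fU by (auto simp: C_def)
    then obtain V where V: "open V" "t \<in> V" "boundary (- V)" using none[of t] by (auto simp: shilov_def)
    obtain G where G: "finite G" "G \<subseteq> B" "\<And>g. g \<in> G \<Longrightarrow> g t = 0" "{u. \<forall>g\<in>G. cmod (g u) < 1} \<subseteq> V"
      using basic_neighbourhood[OF V(1,2)] by blast
    have "boundary (- {u. \<forall>g\<in>G. cmod (g u) < 1})" using V(3) G(4) by (intro boundary_mono[OF V(3)]) blast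
    with G show ?thesis by blast
  qed
  then have "\<forall>t\<in>C. \<exists>G. finite G \<and> G \<subseteq> B \<and> (\<forall>g\<in>G. g t = 0) \<and> boundary (- {u. \<forall>g\<in>G. cmod (g u) < 1})"
    by blast
  from bchoice[OF this] obtain G where G0: "\<forall>t\<in>C. finite (G t) \<and> G t \<subseteq> B \<and> (\<forall>g\<in>G t. g t = 0) \<and>
      boundary (- {u. \<forall>g\<in>G t. cmod (g u) < 1})" by blast
  then have G: "\<And>t. t \<in> C \<Longrightarrow> finite (G t)" "\<And>t. t \<in> C \<Longrightarrow> G t \<subseteq> B"
    "\<And>t g. t \<in> C \<Longrightarrow> g \<in> G t \<Longrightarrow> g t = 0" "\<And>t. t \<in> C \<Longrightarrow> boundary (- {u. \<forall>g\<in>G t. cmod (g u) < 1})"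
    by blast+
  define V where "V t = {u. \<forall>g\<in>G t. cmod (g u) < 1}" for t
  have openV: "open (V t)" if "t \<in> C" for t
  proof -
    have "V t = (\<Inter>g\<in>G t. {u. cmod (g u) < 1})" by (auto simp: V_def)
    then show ?thesis using G(1,2)[OF that] by (auto intro!: open_INT open_less)
  qed
  have "t \<in> V t" if "t \<in> C" for t by (simp add: V_def G(3)[OF that])
  then have "C \<subseteq> (\<Union>t\<in>C. V t)" by blast
  from compactE_image[OF C openV this] obtain D where D: "D \<subseteq> C" "finite D" "C \<subseteq> (\<Union>t\<in>D. V t)" by blast
  \<comment> \<open>Starting from the whole space, the sets \<open>V t\<close> are removed one at a
    time.\<close>
  have "closed (UNIV - (\<Union>t\<in>D. V t)) \<and> boundary (UNIV - (\<Union>t\<in>D. V t))"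
    using D(2,1)
  proof (induction D rule: finite_induct)
    case empty
    show ?case by (auto simp: boundary_def)
  next
    case (insert t D)
    have eq: "UNIV - (\<Union>t\<in>insert t D. V t) = (UNIV - (\<Union>t\<in>D. V t)) - V t" by blast
    show ?case
      unfolding eq
    proof
      show "closed (UNIV - (\<Union>t\<in>D. V t) - V t)" 
        by (rule closed_Diff) (use insert.IH insert.prems openV[of t] in simp_all)
      show "boundary (UNIV - (\<Union>t\<in>D. V t) - V t)"
      proof (rule boundary_diff)
        show "finite (G t)" "G t \<subseteq> B" "boundary (- V t)"
          unfolding V_def using G(1,2,4)[of t] insert.prems by simp_all
      qed (use insert.IH insert.prems V_def in simp_all)
    qed
  qed
  then obtain t where t: "t \<in> UNIV - (\<Union>t\<in>D. V t)" "cmod (f s) \<le> cmod (f t)"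
    using boundaryD[OF _ fB] by blast
  then have "t \<in> C" using fs by (simp add: C_def)
  with D(3) t show False by blast
qed

text \<open>An approximate maximum principle: the open set where \<open>cmod (f t)\<close> exceeds
  \<open>r\<close> contains a maximum point of \<open>f\<close>, so its complement is not a
  boundary.\<close>

lemma boundary_shilov_approx:
  assumes f: "f \<in> B" and r: "r < cmod (f s)"
  obtains t where "t \<in> shilov" "r < cmod (f t)"
proof -
  have "\<not> boundary (- {t. r < cmod (f t)})"
  proof
    assume "boundary (- {t. r < cmod (f t)})"
    from boundaryD[OF this f, of s] r show False by auto
  qed
  from shilov_meets[OF open_greater[OF f] this] show ?thesis using that by auto
qed

lemma zero_on_shilov:
  assumes f: "f \<in> B" and "\<And>t. t \<in> shilov \<Longrightarrow> f t = 0"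
  shows "f s = 0"
proof (rule ccontr)
  assume "f s \<noteq> 0"
  then obtain t where "t \<in> shilov" "0 < cmod (f t)" using boundary_shilov_approx[OF f, of 0 s] by auto
  with assms(2) show False by simp
qed

text \<open>A function peaking off \<open>- W\<close> has modulus \<open>1\<close> at
  \<open>s\<close> and at most \<open>\<rho> < 1\<close> on the rest of \<open>shilov\<close>. After
  normalization at \<open>s\<close> its powers converge uniformly, and the limit is \<open>1\<close>
  at \<open>s\<close> and \<open>0\<close> on the rest of \<open>shilov\<close>.\<close>

lemma isolated_shilov_indicator:
  assumes s: "s \<in> shilov" and W: "open W" "shilov \<inter> W = {s}"
  shows "(\<lambda>t. if t = s then 1 else 0) \<in> B"
proof -
  have "\<not> boundary (- W)" using s W by (auto simp: shilov_def)
  then obtain a p where a: "peaking (- W) a p" by (rule peakingI_not_boundary)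
  then have aB: "a \<in> B" and ap: "a p = 1" and a1: "\<And>t. cmod (a t) \<le> 1"
    and aW: "\<And>t. t \<in> - W \<Longrightarrow> cmod (a t) < 1" by (auto simp: peaking_def)
  have "closed (- W)" using W by auto
  then obtain \<rho> where \<rho>: "0 \<le> \<rho>" "\<rho> < 1" "\<And>u. u \<in> - W \<Longrightarrow> cmod (a u) \<le> \<rho>"
    using strict_bound[OF aB _ aW] by blast
  \<comment> \<open>On \<open>shilov\<close>, modulus above \<open>\<rho>\<close> is possible only
    in \<open>W\<close>, that is, only at \<open>s\<close>. So the maximum known at some point
    \<open>p\<close> must occur at \<open>s\<close>.\<close>
  have big: "r < cmod (a s)" if r: "r < 1" "\<rho> \<le> r" for r
  proof -
    obtain t where t: "t \<in> shilov" "r < cmod (a t)" using boundary_shilov_approx[OF aB, of r p] ap r by auto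
    then have "t \<in> W" using \<rho>(3)[of t] r by force
    with t W show ?thesis by auto
  qed
  have as: "cmod (a s) = 1"
  proof (rule ccontr)
    assume "cmod (a s) \<noteq> 1"
    then have lt: "cmod (a s) < 1" using a1[of s] by simp
    then show False using big[of "max \<rho> (cmod (a s))"] \<rho> by auto
  qed
  define f where "f t = inverse (a s) * a t" for t
  have fB: "f \<in> B" unfolding f_def by (intro cmult aB)
  have norm_f: "cmod (f t) = cmod (a t)" for t by (simp add: f_def norm_mult norm_inverse as)
  have "a s \<noteq> 0" using as by auto
  then have fs: "f s = 1" by (simp add: f_def)
  have f\<rho>: "cmod (f t) \<le> \<rho>" if "t \<in> shilov" "t \<noteq> s" for t
    unfolding norm_f using that W by (intro \<rho>(3)) auto
  \<comment> \<open>Differences of powers vanish at \<open>s\<close> and are at most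
    \<open>2 * \<rho> ^ N\<close> on the rest of \<open>shilov\<close>; the maximum principle
    extends this bound to the whole space.\<close>
  have cauchy: "cmod (f t ^ m - f t ^ n) \<le> 2 * \<rho> ^ N" if mn: "N \<le> m" "N \<le> n" for m n N t
  proof (rule ccontr)
    assume "\<not> ?thesis"
    moreover have "(\<lambda>t. f t ^ m - f t ^ n) \<in> B" by (intro diff power fB)
    ultimately obtain u where u: "u \<in> shilov" "2 * \<rho> ^ N < cmod (f u ^ m - f u ^ n)"
      using boundary_shilov_approx[of "\<lambda>t. f t ^ m - f t ^ n" "2 * \<rho> ^ N" t] by auto
    have "u \<noteq> s" using u \<rho> by (auto simp: fs)
    have pow: "cmod (f u) ^ k \<le> \<rho> ^ N" if "N \<le> k" for k
    proof -
      have "cmod (f u) ^ k \<le> \<rho> ^ k" using f\<rho>[OF u(1) \<open>u \<noteq> s\<close>] by (intro power_mono) auto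
      also have "\<dots> \<le> \<rho> ^ N" using \<rho> that by (intro power_decreasing) auto
      finally show ?thesis .
    qed
    have "cmod (f u ^ m - f u ^ n) \<le> cmod (f u) ^ m + cmod (f u) ^ n"
      using norm_triangle_ineq4[of "f u ^ m" "f u ^ n"] by (simp add: norm_power)
    with pow[OF mn(1)] pow[OF mn(2)] u(2) show False by simp
  qed
  have "uniformly_Cauchy_on UNIV (\<lambda>n t. f t ^ n)"
    unfolding uniformly_Cauchy_on_def
  proof (intro allI impI)
    fix e :: real assume "e > 0"
    then obtain N where N: "\<rho> ^ N < e / 2" using real_arch_pow_inv[of "e / 2" \<rho>] \<rho> by auto
    have "dist (f t ^ m) (f t ^ n) < e" if "N \<le> m" "N \<le> n" for t m n
      using cauchy[OF that, of t] N by (simp add: dist_norm)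
    then show "\<exists>M. \<forall>x\<in>UNIV. \<forall>m\<ge>M. \<forall>n\<ge>M. dist (f x ^ m) (f x ^ n) < e" by blast
  qed
  then obtain e where e: "uniform_limit UNIV (\<lambda>n t. f t ^ n) e sequentially"
    using Cauchy_uniformly_convergent uniformly_convergent_on_def by blast
  have eB: "e \<in> B" using uniformly_closed[OF _ e] power[OF fB] by blast
  have lim: "(\<lambda>n. f t ^ n) \<longlonglongrightarrow> e t" for t using tendsto_uniform_limitI[OF e, of t] by simp
  have es: "e s = 1" using lim[of s] by (simp add: fs LIMSEQ_const_iff)
  have e0: "e t = 0" if "t \<in> shilov" "t \<noteq> s" for t
  proof -
    have "cmod (f t) < 1" using f\<rho>[OF that] \<rho> by simp
    then have "(\<lambda>n. f t ^ n) \<longlonglongrightarrow> 0" by (rule LIMSEQ_power_zero)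
    with lim[of t] show ?thesis by (rule LIMSEQ_unique)
  qed
  have "e t = (if t = s then 1 else 0)" for t
  proof (cases "t = s")
    case False
    then obtain g where g: "g \<in> B" "g t \<noteq> g s" using separating[of t s] by auto
    \<comment> \<open>The factor \<open>g u - g s\<close> removes the value of \<open>e\<close> at
      \<open>s\<close>, so the product vanishes on \<open>shilov\<close> and hence at
      \<open>t\<close>, where \<open>g\<close> differs from \<open>g s\<close>.\<close>
    have "(g t - g s) * e t = 0"
    proof (rule zero_on_shilov[of "\<lambda>t. (g t - g s) * e t"])
      show "(\<lambda>t. (g t - g s) * e t) \<in> B" by (intro mult diff const g eB)
      show "(g u - g s) * e u = 0" if "u \<in> shilov" for u using e0[OF that] by (cases "u = s") auto
    qed
    with g False show ?thesis by simp
  qed (simp add: es)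
  then have "e = (\<lambda>t. if t = s then 1 else 0)" by (intro ext)
  with eB show ?thesis by simp
qed

text \<open>Since \<open>s\<close> is not isolated in \<open>shilov\<close>, shrinking
  neighbourhoods \<open>W n\<close> of \<open>s\<close> leave room for pairwise disjoint open sets
  \<open>U n\<close>, each around another Shilov point and thus supporting a peak function.\<close>

lemma peak_sequence_exists:
  assumes s: "s \<in> shilov" and iso: "\<And>W. open W \<Longrightarrow> s \<in> W \<Longrightarrow> \<exists>s'\<in>shilov \<inter> W. s' \<noteq> s"
    and V: "open V" "s \<in> V" and \<kappa>: "0 < \<kappa>" "\<kappa> \<le> 1"
  obtains h t where "\<And>n. h n \<in> B" "\<And>n. t n \<in> V" "\<And>n::nat. h n (t n) = 1"
    "\<And>n u. cmod (h n u) + cmod (1 - h n u) \<le> 1 + \<kappa>"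
    "\<And>S u. finite S \<Longrightarrow> (\<Sum>n\<in>S. cmod (h n u)) \<le> 4"
proof -
  have "\<exists>WU. \<forall>n. ((open (fst (WU n)) \<and> s \<in> fst (WU n) \<and> fst (WU n) \<subseteq> V) \<and>
        (open (snd (WU n)) \<and> \<not> boundary (- snd (WU n)) \<and> snd (WU n) \<subseteq> V) \<and> fst (WU n) \<inter> snd (WU n) = {}) \<and>
      fst (WU (Suc n)) \<subseteq> fst (WU n) \<and> snd (WU (Suc n)) \<subseteq> fst (WU n)"
  proof (rule dependent_nat_choice)
    have step: "\<exists>W' U'. open W' \<and> s \<in> W' \<and> W' \<subseteq> W \<and> open U' \<and> \<not> boundary (- U') \<and> U' \<subseteq> W \<and> W' \<inter> U' = {}"
      if W: "open W" "s \<in> W" for W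
    proof -
      obtain s' where s': "s' \<in> shilov" "s' \<in> W" "s' \<noteq> s" using iso[OF W] by auto
      then obtain W' U' where WU: "open W'" "open U'" "s \<in> W'" "s' \<in> U'" "W' \<inter> U' = {}"
        using hausdorff[of s s'] by blast
      have "\<not> boundary (- (U' \<inter> W))" using s' WU W by (auto simp: shilov_def)
      then show ?thesis
        using WU W by (intro exI[of _ "W' \<inter> W"] exI[of _ "U' \<inter> W"]) auto
    qed
    show "\<exists>WU. (open (fst WU) \<and> s \<in> fst WU \<and> fst WU \<subseteq> V) \<and>
        (open (snd WU) \<and> \<not> boundary (- snd WU) \<and> snd WU \<subseteq> V) \<and> fst WU \<inter> snd WU = {}"
      using step[OF V] by auto
    fix WU :: "'k set \<times> 'k set" and n :: nat
    assume *: "(open (fst WU) \<and> s \<in> fst WU \<and> fst WU \<subseteq> V) \<and>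
        (open (snd WU) \<and> \<not> boundary (- snd WU) \<and> snd WU \<subseteq> V) \<and> fst WU \<inter> snd WU = {}"
    then obtain W' U' where "open W'" "s \<in> W'" "W' \<subseteq> fst WU" "open U'" "\<not> boundary (- U')" "U' \<subseteq> fst WU" "W' \<inter> U' = {}"
      using step[of "fst WU"] by blast
    then show "\<exists>WU'. ((open (fst WU') \<and> s \<in> fst WU' \<and> fst WU' \<subseteq> V) \<and>
        (open (snd WU') \<and> \<not> boundary (- snd WU') \<and> snd WU' \<subseteq> V) \<and> fst WU' \<inter> snd WU' = {}) \<and>
        fst WU' \<subseteq> fst WU \<and> snd WU' \<subseteq> fst WU"
      using * by (intro exI[of _ "(W', U')"]) auto
  qed
  then obtain WU where "\<forall>n. ((open (fst (WU n)) \<and> s \<in> fst (WU n) \<and> fst (WU n) \<subseteq> V) \<and>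
        (open (snd (WU n)) \<and> \<not> boundary (- snd (WU n)) \<and> snd (WU n) \<subseteq> V) \<and> fst (WU n) \<inter> snd (WU n) = {}) \<and>
      fst (WU (Suc n)) \<subseteq> fst (WU n) \<and> snd (WU (Suc n)) \<subseteq> fst (WU n)" by blast
  moreover define W U where "W n = fst (WU n)" and "U n = snd (WU n)" for n
  ultimately have U: "\<And>n. open (U n)" "\<And>n. \<not> boundary (- U n)" "\<And>n. U n \<subseteq> V"
    and WU: "\<And>n. W n \<inter> U n = {}" and dec: "\<And>n. W (Suc n) \<subseteq> W n" and UW: "\<And>n. U (Suc n) \<subseteq> W n"
    by auto
  have "U n \<inter> U m = {}" if "n < m" for n m
  proof -
    have "W (m - 1) \<subseteq> W n" by (rule lift_Suc_antimono_le[of W]) (use dec that in auto)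
    moreover have "U m \<subseteq> W (m - 1)" using UW[of "m - 1"] that by simp
    ultimately show ?thesis using WU[of n] by blast
  qed
  then have disj: "n = m" if "u \<in> U n" "u \<in> U m" for u n m
    using that by (metis IntI empty_iff linorder_neqE_nat)
  \<comment> \<open>The tolerance \<open>(1/2) ^ n\<close> makes the tails outside the
    \<open>U n\<close> sum to at most \<open>2\<close>. The single \<open>U n\<close> that may
    contain \<open>u\<close> adds at most another \<open>2\<close>, which explains the bound
    \<open>4\<close>.\<close>
  have "\<exists>h t. h \<in> B \<and> t \<in> U n \<and> h t = 1 \<and> (\<forall>u. u \<notin> U n \<longrightarrow> cmod (h u) \<le> min \<kappa> ((1/2) ^ n)) \<and>
      (\<forall>u. cmod (h u) + cmod (1 - h u) \<le> 1 + min \<kappa> ((1/2) ^ n))" for n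
  proof -
    have "0 < min \<kappa> ((1/2) ^ n)" using \<kappa>(1) by simp
    from peak_function_exists[OF U(1)[of n] U(2)[of n] this] show ?thesis by metis
  qed
  then obtain h t where h: "\<And>n. h n \<in> B" "\<And>n. t n \<in> U n" "\<And>n. h n (t n) = 1"
    "\<And>n u. u \<notin> U n \<Longrightarrow> cmod (h n u) \<le> min \<kappa> ((1/2) ^ n)"
    "\<And>n u. cmod (h n u) + cmod (1 - h n u) \<le> 1 + min \<kappa> ((1/2) ^ n)" by metis
  have "(\<Sum>n\<in>S. cmod (h n u)) \<le> 4" if S: "finite S" for S u
  proof -
    have "cmod (h n u) \<le> (1/2) ^ n + (if u \<in> U n then 2 else 0)" for n
    proof (cases "u \<in> U n")
      case True
      have "cmod (h n u) \<le> 1 + min \<kappa> ((1/2) ^ n)" using h(5)[of n u] norm_ge_zero[of "1 - h n u"] by linarith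
      then show ?thesis using True \<kappa>(2) by simp
    qed (use h(4)[of u n] in simp)
    then have "(\<Sum>n\<in>S. cmod (h n u)) \<le> (\<Sum>n\<in>S. (1/2) ^ n + (if u \<in> U n then 2 else 0))" by (intro sum_mono)
    also have "\<dots> = (\<Sum>n\<in>S. (1/2) ^ n) + 2 * card {n \<in> S. u \<in> U n}"
      using S by (simp add: sum.distrib sum.If_cases Int_def)
    also have "(\<Sum>n\<in>S. (1/2) ^ n :: real) \<le> (\<Sum>n. (1/2) ^ n)"
      using S by (intro sum_le_suminf summable_geometric) auto
    also have "(\<Sum>n. (1/2) ^ n :: real) = 2" by (simp add: suminf_geometric)
    also have "card {n \<in> S. u \<in> U n} \<le> 1" using S disj by (auto simp: card_le_Suc0_iff_eq)
    finally show ?thesis by simp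
  qed
  moreover have "cmod (h n u) + cmod (1 - h n u) \<le> 1 + \<kappa>" for n u using h(5)[of n u] by simp
  moreover have "t n \<in> V" for n using h(2) U(3) by (rule subsetD[rotated])
  ultimately show ?thesis by (intro that[of h t] h(1,3)) simp_all
qed

end

section \<open>Weak topologies\<close>

lemma cdual_zero: "(\<lambda>_. 0) \<in> cdual Z"
  by (auto simp: cdual_def intro!: exI[of _ 0])

lemma cdual_eq_bounded_clinear_on: "\<phi> \<in> cdual Z \<longleftrightarrow> bounded_clinear_on Z UNIV \<phi>"
  by (auto simp: cdual_def bounded_clinear_on_def)

lemma bounded_clinear_on_compose:
  assumes "bounded_clinear_on U V L" "bounded_clinear_on V W G"
  shows "bounded_clinear_on U W (\<lambda>u. G (L u))"
proof -
  obtain a where a: "a \<ge> 0" "\<And>u. u \<in> U \<Longrightarrow> norm (L u) \<le> a * norm u"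
    using bounded_clinear_on_bound[OF assms(1)] by blast
  obtain b where b: "b \<ge> 0" "\<And>u. u \<in> V \<Longrightarrow> norm (G u) \<le> b * norm u"
    using bounded_clinear_on_bound[OF assms(2)] by blast
  note L = bounded_clinear_onD[OF assms(1)] and G = bounded_clinear_onD[OF assms(2)]
  show ?thesis
  proof (rule bounded_clinear_onI)
    fix u assume u: "u \<in> U"
    have "norm (G (L u)) \<le> b * norm (L u)" using u L(1) b by blast
    also have "\<dots> \<le> b * (a * norm u)" using a b u by (intro mult_left_mono) auto
    finally show "norm (G (L u)) \<le> (b * a) * norm u" by (simp add: mult.assoc)
  qed (simp_all add: L G)
qed

lemma cdual_compose: "bounded_clinear_on Z W L \<Longrightarrow> \<phi> \<in> cdual W \<Longrightarrow> (\<lambda>z. \<phi> (L z)) \<in> cdual Z"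
  unfolding cdual_eq_bounded_clinear_on by (rule bounded_clinear_on_compose)

lemma topspace_weak_topology [simp]: "topspace (weak_topology Z) = Z"
proof -
  have "{z \<in> Z. (0::complex) \<in> UNIV} \<in> {{z \<in> Z. \<phi> z \<in> U} | \<phi> U. \<phi> \<in> cdual Z \<and> open U}"
    using cdual_zero[of Z] by blast
  then show ?thesis unfolding weak_topology_def topology_generated_by_topspace by auto
qed

lemma openin_weak_topology:
  "\<phi> \<in> cdual Z \<Longrightarrow> open U \<Longrightarrow> openin (weak_topology Z) {z \<in> Z. \<phi> z \<in> U}"
  unfolding weak_topology_def by (rule topology_generated_by_Basis) blast

lemma closedin_weak_topology:
  assumes "\<phi> \<in> cdual Z" "closed C"
  shows "closedin (weak_topology Z) {z \<in> Z. \<phi> z \<in> C}"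
proof -
  have "openin (weak_topology Z) {z \<in> Z. \<phi> z \<in> - C}" using assms by (intro openin_weak_topology) auto
  moreover have "{z \<in> Z. \<phi> z \<in> - C} = Z - {z \<in> Z. \<phi> z \<in> C}" by auto
  ultimately show ?thesis by (simp add: closedin_def)
qed

lemma Hausdorff_space_weak_topology:
  assumes "\<And>u v. u \<in> Z \<Longrightarrow> v \<in> Z \<Longrightarrow> u \<noteq> v \<Longrightarrow> \<exists>\<phi>\<in>cdual Z. \<phi> u \<noteq> \<phi> v"
  shows "Hausdorff_space (weak_topology Z)"
  unfolding Hausdorff_space_def topspace_weak_topology
proof (intro allI impI)
  fix u v assume uv: "u \<in> Z \<and> v \<in> Z \<and> u \<noteq> v"
  then obtain \<phi> where \<phi>: "\<phi> \<in> cdual Z" "\<phi> u \<noteq> \<phi> v" using assms by blast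
  obtain U V where UV: "open U" "open V" "\<phi> u \<in> U" "\<phi> v \<in> V" "U \<inter> V = {}"
    using hausdorff[OF \<phi>(2)] by blast
  then show "\<exists>U V. openin (weak_topology Z) U \<and> openin (weak_topology Z) V \<and> u \<in> U \<and> v \<in> V \<and> disjnt U V"
    using uv \<phi>
    by (intro exI[of _ "{z \<in> Z. \<phi> z \<in> U}"] exI[of _ "{z \<in> Z. \<phi> z \<in> V}"])
      (auto simp: openin_weak_topology disjnt_def)
qed

lemma continuous_map_into_weak_topology:
  assumes "L ` topspace T \<subseteq> W"
    and "\<And>\<phi> U. \<phi> \<in> cdual W \<Longrightarrow> open U \<Longrightarrow> openin T {z \<in> topspace T. \<phi> (L z) \<in> U}"
  shows "continuous_map T (weak_topology W) L"
  unfolding weak_topology_def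
proof (rule continuous_on_generated_topo)
  fix S assume "S \<in> {{z \<in> W. \<phi> z \<in> U} | \<phi> U. \<phi> \<in> cdual W \<and> open U}"
  then obtain \<phi> U where S: "S = {z \<in> W. \<phi> z \<in> U}" "\<phi> \<in> cdual W" "open U" by blast
  have "L -` S \<inter> topspace T = {z \<in> topspace T. \<phi> (L z) \<in> U}" using assms(1) S by auto
  with assms(2)[OF S(2,3)] show "openin T (L -` S \<inter> topspace T)" by simp
next
  show "L ` topspace T \<subseteq> \<Union> {{z \<in> W. \<phi> z \<in> U} | \<phi> U. \<phi> \<in> cdual W \<and> open U}"
    using assms(1) topspace_weak_topology[of W]
    unfolding weak_topology_def topology_generated_by_topspace by simp
qed

lemma continuous_map_weak_topology:
  assumes "bounded_clinear_on Z W L"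
  shows "continuous_map (weak_topology Z) (weak_topology W) L"
  using bounded_clinear_onD(1)[OF assms] openin_weak_topology[OF cdual_compose[OF assms]]
  by (intro continuous_map_into_weak_topology) auto

lemma relatively_weakly_compact_subset:
  assumes H: "Hausdorff_space (weak_topology W)" and K: "compactin (weak_topology W) K" and S: "S \<subseteq> K"
  shows "relatively_weakly_compact W S"
proof -
  have "closedin (weak_topology W) K" using H K by (rule compactin_imp_closedin)
  then have "weak_topology W closure_of S \<subseteq> K" using S by (intro closure_of_minimal)
  then have "compactin (weak_topology W) (weak_topology W closure_of S)"
    using K by (intro closed_compactin[OF K]) auto
  moreover have "S \<subseteq> W" using compactin_subset_topspace[OF K] S by simp
  ultimately show ?thesis by (simp add: relatively_weakly_compact_def)
qed

text \<open>A bounded operator is continuous for the weak topologies, so the image of the weak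
  closure is compact, and any part of a compact set in a Hausdorff space has compact
  closure.\<close>

lemma relatively_weakly_compact_image:
  assumes H: "Hausdorff_space (weak_topology W)" and L: "bounded_clinear_on Z W L"
    and S: "relatively_weakly_compact Z S" and S': "S' \<subseteq> L ` S"
  shows "relatively_weakly_compact W S'"
proof (rule relatively_weakly_compact_subset[OF H])
  show "compactin (weak_topology W) (L ` (weak_topology Z closure_of S))"
    using S by (intro image_compactin[OF _ continuous_map_weak_topology[OF L]])
      (simp add: relatively_weakly_compact_def)
  have "S \<subseteq> weak_topology Z closure_of S"
    using S by (intro closure_of_subset) (simp add: relatively_weakly_compact_def)
  then show "S' \<subseteq> L ` (weak_topology Z closure_of S)" using S' by blast
qed

lemma cdual_complex_scale: "\<phi> \<in> cdual (UNIV :: complex set) \<Longrightarrow> \<phi> z = z * \<phi> 1"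
proof -
  assume "\<phi> \<in> cdual (UNIV :: complex set)"
  then have "\<phi> (z *\<^sub>C 1) = z * \<phi> 1" unfolding cdual_def by blast
  then show ?thesis by simp
qed

lemma cdual_separates_points:
  fixes u v :: "'x::complex_normed_vector"
  assumes "u \<noteq> v"
  shows "\<exists>\<phi>\<in>cdual UNIV. \<phi> u \<noteq> \<phi> v"
proof -
  obtain \<phi> where \<phi>: "\<phi> \<in> cdual UNIV" "\<phi> (u - v) = of_real (norm (u - v))"
    using norming_functional_exists[of "u - v"] by blast
  have "\<phi> u = \<phi> ((u - v) + v)" by simp
  also have "\<dots> = \<phi> (u - v) + \<phi> v" using \<phi>(1) unfolding cdual_def by blast
  finally have "\<phi> u \<noteq> \<phi> v" using \<phi>(2) \<open>u \<noteq> v\<close> by simp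
  with \<phi>(1) show ?thesis by blast
qed

lemma Hausdorff_weak_topology_UNIV:
  "Hausdorff_space (weak_topology (UNIV :: 'x::complex_normed_vector set))"
  by (rule Hausdorff_space_weak_topology) (rule cdual_separates_points)

lemma relatively_weakly_compact_cball:
  "relatively_weakly_compact UNIV (cball (0::complex) 1)"
proof (rule relatively_weakly_compact_subset[OF Hausdorff_weak_topology_UNIV])
  have "continuous_map euclidean (weak_topology UNIV) (\<lambda>z::complex. z)"
  proof (rule continuous_map_into_weak_topology)
    fix \<phi> :: "complex \<Rightarrow> complex" and U :: "complex set" assume "\<phi> \<in> cdual UNIV" "open U"
    then obtain c where "\<phi> = (\<lambda>z. z * c)" using cdual_complex_scale by blast
    then have "continuous_on UNIV \<phi>" by (auto intro!: continuous_intros)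
    with \<open>open U\<close> show "openin euclidean {z \<in> topspace euclidean. \<phi> z \<in> U}"
      using open_vimage[of U \<phi>] by (simp add: vimage_def)
  qed simp
  then have "compactin (weak_topology UNIV) ((\<lambda>z. z) ` cball (0::complex) 1)"
    by (rule image_compactin[rotated]) simp
  then show "compactin (weak_topology UNIV) (cball (0::complex) 1)" by simp
qed simp

text \<open>The finite intersection property is applied to the weakly closed sets that eventually
  contain the sequence. A cluster point in this sense suffices, and no convergent subsequence is
  extracted.\<close>

lemma weak_cluster_point:
  assumes S: "relatively_weakly_compact Z S" and p: "\<And>n::nat. p n \<in> S"
  shows "\<exists>x\<in>Z. \<forall>\<phi>\<in>cdual Z. \<forall>C. closed C \<longrightarrow> eventually (\<lambda>n. \<phi> (p n) \<in> C) sequentially \<longrightarrow> \<phi> x \<in> C"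
proof -
  let ?T = "weak_topology Z"
  define K where "K = ?T closure_of S"
  define I where "I = {(\<phi>, C). \<phi> \<in> cdual Z \<and> closed C \<and> eventually (\<lambda>n. \<phi> (p n) \<in> C) sequentially}"
  define W where "W i = {z \<in> Z. fst i z \<in> snd i}" for i :: "('a \<Rightarrow> complex) \<times> complex set"
  define \<U> where "\<U> = W ` I"
  have SZ: "S \<subseteq> Z" and K: "compactin ?T K" using S by (auto simp: relatively_weakly_compact_def K_def)
  have SK: "S \<subseteq> K" unfolding K_def using SZ by (intro closure_of_subset) simp
  have cl: "closedin ?T D" if "D \<in> \<U>" for D 
    using that closedin_weak_topology by (auto simp: \<U>_def I_def W_def)
  have ev: "eventually (\<lambda>n. p n \<in> D) sequentially" if "D \<in> \<U>" for D
  proof -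
    obtain i where i: "i \<in> I" "D = W i" using \<open>D \<in> \<U>\<close> by (auto simp: \<U>_def)
    then have "eventually (\<lambda>n. fst i (p n) \<in> snd i) sequentially" by (auto simp: I_def)
    then show ?thesis by eventually_elim (use i(2) p SZ in \<open>auto simp: W_def\<close>)
  qed
  have fin: "K \<inter> \<Inter> \<F> \<noteq> {}" if "finite \<F>" "\<F> \<subseteq> \<U>" for \<F>
  proof -
    have "eventually (\<lambda>n. \<forall>D\<in>\<F>. p n \<in> D) sequentially"
      using that ev by (auto simp: eventually_ball_finite_distrib)
    then obtain n where "\<forall>D\<in>\<F>. p n \<in> D" using eventually_happens' sequentially_bot by blast
    then show ?thesis using p[of n] SK by blast
  qed
  have "K \<inter> \<Inter> \<U> \<noteq> {}"
    by (rule K[unfolded compactin_fip, THEN conjunct2, rule_format]) (use cl fin in simp)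
  then obtain x where x: "x \<in> K" "x \<in> \<Inter> \<U>" by blast
  have xZ: "x \<in> Z" using compactin_subset_topspace[OF K] x by auto
  show ?thesis
  proof (intro bexI[OF _ xZ] ballI allI impI)
    fix \<phi> C assume "\<phi> \<in> cdual Z" "closed C" "eventually (\<lambda>n. \<phi> (p n) \<in> C) sequentially"
    then have "(\<phi>, C) \<in> I" by (simp add: I_def)
    then have "x \<in> W (\<phi>, C)" using x(2) by (auto simp: \<U>_def)
    then show "\<phi> x \<in> C" by (simp add: W_def)
  qed
qed

text \<open>\<open>K\<close> may fail to be sequentially compact, so the point is a cluster point of
  the image filter, tested by real continuous functions.\<close>

lemma compact_cluster_point:
  fixes t :: "nat \<Rightarrow> 'k::topological_space"
  assumes "compact (UNIV :: 'k set)"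
  obtains l where "\<And>(g :: 'k \<Rightarrow> real) c. continuous_on UNIV g \<Longrightarrow> eventually (\<lambda>n. g (t n) \<le> c) sequentially \<Longrightarrow> g l \<le> c"
proof -
  define F where "F = filtermap t sequentially"
  have "F \<noteq> bot" by (simp add: F_def filtermap_bot_iff)
  then obtain l where l: "inf (nhds l) F \<noteq> bot" 
    using assms[unfolded compact_filter, rule_format, of F] by auto
  show ?thesis
  proof (rule that[of l], rule ccontr)
    fix g :: "'k \<Rightarrow> real" and c
    assume g: "continuous_on UNIV g" and ev: "eventually (\<lambda>n. g (t n) \<le> c) sequentially" and "\<not> g l \<le> c"
    then have "open {u. c < g u}" "l \<in> {u. c < g u}" by (auto intro!: open_Collect_less continuous_intros)
    then have 1: "eventually (\<lambda>u. c < g u) (nhds l)" by (auto simp: eventually_nhds)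
    have 2: "eventually (\<lambda>u. g u \<le> c) F" using ev by (simp add: F_def eventually_filtermap)
    have "eventually (\<lambda>u. False) (inf (nhds l) F)"
      unfolding eventually_inf using 1 2 by (intro exI conjI) auto
    with l show False by (simp add: trivial_limit_def)
  qed
qed

section \<open>The norm of a polynomial\<close>

lemma poly_norm_upper:
  assumes "csubspace Z" "polynomial_on Z P" "z \<in> Z" "norm z \<le> 1"
  shows "norm (P z) \<le> poly_norm Z P"
proof -
  obtain C where "\<And>z. z \<in> Z \<Longrightarrow> norm z \<le> 1 \<Longrightarrow> norm (P z) \<le> C"
    using polynomial_on_bounded[OF assms(1,2)] by blast
  then show ?thesis
    unfolding poly_norm_def using assms by (intro cSUP_upper bdd_aboveI2[of _ _ C]) auto
qed

lemma poly_norm_least: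
  assumes "csubspace Z" "\<And>z. z \<in> Z \<Longrightarrow> norm z \<le> 1 \<Longrightarrow> norm (P z) \<le> c"
  shows "poly_norm Z P \<le> c"
proof -
  have "0 \<in> Z \<inter> cball 0 1" using csubspace_0[OF assms(1)] by simp
  then show ?thesis unfolding poly_norm_def using assms(2) by (intro cSUP_least) auto
qed

lemma poly_norm_approx:
  assumes "csubspace Z" "c < poly_norm Z P"
  shows "\<exists>z\<in>Z. norm z \<le> 1 \<and> c < norm (P z)"
proof (rule ccontr)
  assume "\<not> ?thesis"
  then have "poly_norm Z P \<le> c" by (intro poly_norm_least[OF assms(1)]) auto
  with assms(2) show False by simp
qed

lemma polynomial_on_id:
  assumes "csubspace Z"
  shows "polynomial_on Z (\<lambda>z. z)"
proof (rule polynomial_on_homogeneous)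
  have "bounded_multilinear_on 1 Z (\<lambda>z. z 0)"
    unfolding bounded_multilinear_on_def
  proof (intro conjI exI[of _ 1])
    show "(\<lambda>z. z 0) \<in> ({..<1::nat} \<rightarrow>\<^sub>E Z) \<rightarrow> Z" by (auto simp: PiE_iff)
  qed auto
  then show "homogeneous_polynomial_on 1 Z (\<lambda>z. z)"
    unfolding homogeneous_polynomial_on_def by (intro exI[of _ "\<lambda>z. z 0"] conjI) auto
qed

text \<open>The upper estimate is the triangle inequality. If \<open>poly_norm Z P\<close> is not
  positive, then \<open>P e = 0\<close> and the unit vector \<open>e\<close> settles the lower
  one.\<close>

lemma polynomial_Daugavet_propertyI:
  assumes Z: "csubspace Z" and e: "e \<in> Z" "norm e = 1"
    and *: "\<And>P \<epsilon>. weakly_compact_polynomial_on Z P \<Longrightarrow> 0 < poly_norm Z P \<Longrightarrow> 0 < \<epsilon> \<Longrightarrow>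
      \<exists>z\<in>Z. norm z \<le> 1 \<and> 1 + poly_norm Z P - \<epsilon> \<le> norm (z + P z)"
  shows "polynomial_Daugavet_property Z"
  unfolding polynomial_Daugavet_property_def
proof (intro allI impI antisym)
  fix P assume wc: "weakly_compact_polynomial_on Z P"
  then have P: "polynomial_on Z P" by (simp add: weakly_compact_polynomial_on_def)
  have IP: "polynomial_on Z (\<lambda>z. z + P z)" by (intro polynomial_on_add polynomial_on_id P Z)
  show "poly_norm Z (\<lambda>z. z + P z) \<le> 1 + poly_norm Z P"
    using poly_norm_upper[OF Z P] by (intro poly_norm_least[OF Z]) (meson add_mono norm_triangle_le)
  show "1 + poly_norm Z P \<le> poly_norm Z (\<lambda>z. z + P z)"
  proof (cases "0 < poly_norm Z P")
    case True
    show ?thesis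
    proof (rule field_le_epsilon)
      fix \<epsilon> :: real assume "\<epsilon> > 0"
      then obtain z where "z \<in> Z" "norm z \<le> 1" "1 + poly_norm Z P - \<epsilon> \<le> norm (z + P z)"
        using *[OF wc True] by blast
      with poly_norm_upper[OF Z IP, of z] show "1 + poly_norm Z P \<le> poly_norm Z (\<lambda>z. z + P z) + \<epsilon>" by simp
    qed
  next
    case False
    have "norm (P e) \<le> poly_norm Z P" using e by (intro poly_norm_upper[OF Z P]) auto
    then have "norm (P e) \<le> 0" using False by linarith
    then have "P e = 0" by simp
    then have "norm (e + P e) = 1" using e by simp
    then have "1 \<le> poly_norm Z (\<lambda>z. z + P z)" using poly_norm_upper[OF Z IP e(1)] e by simp
    then show ?thesis using False by simp
  qed
qed

section \<open>Function spaces\<close>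

lemma cdual_bound:
  assumes "\<phi> \<in> cdual Z"
  obtains M where "M \<ge> 0" "\<And>u. u \<in> Z \<Longrightarrow> cmod (\<phi> u) \<le> M * norm u"
  using bounded_clinear_on_bound[of Z UNIV \<phi>] assms by (auto simp: cdual_eq_bounded_clinear_on)

lemma cdual_add: "\<phi> \<in> cdual Z \<Longrightarrow> u \<in> Z \<Longrightarrow> v \<in> Z \<Longrightarrow> \<phi> (u + v) = \<phi> u + \<phi> v"
  and cdual_scale: "\<phi> \<in> cdual Z \<Longrightarrow> u \<in> Z \<Longrightarrow> \<phi> (c *\<^sub>C u) = c * \<phi> u"
  unfolding cdual_def by blast+

lemma cdual_bounded_linear:
  assumes "\<phi> \<in> cdual UNIV"
  shows "bounded_linear \<phi>"
proof -
  obtain M where "\<And>u. cmod (\<phi> u) \<le> M * norm u" using cdual_bound[OF assms] by auto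
  then show ?thesis
    by (intro bounded_linear_intro[of _ M])
      (simp_all add: cdual_add[OF assms] scaleR_scaleC cdual_scale[OF assms] mult.commute)
qed

locale function_space =
  fixes A :: "('k::t2_space \<Rightarrow>\<^sub>C complex) set" and Z :: "('k \<Rightarrow>\<^sub>C 'x::complex_normed_vector) set"
  assumes compact_UNIV: "compact (UNIV :: 'k set)" and function_space: "function_space_over A Z"
begin

lemma csubspace_Z: "csubspace Z"
  and uniform_algebra_A: "uniform_algebra A"
  and tensor_in: "a \<in> A \<Longrightarrow> tensor_bcontfun a x \<in> Z"
  and cmult_in: "a \<in> A \<Longrightarrow> f \<in> Z \<Longrightarrow> cmult_bcontfun a f \<in> Z"
  using function_space unfolding function_space_over_def by blast+

lemma A_iff: "g \<in> A \<longleftrightarrow> (\<exists>\<phi>\<in>cdual UNIV. \<exists>f\<in>Z. apply_bcontfun g = \<phi> \<circ> apply_bcontfun f)"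
  using function_space unfolding function_space_over_def by blast

sublocale algebra: function_algebra "apply_bcontfun ` A"
proof
  show "compact (UNIV :: 'k set)" by (rule compact_UNIV)
  have A: "csubspace A" "closed A" "\<And>f g. f \<in> A \<Longrightarrow> g \<in> A \<Longrightarrow> cmult_bcontfun f g \<in> A"
    "\<And>c. const_bcontfun c \<in> A" "\<And>s t. s \<noteq> t \<Longrightarrow> \<exists>f\<in>A. apply_bcontfun f s \<noteq> apply_bcontfun f t"
    using uniform_algebra_A unfolding uniform_algebra_def by blast+
  show "continuous_on UNIV f" if "f \<in> apply_bcontfun ` A" for f using that by auto
  show "(\<lambda>_. c) \<in> apply_bcontfun ` A" for c
    by (rule image_eqI[OF _ A(4)[of c]]) (simp add: fun_eq_iff)
  show "(\<lambda>t. f t + g t) \<in> apply_bcontfun ` A" if fg: "f \<in> apply_bcontfun ` A" "g \<in> apply_bcontfun ` A" for f g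
  proof -
    obtain a b where "a \<in> A" "b \<in> A" "f = apply_bcontfun a" "g = apply_bcontfun b" using fg by blast
    then show ?thesis by (intro image_eqI[OF _ csubspace_add[OF A(1), of a b]]) (auto simp: fun_eq_iff)
  qed
  show "(\<lambda>t. f t * g t) \<in> apply_bcontfun ` A" if fg: "f \<in> apply_bcontfun ` A" "g \<in> apply_bcontfun ` A" for f g
  proof -
    obtain a b where "a \<in> A" "b \<in> A" "f = apply_bcontfun a" "g = apply_bcontfun b" using fg by blast
    then show ?thesis by (intro image_eqI[OF _ A(3)[of a b]]) (auto simp: fun_eq_iff cmult_bcontfun.rep_eq)
  qed
  show "\<exists>f\<in>apply_bcontfun ` A. f s \<noteq> f t" if "s \<noteq> t" for s t using A(5)[OF that] by blast
  fix f and l :: "'k \<Rightarrow> complex"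
  assume f: "\<And>n::nat. f n \<in> apply_bcontfun ` A" and l: "uniform_limit UNIV f l sequentially"
  have "\<forall>n. \<exists>a. a \<in> A \<and> f n = apply_bcontfun a" using f by blast
  then obtain a where a: "\<And>n. a n \<in> A" "\<And>n. f n = apply_bcontfun (a n)" by metis
  have "uniform_limit UNIV (\<lambda>n. apply_bcontfun (a n)) l sequentially" using l a(2) by (metis (no_types, lifting) ext)
  then obtain l' where l': "l = apply_bcontfun l'" "a \<longlonglongrightarrow> l'"
    by (rule uniform_limit_bcontfunE) auto
  have "l' \<in> A" using closed_sequentially[OF A(2) a(1) l'(2)] .
  with l' show "l \<in> apply_bcontfun ` A" by blast
qed

lemma eval_clinear: "bounded_clinear_on Z UNIV (\<lambda>f. apply_bcontfun f t)"
  by (rule bounded_clinear_onI[of _ _ _ 1]) (auto simp: scaleC_bcontfun.rep_eq norm_bounded)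

lemma eval_cdual: "\<phi> \<in> cdual UNIV \<Longrightarrow> (\<lambda>f. \<phi> (apply_bcontfun f t)) \<in> cdual Z"
  by (rule cdual_compose[OF eval_clinear])

lemma tensor_clinear:
  assumes "a \<in> A"
  shows "bounded_clinear_on UNIV Z (tensor_bcontfun a)"
proof (rule bounded_clinear_onI[of _ _ _ "norm a"])
  show "norm (tensor_bcontfun a x) \<le> norm a * norm x" for x :: 'x
    by (rule norm_bound) (simp add: tensor_bcontfun.rep_eq norm_scaleC norm_bounded mult_right_mono)
qed (auto simp: tensor_in[OF assms] tensor_bcontfun.rep_eq scaleC_bcontfun.rep_eq scaleC_add_right
      scaleC_scaleC mult.commute intro!: bcontfun_eqI)

lemma functional_in_algebra:
  assumes \<phi>: "\<phi> \<in> cdual UNIV" and f: "f \<in> Z"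
  shows "(\<lambda>t. \<phi> (apply_bcontfun f t)) \<in> apply_bcontfun ` A"
proof -
  obtain M where M: "M \<ge> 0" "\<And>x. cmod (\<phi> x) \<le> M * norm x" using cdual_bound[OF \<phi>] by auto
  have "(\<phi> \<circ> apply_bcontfun f) \<in> bcontfun"
  proof (rule bcontfun_normI)
    show "continuous_on UNIV (\<phi> \<circ> apply_bcontfun f)"
      using bounded_linear.continuous_on[OF cdual_bounded_linear[OF \<phi>], of UNIV "apply_bcontfun f"]
      by (simp add: o_def)
    show "cmod ((\<phi> \<circ> apply_bcontfun f) t) \<le> M * norm f" for t
      using M(2)[of "apply_bcontfun f t"] mult_left_mono[OF norm_bounded[of f t] M(1)] by simp
  qed
  then obtain g where "\<phi> \<circ> apply_bcontfun f = apply_bcontfun g" by (rule bcontfunE)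
  moreover from this have "g \<in> A" unfolding A_iff using \<phi> f by (intro bexI[of _ \<phi>] bexI[of _ f]) auto
  ultimately show ?thesis by (intro image_eqI[of _ _ g]) (auto simp: o_def)
qed

lemma Hausdorff_weak_topology_Z: "Hausdorff_space (weak_topology Z)"
proof (rule Hausdorff_space_weak_topology)
  fix u v :: "'k \<Rightarrow>\<^sub>C 'x" assume "u \<noteq> v"
  then obtain t where "apply_bcontfun u t \<noteq> apply_bcontfun v t" by (metis bcontfun_eqI)
  then obtain \<phi> where "\<phi> \<in> cdual UNIV" "\<phi> (apply_bcontfun u t) \<noteq> \<phi> (apply_bcontfun v t)"
    using cdual_separates_points by blast
  then show "\<exists>\<phi>\<in>cdual Z. \<phi> u \<noteq> \<phi> v"
    by (intro bexI[of _ "\<lambda>f. \<phi> (apply_bcontfun f t)"] eval_cdual)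
qed

text \<open>That \<open>X\<close> is nonzero is hidden in the description of \<open>A\<close>: the
  constant \<open>1\<close> has the form \<open>\<phi> \<circ> f\<close>.\<close>

lemma unit_vector_exists: "\<exists>x::'x. norm x = 1"
proof -
  obtain b where b: "b \<in> A" "apply_bcontfun b = (\<lambda>_. 1)" using algebra.const[of 1] by (metis imageE)
  then obtain \<phi> and f :: "'k \<Rightarrow>\<^sub>C 'x" where \<phi>: "\<phi> \<in> cdual UNIV" "apply_bcontfun b = \<phi> \<circ> apply_bcontfun f"
    using A_iff[THEN iffD1, OF b(1)] by blast
  define x where "x = apply_bcontfun f undefined"
  have "\<phi> x = 1" using \<phi>(2) b(2) by (metis comp_apply x_def)
  moreover have "\<phi> 0 = 0" using cdual_scale[OF \<phi>(1), of 0 0] by simp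
  ultimately have "x \<noteq> 0" by auto
  then show ?thesis by (intro exI[of _ "sgn x"]) (simp add: norm_sgn)
qed

lemma norm_tensor_one:
  assumes "a \<in> A" "apply_bcontfun a = (\<lambda>_. 1)"
  shows "norm (tensor_bcontfun a x :: 'k \<Rightarrow>\<^sub>C 'x) = norm x"
proof (rule antisym)
  have ap: "apply_bcontfun (tensor_bcontfun a x) t = x" for t
    by (simp add: tensor_bcontfun.rep_eq assms scaleC_one)
  show "norm (tensor_bcontfun a x) \<le> norm x" by (rule norm_bound) (simp add: ap)
  show "norm x \<le> norm (tensor_bcontfun a x)"
    using norm_bounded[of "tensor_bcontfun a x" undefined] by (simp add: ap)
qed

lemma unit_function_exists: "\<exists>e\<in>Z. norm e = 1"
proof -
  obtain b where b: "b \<in> A" "apply_bcontfun b = (\<lambda>_. 1)" using algebra.const[of 1] by (metis imageE)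
  obtain x :: 'x where "norm x = 1" using unit_vector_exists by blast
  then show ?thesis using norm_tensor_one[OF b, of x] tensor_in[OF b(1), of x] by metis
qed

text \<open>
  Moving \<open>f\<close> to \<open>y\<close> on small, almost disjoint peak sets inside the region where \<open>\<phi> \<circ> P f\<close> exceeds
  \<open>\<alpha>\<close> hardly changes \<open>P f\<close> at finitely many points.  If \<open>P\<close> always dropped at the new peak points
  \<open>t i\<close>, then iterating would produce functions \<open>f j\<close> with \<open>\<phi> (P (f j) (t i)) > \<alpha>\<close> for \<open>j < i\<close> and
  \<open>\<phi> (P (f j) (t i)) < \<alpha> - \<epsilon>/2\<close> for \<open>i \<le> j\<close>: the double limits of evaluations disagree, which is
  impossible on a relatively weakly compact set of continuous functions.
\<close>

lemma nonisolated_approximation: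
  assumes s: "s \<in> algebra.shilov"
    and iso: "\<And>W. open W \<Longrightarrow> s \<in> W \<Longrightarrow> \<exists>s'\<in>algebra.shilov \<inter> W. s' \<noteq> s"
    and P: "polynomial_on Z P" and wc: "relatively_weakly_compact Z (P ` (Z \<inter> cball 0 1))"
    and \<phi>: "\<phi> \<in> cdual UNIV"
    and f0: "f0 \<in> Z" "norm f0 < 1" and y: "norm y < 1"
    and \<alpha>: "\<alpha> < Re (\<phi> (apply_bcontfun (P f0) s))" and \<epsilon>: "\<epsilon> > 0"
  shows "\<exists>f\<in>Z. norm f < 1 \<and> (\<exists>t. apply_bcontfun f t = y \<and> \<alpha> - \<epsilon> < Re (\<phi> (apply_bcontfun (P f) t)))"
proof (rule ccontr)
  assume "\<not> ?thesis"
  then have "\<not> \<alpha> - \<epsilon> < Re (\<phi> (apply_bcontfun (P f) t))"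
    if "f \<in> Z" "norm f < 1" "apply_bcontfun f t = y" for f t
    using that by blast
  then have drop: "Re (\<phi> (apply_bcontfun (P f) t)) \<le> \<alpha> - \<epsilon>"
    if "f \<in> Z" "norm f < 1" "apply_bcontfun f t = y" for f t
    using that by (simp add: not_less)
  define g where "g f t = Re (\<phi> (apply_bcontfun (P f) t))" for f t
  note PZ = polynomial_on_maps_to[OF csubspace_Z P]
  have g_cont: "continuous_on UNIV (g f)" if "f \<in> Z" for f
    unfolding g_def
    by (intro continuous_intros algebra.continuous functional_in_algebra[OF \<phi>] PZ that)
  have g_open: "open {u. \<alpha> < g f u}" if "f \<in> Z" for f
    by (intro open_Collect_less continuous_intros g_cont[OF that])
  \<comment> \<open>\<open>T\<close> collects the peak points used so far and \<open>W\<close> the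
    room left for later ones. Asking only for \<open>\<alpha> - \<epsilon> / 2\<close> gives a
    strict inequality, which survives small pointwise changes.\<close>
  define inv where "inv f W T \<longleftrightarrow> f \<in> Z \<and> norm f < 1 \<and> open W \<and> s \<in> W \<and> (\<forall>u\<in>W. \<alpha> < g f u) \<and>
      finite T \<and> (\<forall>t\<in>T. g f t < \<alpha> - \<epsilon> / 2)" for f W T
  have step: "\<exists>f' t W'. inv f' W' (insert t T) \<and> t \<in> W \<and> W' \<subseteq> W" if inv: "inv f W T" for f W T
  proof -
    have f: "f \<in> Z" "norm f < 1" and W: "open W" "s \<in> W" "\<And>u. u \<in> W \<Longrightarrow> \<alpha> < g f u"
      and T: "finite T" "\<And>t. t \<in> T \<Longrightarrow> g f t < \<alpha> - \<epsilon> / 2"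
      using inv by (auto simp: inv_def)
    define r where "r = max (norm f) (norm y)"
    have r: "0 \<le> r" "r < 1" using f y by (auto simp: r_def le_max_iff_disj)
    \<comment> \<open>With this choice \<open>(1 + \<kappa>) * r \<le> (1 + r) / 2 < 1\<close>, so
      the overshoot of the peak functions keeps the norm below \<open>1\<close>.\<close>
    define \<kappa> where "\<kappa> = (1 - r) / 2"
    have \<kappa>: "0 < \<kappa>" "\<kappa> \<le> 1" using r by (auto simp: \<kappa>_def)
    have "(1 + \<kappa>) * r = r + \<kappa> * r" by (simp add: algebra_simps)
    also have "\<kappa> * r \<le> \<kappa> * 1" using \<kappa> r by (intro mult_left_mono) auto
    also have "r + \<kappa> * 1 < 1" using r by (simp add: \<kappa>_def field_simps)
    finally have \<kappa>r: "(1 + \<kappa>) * r < 1" by simp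
    obtain h t where h: "\<And>n. h n \<in> apply_bcontfun ` A" "\<And>n. t n \<in> W" "\<And>n::nat. h n (t n) = 1"
      "\<And>n u. cmod (h n u) + cmod (1 - h n u) \<le> 1 + \<kappa>"
      "\<And>S u. finite S \<Longrightarrow> (\<Sum>n\<in>S. cmod (h n u)) \<le> 4"
      using algebra.peak_sequence_exists[OF s iso W(1,2) \<kappa>] by blast
    have "\<forall>n. \<exists>a. a \<in> A \<and> h n = apply_bcontfun a" using h(1) by blast
    then obtain a where a: "\<And>n. a n \<in> A" "\<And>n. h n = apply_bcontfun (a n)" by metis
    \<comment> \<open>Then \<open>f + e n\<close> is the almost convex combination of
      \<open>f\<close> and \<open>y\<close> with weights \<open>1 - h n\<close> and
      \<open>h n\<close>, equal to \<open>y\<close> at \<open>t n\<close>.\<close>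
    define e where "e n = tensor_bcontfun (a n) y - cmult_bcontfun (a n) f" for n
    have eZ: "e n \<in> Z" for n
      unfolding e_def by (intro csubspace_diff[OF csubspace_Z] tensor_in cmult_in a f)
    have e_apply: "apply_bcontfun (e n) u = h n u *\<^sub>C y - h n u *\<^sub>C apply_bcontfun f u" for n u
      by (simp add: e_def tensor_bcontfun.rep_eq cmult_bcontfun.rep_eq a)
    have fe_apply: "apply_bcontfun (f + e n) u = (1 - h n u) *\<^sub>C apply_bcontfun f u + h n u *\<^sub>C y" for n u
    proof -
      have "apply_bcontfun f u = (1 - h n u) *\<^sub>C apply_bcontfun f u + h n u *\<^sub>C apply_bcontfun f u"
        by (simp add: scaleC_add_left[symmetric] scaleC_one)
      then show ?thesis by (simp add: e_apply algebra_simps)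
    qed
    have fe_norm: "norm (f + e n) < 1" for n
    proof -
      have "norm (f + e n) \<le> (1 + \<kappa>) * r"
      proof (rule norm_bound)
        fix u
        have "norm (apply_bcontfun (f + e n) u) \<le> cmod (1 - h n u) * norm (apply_bcontfun f u) + cmod (h n u) * norm y"
          unfolding fe_apply by (metis norm_scaleC norm_triangle_ineq)
        also have "\<dots> \<le> cmod (1 - h n u) * r + cmod (h n u) * r"
          using norm_bounded[of f u] by (intro add_mono mult_left_mono) (auto simp: r_def)
        also have "\<dots> = (cmod (h n u) + cmod (1 - h n u)) * r" by (simp add: algebra_simps)
        also have "\<dots> \<le> (1 + \<kappa>) * r" by (intro mult_right_mono h r)
        finally show "norm (apply_bcontfun (f + e n) u) \<le> (1 + \<kappa>) * r" .
      qed
      with \<kappa>r show ?thesis by simp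
    qed
    have e_sum: "norm (\<Sum>n\<in>S. e n) \<le> 4 * (norm y + norm f)" if S: "finite S" for S
    proof (rule norm_bound)
      fix u
      have sum_apply: "apply_bcontfun (\<Sum>n\<in>S. e n) u = (\<Sum>n\<in>S. apply_bcontfun (e n) u)"
        by (induction S rule: infinite_finite_induct) auto
      have "norm (apply_bcontfun (e n) u) \<le> cmod (h n u) * (norm y + norm f)" for n
      proof -
        have "norm (apply_bcontfun (e n) u) \<le> cmod (h n u) * norm y + cmod (h n u) * norm (apply_bcontfun f u)"
          unfolding e_apply by (metis norm_scaleC norm_triangle_ineq4)
        also have "\<dots> \<le> cmod (h n u) * norm y + cmod (h n u) * norm f"
          by (intro add_left_mono mult_left_mono norm_bounded) auto
        finally show ?thesis by (simp add: algebra_simps)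
      qed
      then have "norm (\<Sum>n\<in>S. apply_bcontfun (e n) u) \<le> (\<Sum>n\<in>S. cmod (h n u) * (norm y + norm f))"
        by (intro sum_norm_le) auto
      also have "\<dots> = (\<Sum>n\<in>S. cmod (h n u)) * (norm y + norm f)" by (simp add: sum_distrib_right)
      also have "\<dots> \<le> 4 * (norm y + norm f)" by (intro mult_right_mono h S) auto
      finally show "norm (apply_bcontfun (\<Sum>n\<in>S. e n) u) \<le> 4 * (norm y + norm f)" by (simp add: sum_apply)
    qed
    have lim: "(\<lambda>n. g (f + e n) u) \<longlonglongrightarrow> g f u" for u
    proof -
      have dual: "(\<lambda>f. \<phi> (apply_bcontfun f u)) \<in> cdual Z" by (rule eval_cdual[OF \<phi>])
      obtain d where d: "frechet_polynomial_on Z d (\<lambda>f. g f u)"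
        using frechet_polynomial_on_polynomial[OF csubspace_Z P, of "\<lambda>f. Re (\<phi> (apply_bcontfun f u))"]
          cdual_add[OF dual] unfolding g_def by auto
      obtain M where M: "M \<ge> 0" "\<And>f. f \<in> Z \<Longrightarrow> cmod (\<phi> (apply_bcontfun f u)) \<le> M * norm f"
        using cdual_bound[OF dual] by auto
      have bdd: "\<exists>C. \<forall>z\<in>Z. norm z \<le> c \<longrightarrow> \<bar>g z u\<bar> \<le> C" for c
      proof -
        obtain C where C: "\<And>z. z \<in> Z \<Longrightarrow> norm z \<le> c \<Longrightarrow> norm (P z) \<le> C"
          using polynomial_on_bounded[OF csubspace_Z P] by blast
        have "\<bar>g z u\<bar> \<le> M * C" if "z \<in> Z" "norm z \<le> c" for z
        proof -
          have "\<bar>g z u\<bar> \<le> M * norm (P z)"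
            unfolding g_def using abs_Re_le_cmod M(2)[OF PZ[OF that(1)]] by (rule order_trans)
          also have "\<dots> \<le> M * C" using C[OF that] M(1) by (rule mult_left_mono)
          finally show ?thesis .
        qed
        then show ?thesis by blast
      qed
      show ?thesis
        by (rule frechet_polynomial_on_increment_limit[OF csubspace_Z f(1) eZ e_sum d bdd])
    qed
    have "eventually (\<lambda>n. \<forall>t\<in>T. g (f + e n) t < \<alpha> - \<epsilon> / 2) sequentially"
      using T by (auto simp: eventually_ball_finite_distrib intro!: order_tendstoD(2)[OF lim])
    moreover have "eventually (\<lambda>n. \<alpha> < g (f + e n) s) sequentially"
      using W by (intro order_tendstoD(1)[OF lim]) auto
    ultimately have "eventually (\<lambda>n. (\<forall>t\<in>T. g (f + e n) t < \<alpha> - \<epsilon> / 2) \<and> \<alpha> < g (f + e n) s) sequentially"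
      by (rule eventually_conj)
    then obtain n where n: "\<And>t. t \<in> T \<Longrightarrow> g (f + e n) t < \<alpha> - \<epsilon> / 2" "\<alpha> < g (f + e n) s"
      using eventually_happens' sequentially_bot by blast
    have feZ: "f + e n \<in> Z" by (intro csubspace_add[OF csubspace_Z] f eZ)
    have "apply_bcontfun (f + e n) (t n) = y" unfolding fe_apply h(3) by (simp add: scaleC_one)
    then have "g (f + e n) (t n) < \<alpha> - \<epsilon> / 2"
      using drop[OF feZ fe_norm] \<epsilon> unfolding g_def by (smt (verit) field_sum_of_halves)
    \<comment> \<open>Shrinking \<open>W\<close> to the region where the new function exceeds
      \<open>\<alpha>\<close> forces all later peak points into that region.\<close>
    then have "inv (f + e n) (W \<inter> {u. \<alpha> < g (f + e n) u}) (insert (t n) T)"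
      unfolding inv_def using feZ fe_norm W n T g_open[OF feZ] by auto
    then show ?thesis using h(2)[of n] by blast
  qed
  have "\<exists>X. \<forall>n. inv (fst (X n)) (fst (snd (X n))) (snd (snd (X n))) \<and>
      (\<exists>t\<in>fst (snd (X n)). snd (snd (X (Suc n))) = insert t (snd (snd (X n))) \<and>
        fst (snd (X (Suc n))) \<subseteq> fst (snd (X n)))"
  proof (rule dependent_nat_choice)
    have "inv f0 {u. \<alpha> < g f0 u} {}" using f0 \<alpha> g_open[OF f0(1)] by (auto simp: inv_def g_def)
    then show "\<exists>X. inv (fst X) (fst (snd X)) (snd (snd X))" by (metis fst_conv snd_conv)
  next
    fix X :: "('k \<Rightarrow>\<^sub>C 'x) \<times> 'k set \<times> 'k set" and n :: nat
    assume "inv (fst X) (fst (snd X)) (snd (snd X))"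
    from step[OF this] obtain f' t W' where "inv f' W' (insert t (snd (snd X)))" "t \<in> fst (snd X)" "W' \<subseteq> fst (snd X)"
      by blast
    then show "\<exists>X'. inv (fst X') (fst (snd X')) (snd (snd X')) \<and>
        (\<exists>t\<in>fst (snd X). snd (snd X') = insert t (snd (snd X)) \<and> fst (snd X') \<subseteq> fst (snd X))"
      by (intro exI[of _ "(f', W', insert t (snd (snd X)))"]) auto
  qed
  then obtain X where "\<forall>n. inv (fst (X n)) (fst (snd (X n))) (snd (snd (X n))) \<and>
      (\<exists>t\<in>fst (snd (X n)). snd (snd (X (Suc n))) = insert t (snd (snd (X n))) \<and>
        fst (snd (X (Suc n))) \<subseteq> fst (snd (X n)))" by blast
  moreover define f W T where "f n = fst (X n)" and "W n = fst (snd (X n))" and "T n = snd (snd (X n))" for n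
  ultimately have inv: "\<And>n. inv (f n) (W n) (T n)"
    and ex: "\<forall>n. \<exists>t. t \<in> W n \<and> T (Suc n) = insert t (T n) \<and> W (Suc n) \<subseteq> W n" by auto
  from ex obtain t where t: "\<And>n. t n \<in> W n" "\<And>n. T (Suc n) = insert (t n) (T n)" "\<And>n. W (Suc n) \<subseteq> W n" by metis
  have Wdec: "W j \<subseteq> W i" if "i \<le> j" for i j by (rule lift_Suc_antimono_le[of W, OF t(3) that])
  have Tinc: "T i \<subseteq> T j" if "i \<le> j" for i j by (rule lift_Suc_mono_le[of T, OF _ that]) (use t(2) in blast)
  have fZ: "f n \<in> Z" "norm (f n) < 1" for n using inv by (auto simp: inv_def)
  have upper: "\<alpha> < g (f j) (t i)" if "j \<le> i" for i j
    using inv[of j] Wdec[OF that] t(1)[of i] by (auto simp: inv_def)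
  have lower: "g (f j) (t i) < \<alpha> - \<epsilon> / 2" if "i < j" for i j
    using inv[of j] Tinc[of "Suc i" j] t(2)[of i] that by (auto simp: inv_def)
  \<comment> \<open>Compared at the cluster points \<open>l\<close> of \<open>t\<close> and
    \<open>x\<close> of \<open>P (f n)\<close>: letting \<open>i\<close> grow before
    \<open>j\<close> gives at least \<open>\<alpha>\<close>, and the opposite order gives at most
    \<open>\<alpha> - \<epsilon> / 2\<close>.\<close>
  obtain l where l: "\<And>(q :: 'k \<Rightarrow> real) c. continuous_on UNIV q \<Longrightarrow> eventually (\<lambda>n. q (t n) \<le> c) sequentially \<Longrightarrow> q l \<le> c"
    using compact_cluster_point[OF compact_UNIV, of t] by blast
  have "P (f n) \<in> P ` (Z \<inter> cball 0 1)" for n using fZ[of n] by auto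
  from weak_cluster_point[where p = "\<lambda>n. P (f n)", OF wc this] obtain x where xZ: "x \<in> Z"
    and x': "\<forall>\<psi>\<in>cdual Z. \<forall>C. closed C \<longrightarrow> eventually (\<lambda>n. \<psi> (P (f n)) \<in> C) sequentially \<longrightarrow> \<psi> x \<in> C"
    by (elim bexE) (rule that)
  have x: "\<psi> x \<in> C" if "\<psi> \<in> cdual Z" "closed C" "eventually (\<lambda>n. \<psi> (P (f n)) \<in> C) sequentially" for \<psi> C
    using x'[rule_format, OF that] .
  have "\<alpha> \<le> g (f j) l" for j
  proof -
    have "- g (f j) l \<le> - \<alpha>"
    proof (rule l[of "\<lambda>u. - g (f j) u"])
      show "continuous_on UNIV (\<lambda>u. - g (f j) u)" by (intro continuous_intros g_cont fZ)
      show "eventually (\<lambda>n. - g (f j) (t n) \<le> - \<alpha>) sequentially"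
        using eventually_ge_at_top[of j] by eventually_elim (use upper[of j] in \<open>simp add: less_imp_le\<close>)
    qed
    then show ?thesis by simp
  qed
  then have "\<phi> (apply_bcontfun x l) \<in> {w. \<alpha> \<le> Re w}"
    by (intro x[of "\<lambda>f. \<phi> (apply_bcontfun f l)"] eval_cdual \<phi>)
      (auto simp: g_def intro!: closed_Collect_le continuous_intros)
  moreover have "Re (\<phi> (apply_bcontfun x (t i))) \<le> \<alpha> - \<epsilon> / 2" for i
  proof -
    have "eventually (\<lambda>n. \<phi> (apply_bcontfun (P (f n)) (t i)) \<in> {w. Re w \<le> \<alpha> - \<epsilon> / 2}) sequentially"
      using eventually_gt_at_top[of i] by eventually_elim (use lower[of i] in \<open>simp add: g_def less_imp_le\<close>)
    then have "\<phi> (apply_bcontfun x (t i)) \<in> {w. Re w \<le> \<alpha> - \<epsilon> / 2}"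
      by (intro x[of "\<lambda>f. \<phi> (apply_bcontfun f (t i))"] eval_cdual \<phi>)
        (auto intro!: closed_Collect_le continuous_intros)
    then show ?thesis by simp
  qed
  then have "Re (\<phi> (apply_bcontfun x l)) \<le> \<alpha> - \<epsilon> / 2"
    by (intro l[of "\<lambda>u. Re (\<phi> (apply_bcontfun x u))"] continuous_intros algebra.continuous
        functional_in_algebra[OF \<phi>] xZ) auto
  ultimately show False using \<epsilon> by simp
qed

text \<open>Replacing the value of \<open>f0\<close> at \<open>s\<close> by \<open>x\<close> and
  evaluating \<open>P\<close> there defines a weakly compact polynomial \<open>R\<close> on
  \<open>X\<close>. Its norm is at least that of \<open>P f0\<close> at \<open>s\<close>, and the
  property of \<open>X\<close> applied to \<open>R\<close> supplies the new value.\<close>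

lemma isolated_approximation:
  assumes e: "e \<in> A" "apply_bcontfun e = (\<lambda>t. if t = s then 1 else 0)"
    and X: "polynomial_Daugavet_property (UNIV :: 'x set)"
    and P: "polynomial_on Z P" and wc: "relatively_weakly_compact Z (P ` (Z \<inter> cball 0 1))"
    and f0: "f0 \<in> Z" "norm f0 \<le> 1" and \<epsilon>: "\<epsilon> > 0"
  shows "\<exists>f\<in>Z. norm f \<le> 1 \<and> 1 + norm (apply_bcontfun (P f0) s) - \<epsilon> \<le> norm (f + P f)"
proof -
  define c where "c = f0 - cmult_bcontfun e f0"
  have c: "c \<in> Z" unfolding c_def by (intro csubspace_diff[OF csubspace_Z] cmult_in e f0)
  have J_apply: "apply_bcontfun (c + tensor_bcontfun e x) t = (if t = s then x else apply_bcontfun f0 t)" for x t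
    by (simp add: c_def cmult_bcontfun.rep_eq tensor_bcontfun.rep_eq e scaleC_one)
  have J_in: "c + tensor_bcontfun e x \<in> Z" for x by (intro csubspace_add[OF csubspace_Z] c tensor_in e)
  have J_norm: "norm (c + tensor_bcontfun e x) \<le> 1" if "norm x \<le> 1" for x
  proof (rule norm_bound)
    show "norm (apply_bcontfun (c + tensor_bcontfun e x) t) \<le> 1" for t
      unfolding J_apply using that order_trans[OF norm_bounded f0(2)] by simp
  qed
  define R where "R x = apply_bcontfun (P (c + tensor_bcontfun e x)) s" for x
  have R: "polynomial_on UNIV R"
    unfolding R_def by (rule polynomial_on_transport[OF csubspace_UNIV csubspace_Z P c tensor_clinear[OF e(1)] eval_clinear])
  have "relatively_weakly_compact UNIV (R ` (UNIV \<inter> cball 0 1))"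
    by (rule relatively_weakly_compact_image[OF Hausdorff_weak_topology_UNIV eval_clinear[of s] wc])
      (auto simp: R_def J_in intro!: imageI J_norm)
  then have eq: "poly_norm UNIV (\<lambda>x. x + R x) = 1 + poly_norm UNIV R"
    using X R unfolding polynomial_Daugavet_property_def weakly_compact_polynomial_on_def by blast
  have "c + tensor_bcontfun e (apply_bcontfun f0 s) = f0" 
    by (rule bcontfun_eqI) (simp only: J_apply split: if_split, simp)
  then have "R (apply_bcontfun f0 s) = apply_bcontfun (P f0) s" by (simp add: R_def)
  then have "norm (apply_bcontfun (P f0) s) \<le> poly_norm UNIV R"
    using poly_norm_upper[OF csubspace_UNIV R, of "apply_bcontfun f0 s"] order_trans[OF norm_bounded f0(2)] by simp
  then have "1 + norm (apply_bcontfun (P f0) s) - \<epsilon> < poly_norm UNIV (\<lambda>x. x + R x)" using eq \<epsilon> by simp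
  from poly_norm_approx[OF csubspace_UNIV this] obtain x
    where x: "norm x \<le> 1" "1 + norm (apply_bcontfun (P f0) s) - \<epsilon> < norm (x + R x)" by blast
  define f where "f = c + tensor_bcontfun e x"
  have "x + R x = apply_bcontfun (f + P f) s" using J_apply[of x s] by (simp add: R_def f_def)
  then have "norm (x + R x) \<le> norm (f + P f)" using norm_bounded[of "f + P f" s] by simp
  with x J_in[of x] J_norm[of x] show ?thesis unfolding f_def[symmetric] by (intro bexI[of _ f]) auto
qed

lemma Daugavet_property_function_space:
  assumes "polynomial_Daugavet_property (UNIV :: 'x set) \<or>
    \<not> (\<exists>e\<in>A. \<exists>s. apply_bcontfun e = (\<lambda>t. if t = s then 1 else 0))"
  shows "polynomial_Daugavet_property Z"
proof -
  obtain u where u: "u \<in> Z" "norm u = 1" using unit_function_exists by blast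
  show ?thesis
  proof (rule polynomial_Daugavet_propertyI[OF csubspace_Z u])
    fix P and \<epsilon> :: real
    assume P: "weakly_compact_polynomial_on Z P" and pos: "0 < poly_norm Z P" and \<epsilon>: "0 < \<epsilon>"
    have poly: "polynomial_on Z P" and wc: "relatively_weakly_compact Z (P ` (Z \<inter> cball 0 1))"
      using P by (auto simp: weakly_compact_polynomial_on_def)
    define m where "m = poly_norm Z P"
    \<comment> \<open>The second term of the minimum keeps \<open>\<alpha>\<close> positive, which
      the estimates with \<open>norm v > \<alpha>\<close> require.\<close>
    define \<alpha> where "\<alpha> = m - min (\<epsilon> / 4) (m / 2)"
    have \<alpha>: "0 < \<alpha>" "\<alpha> < m" "m - \<epsilon> / 4 \<le> \<alpha>" using pos \<epsilon> by (auto simp: \<alpha>_def m_def min_def)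
    obtain f1 where f1: "f1 \<in> Z" "norm f1 \<le> 1" "\<alpha> < norm (P f1)"
      using poly_norm_approx[OF csubspace_Z, of \<alpha> P] \<alpha>(2) by (auto simp: m_def)
    have "eventually (\<lambda>r. \<alpha> < norm (P (r *\<^sub>R f1))) (at_left 1)"
      by (rule order_tendstoD(1)[OF tendsto_norm[OF polynomial_on_radial_limit[OF csubspace_Z poly f1(1)]] f1(3)])
    moreover have "eventually (\<lambda>r::real. r \<in> {0<..<1}) (at_left 1)" by (rule eventually_at_left_real) simp
    ultimately have "eventually (\<lambda>r. \<alpha> < norm (P (r *\<^sub>R f1)) \<and> r \<in> {0<..<1}) (at_left 1)" by (rule eventually_conj)
    then obtain r where r: "\<alpha> < norm (P (r *\<^sub>R f1))" "0 < r" "r < 1"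
      using eventually_happens'[of "at_left (1::real)"] by fastforce
    define f0 where "f0 = r *\<^sub>R f1"
    have "norm f0 = r * norm f1" using r by (simp add: f0_def)
    also have "\<dots> \<le> r * 1" using r f1 by (intro mult_left_mono) auto
    also have "\<dots> < 1" using r by simp
    finally have "norm f0 < 1" .
    moreover have "f0 \<in> Z" unfolding f0_def scaleR_scaleC by (rule csubspace_scale[OF csubspace_Z f1(1)])
    ultimately have f0: "f0 \<in> Z" "norm f0 < 1" by auto
    have Pf0: "P f0 \<in> Z" by (rule polynomial_on_maps_to[OF csubspace_Z poly f0(1)])
    have "continuous_on UNIV (\<lambda>t. norm (apply_bcontfun (P f0) t))" by (intro continuous_intros) auto
    then obtain t1 where t1: "\<And>t. norm (apply_bcontfun (P f0) t) \<le> norm (apply_bcontfun (P f0) t1)"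
      using continuous_attains_sup[OF compact_UNIV] by (metis UNIV_I UNIV_not_empty)
    define v where "v = apply_bcontfun (P f0) t1"
    have "norm (P f0) \<le> norm v" unfolding v_def by (intro norm_bound t1)
    then have v: "\<alpha> < norm v" using r by (simp add: f0_def)
    obtain \<phi> where \<phi>: "\<phi> \<in> cdual UNIV" "\<phi> v = of_real (norm v)" "\<And>x. cmod (\<phi> x) \<le> norm x"
      using norming_functional_exists[of v] by blast
    define a where "a t = \<phi> (apply_bcontfun (P f0) t)" for t
    have aB: "a \<in> apply_bcontfun ` A" unfolding a_def by (rule functional_in_algebra[OF \<phi>(1) Pf0])
    have a_le: "cmod (a t) \<le> norm v" for t
      unfolding a_def v_def using \<phi>(3) t1 by (rule order_trans)
    define U where "U = {t. \<alpha> < Re (a t)}"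
    have "open U"
      unfolding U_def by (intro open_Collect_less continuous_intros algebra.continuous[OF aB])
    \<comment> \<open>Adding the constant \<open>norm v\<close> turns a statement on real parts into
      one on moduli: the sum has modulus \<open>2 * norm v\<close> at \<open>t1\<close> and strictly
      less wherever the real part of \<open>a\<close> is at most \<open>\<alpha>\<close>.\<close>
    moreover have "\<not> algebra.boundary (- U)"
    proof
      assume "algebra.boundary (- U)"
      moreover have "(\<lambda>t. of_real (norm v) + a t) \<in> apply_bcontfun ` A" by (intro algebra.add algebra.const aB)
      ultimately obtain t where t: "t \<in> - U" "cmod (of_real (norm v) + a t1) \<le> cmod (of_real (norm v) + a t)"
        using algebra.boundaryD by blast
      have "a t1 = of_real (norm v)" unfolding a_def v_def[symmetric] by (rule \<phi>(2))
      then have "cmod (of_real (norm v) + a t1) = 2 * norm v"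
        by (simp flip: of_real_add)
      then have "(2 * norm v)\<^sup>2 \<le> (cmod (of_real (norm v) + a t))\<^sup>2" using t(2) by (intro power_mono) auto
      also have "\<dots> = (norm v)\<^sup>2 + 2 * norm v * Re (a t) + (cmod (a t))\<^sup>2"
        unfolding cmod_power2 by (simp add: power2_eq_square algebra_simps)
      also have "(cmod (a t))\<^sup>2 \<le> (norm v)\<^sup>2" using a_le by (intro power_mono) auto
      also have "2 * norm v * Re (a t) \<le> 2 * norm v * \<alpha>" using t(1) by (intro mult_left_mono) (auto simp: U_def)
      also have "2 * norm v * \<alpha> < 2 * norm v * norm v" using v \<alpha> by (intro mult_strict_left_mono) auto
      finally show False by (simp add: power2_eq_square)
    qed
    ultimately obtain s where s: "s \<in> U" "s \<in> algebra.shilov" using algebra.shilov_meets by blast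
    show "\<exists>z\<in>Z. norm z \<le> 1 \<and> 1 + poly_norm Z P - \<epsilon> \<le> norm (z + P z)"
    proof (cases "\<exists>W. open W \<and> algebra.shilov \<inter> W = {s}")
      case True
      then have "(\<lambda>t. if t = s then 1 else 0) \<in> apply_bcontfun ` A"
        using algebra.isolated_shilov_indicator[OF s(2)] by blast
      then obtain e where e: "e \<in> A" "apply_bcontfun e = (\<lambda>t. if t = s then 1 else 0)" by (metis imageE)
      then have X: "polynomial_Daugavet_property (UNIV :: 'x set)" using assms by blast
      have "0 < \<epsilon> / 4" using \<epsilon> by simp
      from isolated_approximation[OF e X poly wc f0(1) less_imp_le[OF f0(2)] this]
      obtain f where f: "f \<in> Z" "norm f \<le> 1" "1 + norm (apply_bcontfun (P f0) s) - \<epsilon> / 4 \<le> norm (f + P f)" by blast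
      have "\<alpha> < Re (a s)" using s by (simp add: U_def)
      also have "\<dots> \<le> norm (apply_bcontfun (P f0) s)"
        unfolding a_def using complex_Re_le_cmod \<phi>(3) by (rule order_trans)
      finally show ?thesis using f \<alpha>(3) \<epsilon> by (intro bexI[of _ f]) (auto simp: m_def)
    next
      case False
      have iso: "\<exists>s'\<in>algebra.shilov \<inter> W. s' \<noteq> s" if "open W" "s \<in> W" for W
        using False s(2) that by blast
      define \<rho> where "\<rho> = max 0 (1 - \<epsilon> / 4)"
      have \<rho>: "0 \<le> \<rho>" "\<rho> < 1" "1 - \<epsilon> / 4 \<le> \<rho>" using \<epsilon> by (auto simp: \<rho>_def)
      have nv: "norm v > 0" using v \<alpha> by linarith
      \<comment> \<open>\<open>y\<close> points in the direction of \<open>v\<close>, so that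
        \<open>\<phi>\<close> adds its value \<open>\<rho>\<close> to the real part of
        \<open>\<phi> (P f t)\<close> without cancellation.\<close>
      define y where "y = (\<rho> / norm v) *\<^sub>R v"
      have y: "norm y < 1" using \<rho> nv by (simp add: y_def)
      have \<phi>y: "\<phi> y = of_real \<rho>"
        using nv by (simp add: y_def scaleR_scaleC cdual_scale[OF \<phi>(1)] \<phi>(2))
      have "\<alpha> < Re (\<phi> (apply_bcontfun (P f0) s))" using s(1) by (simp add: U_def a_def)
      moreover have "0 < \<epsilon> / 4" using \<epsilon> by simp
      ultimately obtain f t where f: "f \<in> Z" "norm f < 1" "apply_bcontfun f t = y"
          "\<alpha> - \<epsilon> / 4 < Re (\<phi> (apply_bcontfun (P f) t))"
        using nonisolated_approximation[OF s(2) iso poly wc \<phi>(1) f0 y] by blast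
      have "1 + m - \<epsilon> \<le> \<rho> + (\<alpha> - \<epsilon> / 4)" using \<rho>(3) \<alpha>(3) \<epsilon> by simp
      also have "\<dots> \<le> Re (\<phi> (apply_bcontfun f t + apply_bcontfun (P f) t))"
        using f(3,4) by (simp add: cdual_add[OF \<phi>(1)] \<phi>y)
      also have "\<dots> \<le> norm (apply_bcontfun (f + P f) t)"
        using order_trans[OF complex_Re_le_cmod \<phi>(3)] by simp
      also have "\<dots> \<le> norm (f + P f)" by (rule norm_bounded)
      finally show ?thesis using f by (intro bexI[of _ f]) (auto simp: m_def)
    qed
  qed
qed

section \<open>Consequences of an atom, and the base algebra as a function space\<close>

text \<open>\<open>Q\<close> lifts \<open>P\<close> to functions supported at \<open>s\<close>. Off
  \<open>s\<close> the function \<open>f + Q f\<close> is just \<open>f\<close>, of norm at most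
  \<open>1\<close>, so a norm beyond \<open>1\<close> has to come from the value at
  \<open>s\<close>, which is that of \<open>x + P x\<close> for \<open>x = f s\<close>.\<close>

lemma indicator_Daugavet_property_range:
  assumes e: "e \<in> A" "apply_bcontfun e = (\<lambda>t. if t = s then 1 else 0)"
    and Z: "polynomial_Daugavet_property Z"
  shows "polynomial_Daugavet_property (UNIV :: 'x set)"
proof -
  obtain u :: 'x where u: "norm u = 1" using unit_vector_exists by blast
  show ?thesis
  proof (rule polynomial_Daugavet_propertyI[OF csubspace_UNIV UNIV_I u])
    fix P :: "'x \<Rightarrow> 'x" and \<epsilon> :: real
    assume P: "weakly_compact_polynomial_on UNIV P" and pos: "0 < poly_norm UNIV P" and \<epsilon>: "0 < \<epsilon>"
    have poly: "polynomial_on UNIV P" and wc: "relatively_weakly_compact UNIV (P ` (UNIV \<inter> cball 0 1))"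
      using P by (auto simp: weakly_compact_polynomial_on_def)
    define Q where "Q f = tensor_bcontfun e (P (0 + apply_bcontfun f s))" for f
    have Q: "polynomial_on Z Q"
      unfolding Q_def by (rule polynomial_on_transport[OF csubspace_Z csubspace_UNIV poly UNIV_I eval_clinear tensor_clinear[OF e(1)]])
    have Q_apply: "apply_bcontfun (Q f) t = (if t = s then P (apply_bcontfun f s) else 0)" for f t
      by (simp add: Q_def tensor_bcontfun.rep_eq e scaleC_one)
    have "relatively_weakly_compact Z (Q ` (Z \<inter> cball 0 1))"
      by (rule relatively_weakly_compact_image[OF Hausdorff_weak_topology_Z tensor_clinear[OF e(1)] wc])
        (auto simp: Q_def intro!: imageI order_trans[OF norm_bounded])
    then have eq: "poly_norm Z (\<lambda>f. f + Q f) = 1 + poly_norm Z Q"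
      using Z Q unfolding polynomial_Daugavet_property_def weakly_compact_polynomial_on_def by blast
    have "poly_norm UNIV P \<le> poly_norm Z Q"
    proof (rule poly_norm_least[OF csubspace_UNIV])
      fix x :: 'x assume x: "norm x \<le> 1"
      define f where "f = tensor_bcontfun e x"
      have f: "f \<in> Z" unfolding f_def by (rule tensor_in[OF e(1)])
      have f_apply: "apply_bcontfun f t = (if t = s then x else 0)" for t
        by (simp add: f_def tensor_bcontfun.rep_eq e scaleC_one)
      have "norm f \<le> 1" by (rule norm_bound) (simp add: f_apply x)
      then have "norm (Q f) \<le> poly_norm Z Q" by (rule poly_norm_upper[OF csubspace_Z Q f])
      moreover have "norm (P x) \<le> norm (Q f)" using norm_bounded[of "Q f" s] by (simp add: Q_apply f_apply)
      ultimately show "norm (P x) \<le> poly_norm Z Q" by simp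
    qed
    \<comment> \<open>The maximum with \<open>1\<close> excludes all points other than
      \<open>s\<close> even when \<open>\<epsilon>\<close> exceeds
      \<open>poly_norm UNIV P\<close>.\<close>
    then have "max 1 (1 + poly_norm UNIV P - \<epsilon>) < poly_norm Z (\<lambda>f. f + Q f)" using eq pos \<epsilon> by simp
    from poly_norm_approx[OF csubspace_Z this] obtain f where f: "f \<in> Z" "norm f \<le> 1"
      and big: "max 1 (1 + poly_norm UNIV P - \<epsilon>) < norm (f + Q f)" by blast
    have "\<exists>t. max 1 (1 + poly_norm UNIV P - \<epsilon>) < norm (apply_bcontfun (f + Q f) t)"
      using norm_bound[of "f + Q f" "max 1 (1 + poly_norm UNIV P - \<epsilon>)"] big by (meson not_le)
    then obtain t where t: "max 1 (1 + poly_norm UNIV P - \<epsilon>) < norm (apply_bcontfun (f + Q f) t)" by blast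
    have fn: "norm (apply_bcontfun f t) \<le> 1" for t using norm_bounded f(2) by (rule order_trans)
    have "t = s" using t fn[of t] by (cases "t = s") (auto simp: Q_apply)
    then show "\<exists>z\<in>UNIV. norm z \<le> 1 \<and> 1 + poly_norm UNIV P - \<epsilon> \<le> norm (z + P z)"
      using t fn[of s] by (intro bexI[of _ "apply_bcontfun f s"]) (auto simp: Q_apply)
  qed
qed

text \<open>Functionals on the scalars are multiplications, so composing with them stays in
  \<open>A\<close>. Every result on function spaces thereby applies to \<open>A\<close>
  itself.\<close>

lemma function_space_algebra: "function_space A A"
proof
  show "compact (UNIV :: 'k set)" by (rule compact_UNIV)
  have A: "csubspace A" "\<And>f g. f \<in> A \<Longrightarrow> g \<in> A \<Longrightarrow> cmult_bcontfun f g \<in> A" "\<And>c. const_bcontfun c \<in> A"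
    using uniform_algebra_A unfolding uniform_algebra_def by blast+
  have tensor: "tensor_bcontfun f c \<in> A" if "f \<in> A" for f and c :: complex
  proof -
    have "tensor_bcontfun f c = cmult_bcontfun f (const_bcontfun c)"
      by (rule bcontfun_eqI) (simp add: tensor_bcontfun.rep_eq cmult_bcontfun.rep_eq)
    then show ?thesis using A(2)[OF that A(3)] by simp
  qed
  have "(g \<in> A) = (\<exists>\<phi>\<in>cdual UNIV. \<exists>f\<in>A. apply_bcontfun g = \<phi> \<circ> apply_bcontfun f)" for g
  proof
    assume "g \<in> A"
    moreover have "(\<lambda>z. z) \<in> cdual (UNIV :: complex set)"
      by (auto simp: cdual_def intro!: exI[of _ 1])
    ultimately show "\<exists>\<phi>\<in>cdual UNIV. \<exists>f\<in>A. apply_bcontfun g = \<phi> \<circ> apply_bcontfun f"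
      by (intro bexI[of _ "\<lambda>z. z"] bexI[of _ g]) auto
  next
    assume "\<exists>\<phi>\<in>cdual UNIV. \<exists>f\<in>A. apply_bcontfun g = \<phi> \<circ> apply_bcontfun f"
    then obtain \<phi> and f :: "'k \<Rightarrow>\<^sub>C complex"
      where \<phi>: "\<phi> \<in> cdual UNIV" "f \<in> A" "apply_bcontfun g = \<phi> \<circ> apply_bcontfun f" by blast
    have "g = tensor_bcontfun f (\<phi> 1)"
      by (rule bcontfun_eqI) (simp add: \<phi>(3) tensor_bcontfun.rep_eq flip: cdual_complex_scale[OF \<phi>(1)])
    with tensor[OF \<phi>(2)] show "g \<in> A" by simp
  qed
  then show "function_space_over A A"
    unfolding function_space_over_def using A tensor uniform_algebra_A by blast
qed

end

text \<open>\<open>f + T f\<close> is \<open>f\<close> with its value at \<open>s\<close> erased,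
  hence of norm at most \<open>1\<close> on the ball, while \<open>T\<close> has norm at least
  \<open>1\<close>. Weak compactness holds because \<open>T\<close> factors through the
  scalars.\<close>

lemma indicator_imp_not_Daugavet_property:
  assumes A: "function_space A A" and e: "e \<in> A" "apply_bcontfun e = (\<lambda>t. if t = s then 1 else 0)"
  shows "\<not> polynomial_Daugavet_property A"
proof
  assume pdp: "polynomial_Daugavet_property A"
  interpret function_space A A by (rule A)
  define G :: "complex \<Rightarrow> _" where "G = tensor_bcontfun ((-1) *\<^sub>C e)"
  have me: "(-1) *\<^sub>C e \<in> A" using csubspace_Z e(1) by (rule csubspace_scale)
  have G: "bounded_clinear_on UNIV A G" unfolding G_def by (rule tensor_clinear[OF me])
  define T where "T f = G (0 + apply_bcontfun f s)" for f
  have T: "polynomial_on A T"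
    unfolding T_def
    by (rule polynomial_on_transport[OF csubspace_Z csubspace_UNIV polynomial_on_id[OF csubspace_UNIV] UNIV_I eval_clinear G])
  have T_apply: "apply_bcontfun (T f) t = (if t = s then - apply_bcontfun f s else 0)" for f t
    by (simp add: T_def G_def tensor_bcontfun.rep_eq scaleC_bcontfun.rep_eq e)
  have "relatively_weakly_compact A (T ` (A \<inter> cball 0 1))"
    by (rule relatively_weakly_compact_image[OF Hausdorff_weak_topology_Z G relatively_weakly_compact_cball])
      (auto simp: T_def intro!: imageI order_trans[OF norm_bounded])
  then have eq: "poly_norm A (\<lambda>f. f + T f) = 1 + poly_norm A T"
    using pdp T unfolding polynomial_Daugavet_property_def weakly_compact_polynomial_on_def by blast
  have "poly_norm A (\<lambda>f. f + T f) \<le> 1"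
  proof (rule poly_norm_least[OF csubspace_Z])
    fix f :: "'a \<Rightarrow>\<^sub>C complex" assume "norm f \<le> 1"
    then have "cmod (apply_bcontfun f t) \<le> 1" for t using norm_bounded[of f t] by simp
    then show "norm (f + T f) \<le> 1" by (intro norm_bound) (simp add: T_apply)
  qed
  moreover have "1 \<le> poly_norm A T"
  proof -
    have "norm e \<le> 1" by (rule norm_bound) (simp add: e)
    then have "norm (T e) \<le> poly_norm A T" by (rule poly_norm_upper[OF csubspace_Z T e(1)])
    moreover have "1 \<le> norm (T e)" using norm_bounded[of "T e" s] by (simp add: T_apply e)
    ultimately show ?thesis by simp
  qed
  ultimately show False using eq by simp
qed

theorem corollary4p12:
  fixes A :: "('k::t2_space \<Rightarrow>\<^sub>C complex) set"
    and AKX :: "('k \<Rightarrow>\<^sub>C 'x::cbanach) set"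
  assumes "compact (UNIV :: 'k set)"
    and "function_space_over A AKX"
  shows "polynomial_Daugavet_property AKX \<longleftrightarrow>
         polynomial_Daugavet_property A \<or> polynomial_Daugavet_property (UNIV :: 'x set)"
proof -
  interpret AKX: function_space A AKX using assms by unfold_locales
  interpret A: function_space A A by (rule AKX.function_space_algebra)
  show ?thesis
  proof (cases "\<exists>e\<in>A. \<exists>s. apply_bcontfun e = (\<lambda>t. if t = s then 1 else 0)")
    case True
    then obtain e s where e: "e \<in> A" "apply_bcontfun e = (\<lambda>t. if t = s then 1 else 0)" by blast
    have "\<not> polynomial_Daugavet_property A"
      by (rule indicator_imp_not_Daugavet_property[OF AKX.function_space_algebra e])
    with AKX.indicator_Daugavet_property_range[OF e] AKX.Daugavet_property_function_space show ?thesis by blast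
  next
    \<comment> \<open>Without atoms both sides of the equivalence hold: the same lemma applies to
      \<open>AKX\<close> and to \<open>A\<close>.\<close>
    case False
    with AKX.Daugavet_property_function_space A.Daugavet_property_function_space show ?thesis by blast
  qed
qed

end
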